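(* Let $U\subseteq\mathbb{C}$ be a connected domain and let $f$ be complex analytic on $U$. Suppose $f(z)$ is not algebraic (over $\mathbb{C}(z)$) and satisfies a strongly minimal algebraic differential equation (with respect to $\frac{d}{dz}$, with coefficients in $\mathbb{C}(z)$) of order at least two. Then $f$ is not $\mathbb{C}$-Pfaffian on $U$, i.e. $f$ cannot be written as a polynomial with complex coefficients in the functions of a $\mathbb{C}$-Pfaffian chain on $U$.
   Context: A $\mathbb{C}$-Pfaffian chain on a domain $U\subseteq\mathbb{C}$ is a tuple $(f_1,\ldots,f_l)$ of complex analytic functions on $U$ for which there exist polynomials $p_i(u,v_1,\ldots,v_i)$ with complex coefficients such that $f_i'(z)=p_i(z,f_1(z),\ldots,f_i(z))$ for $1\le i\le l$. A function is $\mathbb{C}$-Pfaffian if it is a $\mathbb{C}$-polynomial in the functions of some $\mathbb{C}$-Pfaffian chain. All differential fields have characteristic zero. For a differential field $K$ and an element $a$ of a differential field extension, $K\langle a\rangle$ denotes the differential field generated by $a$ over $K$. An algebraic differential equation $P(y,y',\ldots,y^{(h)})=0$ with coefficients in a differential field $K$ (order $h$ = highest derivative occurring) is strongly minimal if its solution set, as a definable set in a differentially closed field extending $K$, is strongly minimal; equivalently: (1) $P$ is irreducible over $K^{alg}$ as a polynomial in several variables, and (2) for every solution $a$ and every differential field extension $F$ of $K$ (with $a$ in a common differential field extension), $\operatorname{trdeg}_F F\langle a\rangle$ equals either $\operatorname{trdeg}_K K\langle a\rangle$ or $0$. *)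

theory Defs
  imports
    "HOL-Complex_Analysis.Complex_Analysis"
    "HOL-Computational_Algebra.Computational_Algebra"
    "HOL-Computational_Algebra.Field_as_Ring"
    "HOL-Algebra.Indexed_Polynomials"
    "HOL-Algebra.Algebraic_Closure_Type"
begin

section \<open>Polynomials in several variables\<close>

text \<open>
  Polynomials over a ring \<open>R\<close> in the variables \<open>I\<close> are the elements of
  \<open>ring.indexed_pset R I (carrier R)\<close>; a polynomial is the function that sends a monomial,
  given as a multiset of variables, to its coefficient.
\<close>

definition mpoly_eval ::
  "('a, 'm) ring_scheme \<Rightarrow> ('i multiset \<Rightarrow> 'a) \<Rightarrow> ('i \<Rightarrow> 'a) \<Rightarrow> 'a" where
  "mpoly_eval R p x =
     (\<Oplus>\<^bsub>R\<^esub>m\<in>{m. p m \<noteq> \<zero>\<^bsub>R\<^esub>}. p m \<otimes>\<^bsub>R\<^esub> (\<Otimes>\<^bsub>R\<^esub>i\<in>set_mset m. x i [^]\<^bsub>R\<^esub> count m i))"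


section \<open>Differential fields and differential polynomials\<close>

record 'a diff_ring = "'a ring" +
  der :: "'a \<Rightarrow> 'a"

locale differential_field = field R for R :: "('a, 'm) diff_ring_scheme" (structure) +
  assumes char_zero: "n > 0 \<Longrightarrow> [(n :: nat)] \<cdot> \<one> \<noteq> \<zero>"
    and der_closed: "x \<in> carrier R \<Longrightarrow> der R x \<in> carrier R"
    and der_add: "\<lbrakk>x \<in> carrier R; y \<in> carrier R\<rbrakk> \<Longrightarrow> der R (x \<oplus> y) = der R x \<oplus> der R y"
    and der_mult: "\<lbrakk>x \<in> carrier R; y \<in> carrier R\<rbrakk>
      \<Longrightarrow> der R (x \<otimes> y) = der R x \<otimes> y \<oplus> x \<otimes> der R y"

text \<open>
  An extension of differential fields is given by an embedding.  Homomorphisms of fields are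
  injective, so injectivity need not be demanded.
\<close>

definition diff_field_embedding ::
  "('a, 'm) diff_ring_scheme \<Rightarrow> ('b, 'n) diff_ring_scheme \<Rightarrow> ('a \<Rightarrow> 'b) \<Rightarrow> bool" where
  "diff_field_embedding K M h \<longleftrightarrow>
     h \<in> ring_hom K M \<and> (\<forall>x\<in>carrier K. h (der K x) = der M (h x))"

text \<open>In a differential polynomial the variable \<open>i\<close> stands for the derivative \<open>y\<^sup>(\<^sup>i\<^sup>)\<close>.\<close>

definition diff_polys :: "('a, 'm) ring_scheme \<Rightarrow> (nat multiset \<Rightarrow> 'a) set" where
  "diff_polys R = ring.indexed_pset R UNIV (carrier R)"

text \<open>The highest derivative that occurs; \<open>-1\<close> for constants.\<close>

definition diff_order :: "('a, 'm) ring_scheme \<Rightarrow> (nat multiset \<Rightarrow> 'a) \<Rightarrow> int" where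
  "diff_order R p = Max (insert (- 1) (int ` {i. \<not> ring.index_free R p i}))"

definition diff_eval :: "('a, 'm) diff_ring_scheme \<Rightarrow> (nat multiset \<Rightarrow> 'a) \<Rightarrow> 'a \<Rightarrow> 'a" where
  "diff_eval R p a = mpoly_eval R p (\<lambda>i. (der R ^^ i) a)"

definition diff_solutions :: "('a, 'm) diff_ring_scheme \<Rightarrow> (nat multiset \<Rightarrow> 'a) \<Rightarrow> 'a set" where
  "diff_solutions R p = {a \<in> carrier R. diff_eval R p a = \<zero>\<^bsub>R\<^esub>}"

text \<open>Blum's axioms for differentially closed fields of characteristic zero.\<close>

definition differentially_closed :: "('a, 'm) diff_ring_scheme \<Rightarrow> bool" where
  "differentially_closed M \<longleftrightarrow> differential_field M \<and>
     (\<forall>p\<in>diff_polys M. \<forall>q\<in>diff_polys M.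
        diff_order M q < diff_order M p \<and> q \<noteq> (\<lambda>_. \<zero>\<^bsub>M\<^esub>) \<longrightarrow>
        (\<exists>a\<in>carrier M. diff_eval M p a = \<zero>\<^bsub>M\<^esub> \<and> diff_eval M q a \<noteq> \<zero>\<^bsub>M\<^esub>))"


section \<open>Definable sets and strong minimality\<close>

text \<open>
  First-order formulas over the language of differential rings with parameters.  The constants
  \<open>0\<close>, \<open>1\<close>, \<open>-1\<close> are available as parameters.
\<close>

datatype (dt_params: 'a) dterm =
    DVar nat
  | DPar 'a
  | DAdd "'a dterm" "'a dterm"
  | DMult "'a dterm" "'a dterm"
  | DDer "'a dterm"
  for map: map_dterm

datatype (df_params: 'a) dformula =
    DEq "'a dterm" "'a dterm"
  | DNot "'a dformula"
  | DAnd "'a dformula" "'a dformula"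
  | DEx nat "'a dformula"
  for map: map_dformula

primrec dterm_val :: "('a, 'm) diff_ring_scheme \<Rightarrow> (nat \<Rightarrow> 'a) \<Rightarrow> 'a dterm \<Rightarrow> 'a" where
  "dterm_val M v (DVar n) = v n"
| "dterm_val M v (DPar c) = c"
| "dterm_val M v (DAdd s t) = dterm_val M v s \<oplus>\<^bsub>M\<^esub> dterm_val M v t"
| "dterm_val M v (DMult s t) = dterm_val M v s \<otimes>\<^bsub>M\<^esub> dterm_val M v t"
| "dterm_val M v (DDer t) = der M (dterm_val M v t)"

primrec dsat :: "('a, 'm) diff_ring_scheme \<Rightarrow> (nat \<Rightarrow> 'a) \<Rightarrow> 'a dformula \<Rightarrow> bool" where
  "dsat M v (DEq s t) \<longleftrightarrow> dterm_val M v s = dterm_val M v t"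
| "dsat M v (DNot \<phi>) \<longleftrightarrow> \<not> dsat M v \<phi>"
| "dsat M v (DAnd \<phi> \<psi>) \<longleftrightarrow> dsat M v \<phi> \<and> dsat M v \<psi>"
| "dsat M v (DEx n \<phi>) \<longleftrightarrow> (\<exists>a\<in>carrier M. dsat M (v(n := a)) \<phi>)"

text \<open>
  The subset of \<open>M\<close> defined by a formula.  All free variables receive the same value, i.e. they
  are identified to a single free variable.
\<close>

definition def_set :: "('a, 'm) diff_ring_scheme \<Rightarrow> 'a dformula \<Rightarrow> 'a set" where
  "def_set M \<phi> = {a \<in> carrier M. dsat M (\<lambda>_. a) \<phi>}"

definition definable :: "('a, 'm) diff_ring_scheme \<Rightarrow> 'a set \<Rightarrow> bool" where
  "definable M S \<longleftrightarrow> (\<exists>\<phi>. df_params \<phi> \<subseteq> carrier M \<and> S = def_set M \<phi>)"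

definition elementary_extension ::
  "('a, 'm) diff_ring_scheme \<Rightarrow> ('b, 'n) diff_ring_scheme \<Rightarrow> ('a \<Rightarrow> 'b) \<Rightarrow> bool" where
  "elementary_extension M N j \<longleftrightarrow>
     differential_field N \<and> j \<in> carrier M \<rightarrow> carrier N \<and>
     (\<forall>\<phi> v. df_params \<phi> \<subseteq> carrier M \<and> range v \<subseteq> carrier M \<longrightarrow>
        (dsat M v \<phi> \<longleftrightarrow> dsat N (j \<circ> v) (map_dformula j \<phi>)))"

definition minimal_set :: "('a, 'm) diff_ring_scheme \<Rightarrow> 'a set \<Rightarrow> bool" where
  "minimal_set M S \<longleftrightarrow> infinite S \<and> (\<forall>T. definable M T \<longrightarrow> finite (S \<inter> T) \<or> finite (S - T))"

text \<open>
  \<open>S\<close> is strongly minimal if it is definable and the set defined by the same formula is minimal in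
  every elementary extension.  (Whether this holds does not depend on the formula chosen for
  \<open>S\<close>.)  The elementary extensions live in the same type as \<open>M\<close>.
\<close>

definition strongly_minimal :: "'a diff_ring \<Rightarrow> 'a set \<Rightarrow> bool" where
  "strongly_minimal M S \<longleftrightarrow>
     (\<exists>\<phi>. df_params \<phi> \<subseteq> carrier M \<and> S = def_set M \<phi> \<and>
        (\<forall>(N :: 'a diff_ring) j. elementary_extension M N j \<longrightarrow>
           minimal_set N (def_set N (map_dformula j \<phi>))))"


section \<open>The differential field of rational functions\<close>

definition ratfun_deriv :: "complex poly fract \<Rightarrow> complex poly fract" where
  "ratfun_deriv r = (let (p, q) = quot_of_fract r in Fract (pderiv p * q - p * pderiv q) (q * q))"

definition ratfun_field :: "complex poly fract diff_ring" where
  "ratfun_field = \<lparr>carrier = UNIV, monoid.mult = (*), one = 1, zero = 0, add = (+),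
     der = ratfun_deriv\<rparr>"

definition ratfun_pole :: "complex poly fract \<Rightarrow> complex \<Rightarrow> bool" where
  "ratfun_pole r z \<longleftrightarrow> poly (snd (quot_of_fract r)) z = 0"

definition ratfun_eval :: "complex poly fract \<Rightarrow> complex \<Rightarrow> complex" where
  "ratfun_eval r z = poly (fst (quot_of_fract r)) z / poly (snd (quot_of_fract r)) z"

text \<open>
  Differential fields are taken inside the type \<^typ>\<open>complex set\<close>, since HOL cannot quantify over
  types within a formula.  This loses nothing: the field of rational functions has the
  cardinality of the continuum, so a failure of strong minimality, being witnessed by a single
  formula and its parameters, is by Loewenheim-Skolem already visible in a differentially closed
  field with at most continuum many elements.  The choice of the differentially closed extension
  is immaterial because any two of them satisfy the same sentences with parameters in the field
  of rational functions (quantifier elimination), hence the universal quantifier.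
\<close>

definition strongly_minimal_ade :: "(nat multiset \<Rightarrow> complex poly fract) \<Rightarrow> bool" where
  "strongly_minimal_ade P \<longleftrightarrow> P \<in> diff_polys ratfun_field \<and>
     (\<forall>(M :: complex set diff_ring) h.
        differentially_closed M \<and> diff_field_embedding ratfun_field M h \<longrightarrow>
        strongly_minimal M (diff_solutions M (h \<circ> P)))"


section \<open>Analytic functions\<close>

abbreviation complex_ring :: "complex ring" where
  "complex_ring \<equiv> ring_of_type_algebra"

text \<open>Equations with rational coefficients are evaluated away from the poles of the coefficients.\<close>

definition satisfies_ade ::
  "complex set \<Rightarrow> (complex \<Rightarrow> complex) \<Rightarrow> (nat multiset \<Rightarrow> complex poly fract) \<Rightarrow> bool" where
  "satisfies_ade U f P \<longleftrightarrow>
     (\<forall>z\<in>U. (\<forall>m. \<not> ratfun_pole (P m) z) \<longrightarrow>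
        mpoly_eval complex_ring (\<lambda>m. ratfun_eval (P m) z) (\<lambda>i. (deriv ^^ i) f z) = 0)"

definition algebraic_on :: "complex set \<Rightarrow> (complex \<Rightarrow> complex) \<Rightarrow> bool" where
  "algebraic_on U f \<longleftrightarrow>
     (\<exists>Q :: complex poly fract poly. Q \<noteq> 0 \<and>
        (\<forall>z\<in>U. (\<forall>n. \<not> ratfun_pole (Polynomial.coeff Q n) z) \<longrightarrow>
           poly (map_poly (\<lambda>r. ratfun_eval r z) Q) (f z) = 0))"

text \<open>
  A chain \<open>g 1, \<dots>, g l\<close>.  In the polynomial \<open>p i\<close> the variable \<open>0\<close> is \<open>u\<close> and the variable \<open>j \<ge> 1\<close>
  is \<open>v\<^sub>j\<close>.
\<close>

definition pfaffian_chain :: "complex set \<Rightarrow> nat \<Rightarrow> (nat \<Rightarrow> complex \<Rightarrow> complex) \<Rightarrow> bool" where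
  "pfaffian_chain U l g \<longleftrightarrow>
     (\<forall>i\<in>{1..l}. g i analytic_on U) \<and>
     (\<exists>p. \<forall>i\<in>{1..l}. p i \<in> ring.indexed_pset complex_ring {0..i} UNIV \<and>
        (\<forall>z\<in>U. deriv (g i) z =
           mpoly_eval complex_ring (p i) (\<lambda>j. if j = 0 then z else g j z)))"

definition pfaffian_on :: "complex set \<Rightarrow> (complex \<Rightarrow> complex) \<Rightarrow> bool" where
  "pfaffian_on U f \<longleftrightarrow>
     (\<exists>l g q. pfaffian_chain U l g \<and> q \<in> ring.indexed_pset complex_ring {1..l} UNIV \<and>
        (\<forall>z\<in>U. f z = mpoly_eval complex_ring q (\<lambda>j. g j z)))"

end

theory Submission
  imports Defs "HOL-Algebra.Free_Abelian_Groups"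
begin

text \<open>
  Embed the field generated by the Taylor expansions of the chain and of \<open>f\<close> into a differentially
  closed field and let \<open>k\<^sub>i\<close> be the relative algebraic closure of \<open>\<complex>(z, g\<^sub>1, \<dots>, g\<^sub>i)\<close>.
  There is an \<open>i\<close> such that \<open>f\<close> is transcendental over \<open>k = k\<^sub>i\<close> but algebraic over \<open>k(\<gamma>)\<close>, where
  \<open>\<gamma> = g\<^sub>i\<^sub>+\<^sub>1\<close> satisfies \<open>\<gamma>' = p(\<gamma>)\<close> with \<open>p\<close> over \<open>k\<close>, say \<open>r(\<gamma>, f) = 0\<close>.  The definable set
  \<open>T\<close> of all \<open>a\<close> with \<open>r(x, a) = 0\<close> for some \<open>x\<close> such that \<open>x' = p(x)\<close> then cuts the solution set \<open>S\<close> of the equation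
  into two infinite pieces: a solution \<open>x\<close> of \<open>x' = p(x)\<close> that is generic over \<open>k\<close> and finitely many further
  elements yields a conjugate of \<open>f\<close> in \<open>S \<inter> T\<close>, while a generic solution \<open>b\<close> of the equation has \<open>b\<close> and \<open>b'\<close>
  algebraically independent over \<open>k\<close>, as the order is at least two, so \<open>b \<notin> T\<close>.

  The differentially closed field is \<open>\<complex>\<close> itself with a suitable derivation.  A derivation can take
  arbitrary values on a transcendence basis, and the basis is large enough to reserve fresh elements for a
  generic solution of every differential polynomial.
\<close>

text \<open>Strong minimality is given through definable sets, not transcendence degrees, so the
  contradiction must be one formula both of whose traces on the solution set are infinite. This is
  why generic solutions must also avoid a finite set: it is always the half supposed to be finite,
  and genericity over it produces the contradiction. The reason behind \<open>b \<notin> T\<close>: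
  if x' = p(x), the algebraic closure of k(x) is closed under the derivation and has transcendence
  degree at most one over k. A generic b in T would be interalgebraic with x over k, so b' would be
  algebraic over k(b). Relative algebraic closures are used in place of generated fields since then
  being transcendental over k just means not lying in k. As the fields must live in
  \<open>complex set\<close>, the construction depends on a count: there are no more Laurent series
  over the complex numbers than complex numbers. The embedding \<open>\<sigma>\<close> of Laurent
  series moves the constants too, and the derivation on the complex numbers is an algebraic object
  without analytic meaning; \<open>\<sigma>\<close> alone ties it to differentiation of
  functions.\<close>

hide_const (open) up_ring.coeff up_ring.monom Polynomials.degree Polynomials.lead_coeff

subsection \<open>Extending partial ring homomorphisms\<close>

text \<open>Partial homomorphisms are represented by their graphs, so that unions of chains are again
  partial homomorphisms.\<close>

definition part_hom :: "('a::field \<times> 'b::comm_ring_1) set \<Rightarrow> bool" where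
  "part_hom g \<longleftrightarrow> (1, 1) \<in> g \<and>
     (\<forall>a b c d. (a, b) \<in> g \<and> (c, d) \<in> g \<longrightarrow> (a - c, b - d) \<in> g \<and> (a * c, b * d) \<in> g) \<and>
     (\<forall>b. (0, b) \<in> g \<longrightarrow> b = 0) \<and> (\<forall>a b. (a, b) \<in> g \<and> a \<noteq> 0 \<longrightarrow> b dvd 1)"

lemma part_homI:
  assumes "(1, 1) \<in> g"
    and "\<And>a b c d. (a, b) \<in> g \<Longrightarrow> (c, d) \<in> g \<Longrightarrow> (a - c, b - d) \<in> g"
    and "\<And>a b c d. (a, b) \<in> g \<Longrightarrow> (c, d) \<in> g \<Longrightarrow> (a * c, b * d) \<in> g"
    and "\<And>b. (0, b) \<in> g \<Longrightarrow> b = 0"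
    and "\<And>a b. (a, b) \<in> g \<Longrightarrow> a \<noteq> 0 \<Longrightarrow> b dvd 1"
  shows "part_hom g"
  unfolding part_hom_def by (intro conjI allI impI; (elim conjE)?; rule assms; assumption)

text \<open>\<open>q\<close> is the image of \<open>p\<close> under \<open>g\<close>. A relation
  rather than a map, because \<open>g\<close> is partial; it also records that all coefficients of
  \<open>p\<close> lie in the domain.\<close>

definition lifts :: "('a::field \<times> 'b::comm_ring_1) set \<Rightarrow> 'a poly \<Rightarrow> 'b poly \<Rightarrow> bool" where
  "lifts g p q \<longleftrightarrow> (\<forall>i. (coeff p i, coeff q i) \<in> g)"

text \<open>The candidate extension sending \<open>x\<close> to \<open>y\<close>. It is
  single-valued only if polynomials vanishing at \<open>x\<close> lift to polynomials vanishing at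
  \<open>y\<close>, which is a hypothesis of \<open>part_hom_adjoin\<close>.\<close>

definition adjoin :: "('a::field \<times> 'b::comm_ring_1) set \<Rightarrow> 'a \<Rightarrow> 'b \<Rightarrow> ('a \<times> 'b) set" where
  "adjoin g x y = {(poly p x, poly q y) | p q. lifts g p q}"

text \<open>The target need not be a field: derivations are extended with values in the dual
  numbers. The inverse \<open>e\<close> of \<open>d\<close> exists because \<open>part_hom\<close>
  sends nonzero elements to units.\<close>

definition fractions :: "('a::field \<times> 'b::comm_ring_1) set \<Rightarrow> ('a \<times> 'b) set" where
  "fractions g = {(a / c, b * e) | a b c d e. (a, b) \<in> g \<and> (c, d) \<in> g \<and> c \<noteq> 0 \<and> d * e = 1}"

context
  fixes g :: "('a::field \<times> 'b::comm_ring_1) set"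
  assumes g: "part_hom g"
begin

lemma part_hom_one: "(1, 1) \<in> g"
  and part_hom_diff: "(a, b) \<in> g \<Longrightarrow> (c, d) \<in> g \<Longrightarrow> (a - c, b - d) \<in> g"
  and part_hom_mult: "(a, b) \<in> g \<Longrightarrow> (c, d) \<in> g \<Longrightarrow> (a * c, b * d) \<in> g"
  and part_hom_zeroD: "(0, b) \<in> g \<Longrightarrow> b = 0"
  and part_hom_unit: "(a, b) \<in> g \<Longrightarrow> a \<noteq> 0 \<Longrightarrow> b dvd 1"
  using g by (simp_all add: part_hom_def)

lemma part_hom_zero: "(0, 0) \<in> g"
  using part_hom_diff[OF part_hom_one part_hom_one] by simp

lemma part_hom_uminus: "(a, b) \<in> g \<Longrightarrow> (- a, - b) \<in> g"
  using part_hom_diff[OF part_hom_zero] by fastforce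

lemma part_hom_add: "(a, b) \<in> g \<Longrightarrow> (c, d) \<in> g \<Longrightarrow> (a + c, b + d) \<in> g"
  using part_hom_diff[OF _ part_hom_uminus] by fastforce

lemma part_hom_sum:
  "finite I \<Longrightarrow> (\<And>i. i \<in> I \<Longrightarrow> (a i, b i) \<in> g) \<Longrightarrow> (sum a I, sum b I) \<in> g"
  by (induction I rule: finite_induct) (auto intro: part_hom_zero part_hom_add)

lemma part_hom_fun: "(a, b) \<in> g \<Longrightarrow> (a, b') \<in> g \<Longrightarrow> b = b'"
  using part_hom_diff part_hom_zeroD by fastforce

lemma lifts_diff: "lifts g p q \<Longrightarrow> lifts g r s \<Longrightarrow> lifts g (p - r) (q - s)"
  and lifts_add: "lifts g p q \<Longrightarrow> lifts g r s \<Longrightarrow> lifts g (p + r) (q + s)"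
  and lifts_0: "lifts g 0 0"
  by (auto simp: lifts_def intro: part_hom_diff part_hom_add part_hom_zero)

lemma lifts_const: "(a, b) \<in> g \<Longrightarrow> lifts g [:a:] [:b:]"
  by (auto simp: lifts_def coeff_pCons part_hom_zero split: nat.split)

lemma lifts_monom: "(a, b) \<in> g \<Longrightarrow> lifts g (monom a n) (monom b n)"
  by (auto simp: lifts_def part_hom_zero)

lemma lifts_mult: "lifts g p q \<Longrightarrow> lifts g r s \<Longrightarrow> lifts g (p * r) (q * s)"
  by (auto simp: lifts_def coeff_mult intro!: part_hom_sum part_hom_mult)

lemma lifts_zeroD: "lifts g 0 q \<Longrightarrow> q = 0"
  by (auto simp: lifts_def poly_eq_iff dest: part_hom_zeroD)

lemma lifts_exists:
  assumes "\<And>i. coeff p i \<in> Domain g"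
  obtains q where "lifts g p q"
proof -
  have "\<forall>i. \<exists>b. (coeff p i, b) \<in> g" using assms by blast
  then obtain h where h: "\<And>i. (coeff p i, h i) \<in> g" by metis
  have "h i = 0" if "i > degree p" for i
    using h[of i] that by (auto simp: coeff_eq_0 intro: part_hom_zeroD)
  then have "coeff (Abs_poly h) = h" by (intro coeff_Abs_poly) auto
  then show thesis using h that by (metis lifts_def)
qed

lemma adjoin_superset: "g \<subseteq> adjoin g x y"
proof
  fix z assume "z \<in> g"
  then have "lifts g [:fst z:] [:snd z:]" by (intro lifts_const) auto
  then show "z \<in> adjoin g x y" unfolding adjoin_def by (cases z) force
qed

lemma adjoin_elem: "(x, y) \<in> adjoin g x y"
proof -
  have "lifts g (monom 1 1) (monom 1 1)" by (intro lifts_monom part_hom_one)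
  then show ?thesis unfolding adjoin_def by (force simp: poly_monom)
qed

lemma part_hom_adjoin:
  assumes "\<And>p q. lifts g p q \<Longrightarrow> poly p x = 0 \<Longrightarrow> poly q y = 0"
    and "\<And>p q. lifts g p q \<Longrightarrow> poly p x \<noteq> 0 \<Longrightarrow> poly q y dvd 1"
  shows "part_hom (adjoin g x y)"
proof (rule part_homI)
  show "(1, 1) \<in> adjoin g x y" using adjoin_superset part_hom_one by blast
next
  fix a b c d assume "(a, b) \<in> adjoin g x y" "(c, d) \<in> adjoin g x y"
  then obtain p q r s where *: "lifts g p q" "lifts g r s" "a = poly p x" "b = poly q y"
    "c = poly r x" "d = poly s y" unfolding adjoin_def by blast
  show "(a - c, b - d) \<in> adjoin g x y"
    using lifts_diff[OF *(1,2)] * unfolding adjoin_def by (force simp flip: poly_diff)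
  show "(a * c, b * d) \<in> adjoin g x y"
    using lifts_mult[OF *(1,2)] * unfolding adjoin_def by (force simp flip: poly_mult)
next
  fix b assume "(0, b) \<in> adjoin g x y"
  then show "b = 0" using assms(1) unfolding adjoin_def by force
next
  fix a b assume "(a, b) \<in> adjoin g x y" "a \<noteq> 0"
  then show "b dvd 1" using assms(2) unfolding adjoin_def by blast
qed

lemma fractions_superset: "g \<subseteq> (fractions g)"
proof
  fix z assume "z \<in> g"
  then have "(fst z / 1, snd z * 1) \<in> (fractions g)"
    unfolding fractions_def using part_hom_one by (intro CollectI exI[of _ "fst z"] exI[of _ "snd z"] exI[of _ 1]) auto
  then show "z \<in> (fractions g)" by simp
qed

lemma fractionsI: "(a, b) \<in> g \<Longrightarrow> (c, d) \<in> g \<Longrightarrow> c \<noteq> 0 \<Longrightarrow> d * e = 1 \<Longrightarrow> u = a / c \<Longrightarrow> v = b * e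
    \<Longrightarrow> (u, v) \<in> (fractions g)"
  unfolding fractions_def by blast

lemma part_hom_fractions: "part_hom (fractions g)"
proof (rule part_homI)
  show "(1, 1) \<in> (fractions g)" using fractions_superset part_hom_one by blast
next
  fix u v u' v' assume "(u, v) \<in> (fractions g)" "(u', v') \<in> (fractions g)"
  then obtain a b c d e a' b' c' d' e' where *: "(a, b) \<in> g" "(c, d) \<in> g" "c \<noteq> 0" "d * e = 1"
      "u = a / c" "v = b * e" "(a', b') \<in> g" "(c', d') \<in> g" "c' \<noteq> 0" "d' * e' = 1" "u' = a' / c'" "v' = b' * e'"
    unfolding fractions_def by blast
  have one: "(d * d') * (e * e') = 1" using *(4,10) by (metis mult.assoc mult.commute mult_1)
  have "b * d' * (e * e') = b * e * (d' * e')" "b' * d * (e * e') = b' * e' * (d * e)"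
    by (simp_all only: mult_ac)
  then have v: "v = b * d' * (e * e')" "v' = b' * d * (e * e')" using * by simp_all
  show "(u - u', v - v') \<in> (fractions g)"
  proof (rule fractionsI[OF part_hom_diff[OF part_hom_mult[OF *(1,8)] part_hom_mult[OF *(7,2)]]
        part_hom_mult[OF *(2,8)] _ one])
    show "c * c' \<noteq> 0" using * by simp
    show "u - u' = (a * c' - a' * c) / (c * c')" using * by (simp add: field_simps)
    show "v - v' = (b * d' - b' * d) * (e * e')" using v by (simp add: algebra_simps)
  qed
  show "(u * u', v * v') \<in> (fractions g)"
  proof (rule fractionsI[OF part_hom_mult[OF *(1,7)] part_hom_mult[OF *(2,8)] _ one])
    show "c * c' \<noteq> 0" using * by simp
    show "u * u' = a * a' / (c * c')" using * by simp
    show "v * v' = b * b' * (e * e')" using * by (simp add: mult_ac)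
  qed
next
  fix v assume "(0, v) \<in> (fractions g)"
  then show "v = 0" unfolding fractions_def by (auto dest: part_hom_zeroD)
next
  fix u v assume "(u, v) \<in> (fractions g)" "u \<noteq> 0"
  then obtain a b c d e where *: "(a, b) \<in> g" "a \<noteq> 0" "d * e = 1" "v = b * e"
    unfolding fractions_def by auto
  have "b dvd 1" using part_hom_unit * by blast
  moreover have "e dvd 1" using *(3) by (metis dvd_triv_right)
  ultimately have "b * e dvd 1 * 1" by (rule mult_dvd_mono)
  then show "v dvd 1" using * by simp
qed

lemma Domain_fractions_inverse: "x \<in> Domain g \<Longrightarrow> inverse x \<in> Domain (fractions g)"
proof (cases "x = 0")
  case False
  assume "x \<in> Domain g"
  then obtain y where y: "(x, y) \<in> g" by blast
  then obtain e where "y * e = 1" using part_hom_unit[OF y False] by (metis dvdE)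
  then show ?thesis
    using fractionsI[OF part_hom_one y False, of e] by (auto simp: divide_inverse)
qed (use fractions_superset part_hom_zero in auto)

text \<open>Long division by a monic polynomial uses no inverses, so it can be carried out on both
  sides in step even if the target has zero divisors. The remainder is bounded on the source side,
  through vanishing coefficients.\<close>

lemma lifts_division:
  assumes m: "lifts g m m'" "coeff m n = 1" "degree m = n" and p: "lifts g p p'"
  shows "\<exists>q q' r r'. lifts g q q' \<and> lifts g r r' \<and> p = m * q + r \<and> p' = m' * q' + r' \<and>
           (\<forall>i\<ge>n. coeff r i = 0)"
proof -
  have "\<forall>p p'. lifts g p p' \<and> (\<forall>i\<ge>N. coeff p i = 0) \<longrightarrow>
      (\<exists>q q' r r'. lifts g q q' \<and> lifts g r r' \<and> p = m * q + r \<and> p' = m' * q' + r' \<and>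
           (\<forall>i\<ge>n. coeff r i = 0))" (is "\<forall>p p'. _ \<longrightarrow> ?Q p p'") for N
  proof (induction N)
    case 0
    show ?case
    proof (intro allI impI)
      fix p p' assume "lifts g p p' \<and> (\<forall>i\<ge>0. coeff p i = 0)"
      then show "?Q p p'" using lifts_0
        by (intro exI[of _ 0] exI[of _ 0] exI[of _ p] exI[of _ p']) auto
    qed
  next
    case (Suc N)
    show ?case
    proof (intro allI impI)
      fix p p' assume p: "lifts g p p' \<and> (\<forall>i\<ge>Suc N. coeff p i = 0)"
      show "?Q p p'"
      proof (cases "N < n")
        case True
        then show ?thesis using p lifts_0
          by (intro exI[of _ 0] exI[of _ 0] exI[of _ p] exI[of _ p']) auto
      next
        case False
        \<comment> \<open>\<open>s * m\<close> has the same coefficient as \<open>p\<close> in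
          degree \<open>N\<close>, so subtracting it lowers the bound.\<close>
        define s where "s = monom (coeff p N) (N - n)"
        define s' where "s' = monom (coeff p' N) (N - n)"
        have s: "lifts g s s'"
          unfolding s_def s'_def using p by (intro lifts_monom) (auto simp: lifts_def)
        have "coeff (p - s * m) i = 0" if i: "i \<ge> N" for i
        proof (cases "i = N")
          case True
          then show ?thesis using False m by (simp add: s_def coeff_monom_mult)
        next
          case False
          then have "i \<ge> Suc N" using i by simp
          moreover have "i - (N - n) > degree m" using m(3) \<open>i \<ge> Suc N\<close> \<open>\<not> N < n\<close> by linarith
          ultimately show ?thesis using p by (simp add: s_def coeff_monom_mult coeff_eq_0)
        qed
        then obtain q q' r r' where *: "lifts g q q'" "lifts g r r'" "p - s * m = m * q + r"
            "p' - s' * m' = m' * q' + r'" "\<forall>i\<ge>n. coeff r i = 0"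
          using Suc[rule_format, of "p - s * m" "p' - s' * m'"] lifts_diff[OF _ lifts_mult[OF s m(1)]] p
          by fastforce
        show ?thesis
          using lifts_add[OF *(1) s] *(2-)
          by (intro exI[of _ "q + s"] exI[of _ "q' + s'"] exI[of _ r] exI[of _ r'])
            (auto simp: algebra_simps)
      qed
    qed
  qed
  from this[of "Suc (degree p)"] p show ?thesis by (auto simp: coeff_eq_0)
qed

end

text \<open>Zorn's lemma with a side condition \<open>Q\<close> on the graph. It serves three
  constructions: derivations (\<open>Q\<close> fixes the first component of the dual number),
  extension to algebraic elements (\<open>Q\<close> trivial) and the embedding of Laurent series
  (\<open>Q\<close> bounds the values). Comparing a maximal \<open>g\<close> with
  \<open>fractions g\<close> shows that its domain is a field.\<close>

lemma maximal_part_hom: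
  fixes g0 :: "('a::field \<times> 'b::comm_ring_1) set"
  assumes g0: "part_hom g0" "Q g0"
    and chain: "\<And>C. C \<noteq> {} \<Longrightarrow> subset.chain {g. part_hom g \<and> Q g} C \<Longrightarrow> Q (\<Union>C)"
    and fractions: "\<And>g. part_hom g \<Longrightarrow> Q g \<Longrightarrow> Q (fractions g)"
  obtains g where "g0 \<subseteq> g" "part_hom g" "Q g"
    "\<And>x. x \<in> Domain g \<Longrightarrow> inverse x \<in> Domain g"
    "\<And>x y. part_hom (adjoin g x y) \<Longrightarrow> Q (adjoin g x y) \<Longrightarrow> (x, y) \<in> g"
proof -
  let ?P = "{g. g0 \<subseteq> g \<and> part_hom g \<and> Q g}"
  have "\<exists>g\<in>?P. \<forall>h\<in>?P. g \<subseteq> h \<longrightarrow> h = g"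
  proof (rule subset_Zorn_nonempty)
    show "?P \<noteq> {}" using g0 by blast
  next
    fix C assume C: "C \<noteq> {}" "subset.chain ?P C"
    then have mem: "\<And>g. g \<in> C \<Longrightarrow> g0 \<subseteq> g \<and> part_hom g \<and> Q g"
      and tot: "\<And>g h. g \<in> C \<Longrightarrow> h \<in> C \<Longrightarrow> g \<subseteq> h \<or> h \<subseteq> g"
      unfolding subset.chain_def by fastforce+
    have "subset.chain {g. part_hom g \<and> Q g} C"
      using mem tot unfolding subset.chain_def by fastforce
    then have "Q (\<Union>C)" using chain C by blast
    moreover have "part_hom (\<Union>C)"
    proof (rule part_homI)
      show "(1, 1) \<in> \<Union>C" using C mem part_hom_one by blast
    next
      fix a b c d assume "(a, b) \<in> \<Union>C" "(c, d) \<in> \<Union>C"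
      then obtain g where "g \<in> C" "(a, b) \<in> g" "(c, d) \<in> g" using tot by blast
      then show "(a - c, b - d) \<in> \<Union>C" "(a * c, b * d) \<in> \<Union>C"
        using mem part_hom_diff part_hom_mult by blast+
    next
      fix b assume "(0, b) \<in> \<Union>C"
      then show "b = 0" using mem part_hom_zeroD by blast
    next
      fix a b assume "(a, b) \<in> \<Union>C" "a \<noteq> 0"
      then show "b dvd 1" using mem part_hom_unit by blast
    qed
    ultimately show "\<Union>C \<in> ?P" using C mem by blast
  qed
  then obtain g where gP: "g \<in> ?P" and gmax: "\<forall>h\<in>?P. g \<subseteq> h \<longrightarrow> h = g" by (elim bexE)
  have g: "g0 \<subseteq> g" "part_hom g" "Q g" using gP by simp_all
  have max: "h = g" if "part_hom h" "Q h" "g \<subseteq> h" for h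
  proof -
    have "h \<in> ?P" using that g(1) by auto
    then show ?thesis using gmax that(3) by simp
  qed
  have "fractions g = g"
    by (rule max[OF part_hom_fractions[OF g(2)] fractions[OF g(2,3)] fractions_superset[OF g(2)]])
  show thesis
  proof (rule that[OF g])
    show "inverse x \<in> Domain g" if "x \<in> Domain g" for x
      using Domain_fractions_inverse[OF g(2) that] \<open>fractions g = g\<close> by simp
    show "(x, y) \<in> g" if "part_hom (adjoin g x y)" "Q (adjoin g x y)" for x y
      using max[OF that adjoin_superset[OF g(2)]] adjoin_elem[OF g(2)] by blast
  qed
qed

text \<open>Since the domain is a field, a nonzero polynomial of least degree vanishing at
  \<open>x\<close> can be made monic. Division by it then gives the last conclusion: multiples on
  the source side stay multiples on the target side, where no notion of minimality is
  available.\<close>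

lemma part_hom_minpoly:
  assumes g: "part_hom g" and inv: "\<And>x. x \<in> Domain g \<Longrightarrow> inverse x \<in> Domain g"
    and p: "lifts g p p'" "p \<noteq> 0" "poly p x = 0"
  obtains m m' where "lifts g m m'" "coeff m (degree m) = 1" "poly m x = 0" "degree m > 0"
    "\<And>q q'. lifts g q q' \<Longrightarrow> q \<noteq> 0 \<Longrightarrow> poly q x = 0 \<Longrightarrow> degree m \<le> degree q"
    "\<And>q q'. lifts g q q' \<Longrightarrow> poly q x = 0 \<Longrightarrow> \<exists>r r'. lifts g r r' \<and> q = m * r \<and> q' = m' * r'"
proof -
  let ?P = "\<lambda>m. (\<exists>m'. lifts g m m') \<and> m \<noteq> 0 \<and> poly m x = 0"
  have "?P p" using p by blast
  then obtain k where k: "?P k" and min: "\<And>q. ?P q \<Longrightarrow> degree k \<le> degree q"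
    by (metis ex_has_least_nat[of ?P p degree])
  obtain k' where k': "lifts g k k'" using k by blast
  have "lead_coeff k \<in> Domain g" using k' by (auto simp: lifts_def)
  then obtain c where c: "(inverse (lead_coeff k), c) \<in> g" using inv by blast
  define m where "m = [:inverse (lead_coeff k):] * k"
  define m' where "m' = [:c:] * k'"
  have m: "lifts g m m'"
    unfolding m_def m'_def using lifts_mult[OF g lifts_const[OF g c] k'] .
  have nz: "lead_coeff k \<noteq> 0" using k by simp
  have deg: "degree m = degree k" using nz by (simp add: m_def)
  have lc: "coeff m (degree m) = 1" using nz unfolding deg by (simp add: m_def)
  have root: "poly m x = 0" using k by (simp add: m_def)
  have pos: "degree m > 0"
  proof (rule ccontr)
    assume "\<not> degree m > 0"
    then obtain a where "m = [:a:]" using degree0_coeffs[of m] by auto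
    then show False using lc root by simp
  qed
  have least: "degree m \<le> degree q" if "lifts g q q'" "q \<noteq> 0" "poly q x = 0" for q q'
    using min[of q] that deg by auto
  have "\<exists>r r'. lifts g r r' \<and> q = m * r \<and> q' = m' * r'" if q: "lifts g q q'" "poly q x = 0" for q q'
  proof -
    obtain r r' s s' where *: "lifts g r r'" "lifts g s s'" "q = m * r + s" "q' = m' * r' + s'"
        "\<forall>i\<ge>degree m. coeff s i = 0"
      using lifts_division[OF g m lc refl q(1)] by blast
    have "poly s x = 0" using q * root by simp
    moreover have "degree s < degree m" if "s \<noteq> 0"
      using *(5) that by (metis leading_coeff_0_iff linorder_not_le)
    ultimately have "s = 0" using least[OF *(2)] by fastforce
    then have "s' = 0" using lifts_zeroD[OF g] *(2) by blast
    then show ?thesis using * \<open>s = 0\<close> by auto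
  qed
  then show thesis using that m lc root pos least by blast
qed

lemma part_hom_adjoin_transcendental:
  assumes g: "part_hom g" and "\<And>p q. lifts g p q \<Longrightarrow> poly p x = 0 \<Longrightarrow> p = 0"
    and "\<And>p q. lifts g p q \<Longrightarrow> p \<noteq> 0 \<Longrightarrow> poly q y dvd 1"
  shows "part_hom (adjoin g x y)"
proof (rule part_hom_adjoin[OF g])
  fix p q assume "lifts g p q" "poly p x = 0"
  then show "poly q y = 0" using assms(2) lifts_zeroD[OF g] by fastforce
next
  fix p q assume "lifts g p q" "poly p x \<noteq> 0"
  then show "poly q y dvd 1" using assms(3) by fastforce
qed

text \<open>Between fields a partial homomorphism is injective, so it can be read backwards. This
  gives access to minimal polynomials over the range.\<close>

lemma part_hom_converse:
  fixes g :: "('a::field \<times> 'b::field) set"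
  assumes "part_hom g"
  shows "part_hom (g\<inverse>)"
proof (rule part_homI)
  show "(1, 1) \<in> g\<inverse>" using part_hom_one[OF assms] by simp
next
  fix b assume "(0, b) \<in> g\<inverse>"
  then show "b = 0" using part_hom_unit[OF assms, of b 0] by auto
next
  fix a b assume "(a, b) \<in> g\<inverse>" "a \<noteq> 0"
  then have "b \<noteq> 0" using part_hom_zeroD[OF assms] by auto
  then show "b dvd 1" by (simp add: dvd_field_iff)
qed (auto intro: part_hom_diff[OF assms] part_hom_mult[OF assms])

lemma lifts_converse: "part_hom g \<Longrightarrow> part_hom (g\<inverse>) \<Longrightarrow> lifts (g\<inverse>) q p \<longleftrightarrow> lifts g p q"
  by (simp add: lifts_def)

text \<open>\<open>y\<close> is any root of the image \<open>m'\<close> of the minimal polynomial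
  \<open>m\<close> of \<open>x\<close>. That nonzero values stay nonzero is shown by reversing the
  roles: the minimal polynomial \<open>n'\<close> of \<open>y\<close> over the range divides
  \<open>m'\<close>, its counterpart \<open>n\<close> divides \<open>m\<close>, and least degree
  forces \<open>n\<close> to vanish at \<open>x\<close>. The returned \<open>q'\<close> witnesses
  that \<open>y\<close> is algebraic over the range of \<open>g\<close>.\<close>

lemma part_hom_adjoin_algebraic:
  fixes g :: "('a::field \<times> 'b::alg_closed_field) set"
  assumes g: "part_hom g" and inv: "\<And>x. x \<in> Domain g \<Longrightarrow> inverse x \<in> Domain g"
    and p: "lifts g p p'" "p \<noteq> 0" "poly p x = 0"
  obtains y q q' where "part_hom (adjoin g x y)" "lifts g q q'" "q' \<noteq> 0" "poly q' y = 0"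
proof -
  obtain m m' where m: "lifts g m m'" "coeff m (degree m) = 1" "poly m x = 0" "degree m > 0"
    and least: "\<And>q q'. lifts g q q' \<Longrightarrow> q \<noteq> 0 \<Longrightarrow> poly q x = 0 \<Longrightarrow> degree m \<le> degree q"
    and dvd: "\<And>q q'. lifts g q q' \<Longrightarrow> poly q x = 0 \<Longrightarrow> \<exists>r r'. lifts g r r' \<and> q = m * r \<and> q' = m' * r'"
    using part_hom_minpoly[OF g inv p] by blast
  have g': "part_hom (g\<inverse>)" by (rule part_hom_converse[OF g])
  have inv': "inverse y \<in> Domain (g\<inverse>)" if "y \<in> Domain (g\<inverse>)" for y
  proof -
    obtain a where a: "(a, y) \<in> g" using \<open>y \<in> Domain (g\<inverse>)\<close> by auto
    show ?thesis
    proof (cases "a = 0")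
      case True
      then have "y = 0" using a part_hom_zeroD[OF g] by blast
      then show ?thesis using part_hom_zero[OF g] by auto
    next
      case False
      obtain b where b: "(inverse a, b) \<in> g" using inv a by blast
      then have "(1, y * b) \<in> g" using part_hom_mult[OF g a b] False by simp
      then have "y * b = 1" using part_hom_fun[OF g] part_hom_one[OF g] by blast
      then have "b = inverse y" by (metis inverse_unique)
      then show ?thesis using b by auto
    qed
  qed
  have one: "coeff m' (degree m) = 1"
    using part_hom_fun[OF g _ part_hom_one[OF g]] m(1)[unfolded lifts_def, rule_format, of "degree m"]
      m(2) by simp
  then have "degree m' > 0" using m(4) le_degree[of m' "degree m"] by simp
  then obtain y where y: "poly m' y = 0" using alg_closed_imp_poly_has_root by blast
  have m': "lifts (g\<inverse>) m' m" "m' \<noteq> 0" using m(1) one lifts_converse[OF g g'] by auto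
  obtain n' n where n: "lifts (g\<inverse>) n' n" "coeff n' (degree n') = 1" "poly n' y = 0" "degree n' > 0"
    and dvd': "\<And>q q'. lifts (g\<inverse>) q q' \<Longrightarrow> poly q y = 0 \<Longrightarrow> \<exists>r r'. lifts (g\<inverse>) r r' \<and> q = n' * r \<and> q' = n * r'"
    using part_hom_minpoly[OF g' inv' m' y] by metis
  obtain r r' where r: "lifts (g\<inverse>) r' r" "m' = n' * r'" "m = n * r"
    using dvd'[OF m'(1) y] by blast
  have n_root: "poly n x = 0"
  proof (rule ccontr)
    assume "poly n x \<noteq> 0"
    then have "poly r x = 0" using m(3) r(3) by simp
    have "m \<noteq> 0" using m(4) by auto
    then have "r \<noteq> 0" "n \<noteq> 0" using r by auto
    moreover have "lifts g r r'" using r(1) lifts_converse[OF g g'] by blast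
    ultimately have "degree m \<le> degree r" using least \<open>poly r x = 0\<close> by blast
    then have "degree n = 0" using r(3) \<open>r \<noteq> 0\<close> \<open>n \<noteq> 0\<close> by (simp add: degree_mult_eq)
    moreover have "coeff n (degree n') = 1"
      using part_hom_fun[OF g' _ part_hom_one[OF g']]
        n(1)[unfolded lifts_def, rule_format, of "degree n'"] n(2) by simp
    then have "degree n' \<le> degree n" using le_degree[of n "degree n'"] by simp
    ultimately show False using n(4) by simp
  qed
  have "part_hom (adjoin g x y)"
  proof (rule part_hom_adjoin[OF g])
    fix p q assume pq: "lifts g p q" "poly p x = 0"
    then show "poly q y = 0" using dvd[OF pq] y by auto
  next
    fix p q assume pq: "lifts g p q" "poly p x \<noteq> 0"
    have "poly q y \<noteq> 0"
    proof
      assume "poly q y = 0"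
      moreover have "lifts (g\<inverse>) q p" using pq lifts_converse[OF g g'] by blast
      ultimately have "poly p x = 0" using dvd' n_root by fastforce
      then show False using pq by blast
    qed
    then show "poly q y dvd 1" by (simp add: dvd_field_iff)
  qed
  then show thesis using that m(1) m'(2) y by blast
qed

subsection \<open>Dual numbers\<close>

text \<open>A derivation \<open>D\<close> is the same as a ring homomorphism \<open>x \<mapsto> x + D x \<epsilon>\<close> into the dual numbers,
  so that derivations are extended like homomorphisms.\<close>

datatype 'a dual = Dual (re: 'a) (eps: 'a)

instantiation dual :: (comm_ring_1) comm_ring_1
begin

definition "0 = Dual 0 0"
definition "1 = Dual 1 0"
definition "x + y = Dual (re x + re y) (eps x + eps y)"
definition "x - y = Dual (re x - re y) (eps x - eps y)"
definition "- x = Dual (- re x) (- eps x)"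
definition "x * y = Dual (re x * re y) (re x * eps y + eps x * re y)"

instance
  by standard
    (auto simp: zero_dual_def one_dual_def plus_dual_def minus_dual_def uminus_dual_def
      times_dual_def algebra_simps)

end

lemma re_dual [simp]:
  "re 0 = 0" "re 1 = 1" "re (x + y) = re x + re y" "re (x - y) = re x - re y"
  "re (- x) = - re x" "re (x * y) = re x * re y"
  and eps_dual [simp]: "eps 0 = 0" "eps 1 = 0" "eps (x + y) = eps x + eps y"
  "eps (x - y) = eps x - eps y" "eps (- x) = - eps x" "eps (x * y) = re x * eps y + eps x * re y"
  for x y :: "'a::comm_ring_1 dual"
  by (auto simp: zero_dual_def one_dual_def plus_dual_def minus_dual_def uminus_dual_def
      times_dual_def)

lemma dual_unit:
  fixes z :: "'a::field dual"
  assumes "re z \<noteq> 0"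
  shows "z dvd 1"
proof
  show "1 = z * Dual (inverse (re z)) (- eps z / (re z)\<^sup>2)"
    using assms by (intro dual.expand) (simp add: field_simps power2_eq_square)
qed

text \<open>Taylor expansion to first order. If the coefficients of \<open>q\<close> are the dual
  numbers a + (D a) \<epsilon>, the second component is what D must do to the value at
  \<open>x\<close> when D x = \<open>b\<close>.\<close>

lemma poly_dual:
  "poly q (Dual x b) = Dual (poly (map_poly re q) x)
     (poly (map_poly eps q) x + b * poly (pderiv (map_poly re q)) x)"
  by (induction q)
    (auto simp: map_poly_pCons pderiv_pCons plus_dual_def times_dual_def algebra_simps zero_dual_def)

subsection \<open>Algebraic closure inside a field\<close>

text \<open>Relatively algebraically closed subfields. Closure under inverses is hidden in the last
  clause: the inverse of a nonzero \<open>a\<close> is the root of the linear polynomial with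
  coefficients -1 and \<open>a\<close>.\<close>

definition ac_subfield :: "'a::field set \<Rightarrow> bool" where
  "ac_subfield S \<longleftrightarrow> 1 \<in> S \<and> (\<forall>a\<in>S. \<forall>b\<in>S. a - b \<in> S \<and> a * b \<in> S) \<and>
     (\<forall>p x. (\<forall>i. coeff p i \<in> S) \<and> p \<noteq> 0 \<and> poly p x = 0 \<longrightarrow> x \<in> S)"

text \<open>The algebraic closure, inside the ambient field, of the field generated by
  \<open>V\<close>. As an intersection it is bounded from above by exhibiting a single
  \<open>ac_subfield\<close>; that its elements really are roots is shown in characteristic zero by
  \<open>acl_algebraic\<close>.\<close>

definition acl :: "'a::field set \<Rightarrow> 'a set" where
  "acl V = {x. \<forall>S. ac_subfield S \<and> V \<subseteq> S \<longrightarrow> x \<in> S}"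

context
  fixes S :: "'a::field set"
  assumes S: "ac_subfield S"
begin

lemma ac_subfield_1: "1 \<in> S"
  and ac_subfield_diff: "a \<in> S \<Longrightarrow> b \<in> S \<Longrightarrow> a - b \<in> S"
  and ac_subfield_mult: "a \<in> S \<Longrightarrow> b \<in> S \<Longrightarrow> a * b \<in> S"
  using S unfolding ac_subfield_def by simp_all

lemma ac_subfield_root: "(\<And>i. coeff p i \<in> S) \<Longrightarrow> p \<noteq> 0 \<Longrightarrow> poly p x = 0 \<Longrightarrow> x \<in> S"
  using S unfolding ac_subfield_def by metis

lemma ac_subfield_0: "0 \<in> S"
  using ac_subfield_diff[OF ac_subfield_1 ac_subfield_1] by simp

lemma ac_subfield_uminus: "a \<in> S \<Longrightarrow> - a \<in> S"
  using ac_subfield_diff[OF ac_subfield_0] by fastforce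

lemma ac_subfield_add: "a \<in> S \<Longrightarrow> b \<in> S \<Longrightarrow> a + b \<in> S"
  using ac_subfield_diff[OF _ ac_subfield_uminus] by fastforce

lemma ac_subfield_sum: "(\<And>i. i \<in> I \<Longrightarrow> f i \<in> S) \<Longrightarrow> sum f I \<in> S"
  by (induction I rule: infinite_finite_induct) (auto intro: ac_subfield_0 ac_subfield_add)

lemma ac_subfield_prod: "(\<And>i. i \<in> I \<Longrightarrow> f i \<in> S) \<Longrightarrow> prod f I \<in> S"
  by (induction I rule: infinite_finite_induct) (auto intro: ac_subfield_1 ac_subfield_mult)

lemma ac_subfield_power: "a \<in> S \<Longrightarrow> a ^ n \<in> S"
  by (induction n) (auto intro: ac_subfield_1 ac_subfield_mult)

lemma ac_subfield_inverse: "a \<in> S \<Longrightarrow> inverse a \<in> S"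
proof (cases "a = 0")
  case False
  assume "a \<in> S"
  then show ?thesis
    by (rule_tac ac_subfield_root[of "[:-1, a:]"])
      (use False in \<open>auto simp: coeff_pCons ac_subfield_0 ac_subfield_1 ac_subfield_uminus split: nat.split\<close>)
qed (simp add: ac_subfield_0)

lemma ac_subfield_poly: "(\<And>i. coeff p i \<in> S) \<Longrightarrow> x \<in> S \<Longrightarrow> poly p x \<in> S"
  by (auto simp: poly_altdef intro!: ac_subfield_sum ac_subfield_mult ac_subfield_power)

end

lemma ac_subfield_acl: "ac_subfield (acl V)"
  unfolding ac_subfield_def
proof (intro conjI ballI allI impI)
  show "1 \<in> acl V" unfolding acl_def by (auto intro: ac_subfield_1)
next
  fix a b assume "a \<in> acl V" "b \<in> acl V"
  then show "a - b \<in> acl V" "a * b \<in> acl V"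
    unfolding acl_def by (auto intro: ac_subfield_diff ac_subfield_mult)
next
  fix p x assume p: "(\<forall>i. coeff p i \<in> acl V) \<and> p \<noteq> 0 \<and> poly p x = 0"
  show "x \<in> acl V"
    unfolding acl_def
  proof (intro CollectI allI impI)
    fix S assume S: "ac_subfield S \<and> V \<subseteq> S"
    then have "coeff p i \<in> S" for i using p unfolding acl_def by blast
    then show "x \<in> S" using ac_subfield_root[of S p x] S p by blast
  qed
qed

lemma acl_superset: "V \<subseteq> acl V"
  by (auto simp: acl_def)

lemma acl_least: "ac_subfield S \<Longrightarrow> V \<subseteq> S \<Longrightarrow> acl V \<subseteq> S"
  by (auto simp: acl_def)

lemma acl_mono: "V \<subseteq> Y \<Longrightarrow> acl V \<subseteq> acl Y"
  by (auto simp: acl_def)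

lemma acl_subsetI: "V \<subseteq> acl Y \<Longrightarrow> acl V \<subseteq> acl Y"
  by (rule acl_least[OF ac_subfield_acl])

text \<open>A polynomial has finitely many coefficients, so in a directed union they all lie in one
  member, and hence so do the roots.\<close>

lemma ac_subfield_UN_directed:
  assumes "I \<noteq> {}" "\<And>i. i \<in> I \<Longrightarrow> ac_subfield (S i)"
    and dir: "\<And>i j. i \<in> I \<Longrightarrow> j \<in> I \<Longrightarrow> \<exists>k\<in>I. S i \<union> S j \<subseteq> S k"
  shows "ac_subfield (\<Union>i\<in>I. S i)"
proof -
  have fin: "\<exists>k\<in>I. F \<subseteq> S k" if "finite F" "F \<subseteq> (\<Union>i\<in>I. S i)" for F
    using that
  proof (induction F rule: finite_induct)
    case (insert x F)
    then obtain k i where "k \<in> I" "F \<subseteq> S k" "i \<in> I" "x \<in> S i" by auto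
    then show ?case using dir[of i k] by blast
  qed (use assms in auto)
  show ?thesis
    unfolding ac_subfield_def
  proof (intro conjI ballI allI impI)
    show "1 \<in> (\<Union>i\<in>I. S i)" using assms ac_subfield_1 by blast
  next
    fix a b assume "a \<in> (\<Union>i\<in>I. S i)" "b \<in> (\<Union>i\<in>I. S i)"
    then have "\<exists>k\<in>I. {a, b} \<subseteq> S k" by (intro fin) simp_all
    then obtain k where k: "k \<in> I" "a \<in> S k" "b \<in> S k" by blast
    then have "a - b \<in> S k" "a * b \<in> S k"
      using assms(2) by (simp_all add: ac_subfield_diff ac_subfield_mult)
    then show "a - b \<in> (\<Union>i\<in>I. S i)" "a * b \<in> (\<Union>i\<in>I. S i)"
      using k(1) by blast+
  next
    fix p x assume p: "(\<forall>i. coeff p i \<in> (\<Union>i\<in>I. S i)) \<and> p \<noteq> 0 \<and> poly p x = 0"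
    then have "\<exists>k\<in>I. coeff p ` {..degree p} \<subseteq> S k" by (intro fin) (simp, blast)
    then obtain k where k: "k \<in> I" "coeff p ` {..degree p} \<subseteq> S k" by blast
    have Sk: "ac_subfield (S k)" using assms(2) k(1) .
    have "coeff p i \<in> S k" for i
      using k(2) ac_subfield_0[OF Sk] by (cases "i \<le> degree p") (auto simp: coeff_eq_0)
    then have "x \<in> S k" using p ac_subfield_root[OF Sk, of p x] by blast
    then show "x \<in> (\<Union>i\<in>I. S i)" using k by blast
  qed
qed

text \<open>The closures of the finite subsets of \<open>V\<close> form a directed family whose
  union is an \<open>ac_subfield\<close> containing \<open>V\<close>.\<close>

lemma acl_finite:
  assumes "x \<in> acl V"
  obtains F where "finite F" "F \<subseteq> V" "x \<in> acl F"
proof -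
  let ?I = "{F. finite F \<and> F \<subseteq> V}"
  have "ac_subfield (\<Union>F\<in>?I. acl F)"
  proof (rule ac_subfield_UN_directed)
    fix F G assume "F \<in> ?I" "G \<in> ?I"
    then show "\<exists>k\<in>?I. acl F \<union> acl G \<subseteq> acl k"
      by (intro bexI[of _ "F \<union> G"]) (auto intro: acl_mono[THEN subsetD, rotated])
  qed (auto intro: ac_subfield_acl)
  moreover have "V \<subseteq> (\<Union>F\<in>?I. acl F)"
  proof
    fix y assume "y \<in> V"
    then show "y \<in> (\<Union>F\<in>?I. acl F)" using acl_superset[of "{y}"] by (intro UN_I[of "{y}"]) auto
  qed
  ultimately have "acl V \<subseteq> (\<Union>F\<in>?I. acl F)" by (rule acl_least)
  then show thesis using assms that by blast
qed

subsection \<open>Derivations\<close>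

lemma root_imp_degree_pos:
  fixes p :: "'a::field poly"
  assumes "p \<noteq> 0" "poly p x = 0"
  shows "degree p > 0"
proof (rule ccontr)
  assume "\<not> degree p > 0"
  then obtain a where "p = [:a:]" using degree0_coeffs[of p] by auto
  then show False using assms by simp
qed

definition derivation :: "('a::field \<Rightarrow> 'a) \<Rightarrow> bool" where
  "derivation D \<longleftrightarrow> (\<forall>x y. D (x + y) = D x + D y) \<and> (\<forall>x y. D (x * y) = D x * y + x * D y)"

context
  fixes L :: "'a::field_char_0 set" and \<tau> \<delta> :: "'a \<Rightarrow> 'b::field"
  assumes L: "ac_subfield L"
    and \<tau>: "\<tau> 1 = 1" "\<And>x y. x \<in> L \<Longrightarrow> y \<in> L \<Longrightarrow> \<tau> (x + y) = \<tau> x + \<tau> y"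
      "\<And>x y. x \<in> L \<Longrightarrow> y \<in> L \<Longrightarrow> \<tau> (x * y) = \<tau> x * \<tau> y"
    and \<delta>: "\<And>x y. x \<in> L \<Longrightarrow> y \<in> L \<Longrightarrow> \<delta> (x + y) = \<delta> x + \<delta> y"
      "\<And>x y. x \<in> L \<Longrightarrow> y \<in> L \<Longrightarrow> \<delta> (x * y) = \<delta> x * \<tau> y + \<tau> x * \<delta> y"
begin

lemma twisted_derivation_poly:
  assumes "\<And>i. coeff p i \<in> L" "\<And>i. \<delta> (coeff p i) = 0" "x \<in> L"
  shows "\<delta> (poly p x) = \<tau> (poly (pderiv p) x) * \<delta> x"
  using assms(1,2)
proof (induction p)
  case 0
  have "\<delta> 0 = \<delta> 0 + \<delta> 0"
    using \<delta>(1)[OF ac_subfield_0[OF L] ac_subfield_0[OF L]] by (simp only: add_0_left)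
  then have "\<delta> 0 = 0" by (simp only: add_cancel_right_right)
  moreover have "\<tau> 0 = \<tau> 0 + \<tau> 0"
    using \<tau>(2)[OF ac_subfield_0[OF L] ac_subfield_0[OF L]] by (simp only: add_0_left)
  then have "\<tau> 0 = 0" by (simp only: add_cancel_right_right)
  ultimately show ?case by simp
next
  case (pCons a p)
  have p: "coeff p i \<in> L" "\<delta> (coeff p i) = 0" for i
    using pCons.prems[of "Suc i"] by simp_all
  have a: "a \<in> L" "\<delta> a = 0" using pCons.prems[of 0] by simp_all
  have mem: "poly p x \<in> L" using ac_subfield_poly[OF L p(1) assms(3)] .
  have "coeff (pderiv p) i \<in> L" for i
  proof -
    have "of_nat n \<in> L" for n
      by (induction n) (auto intro: ac_subfield_add[OF L] ac_subfield_0[OF L] ac_subfield_1[OF L])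
    then show ?thesis using p(1) by (simp add: coeff_pderiv ac_subfield_mult[OF L] del: of_nat_Suc)
  qed
  then have mem': "poly (pderiv p) x \<in> L" by (rule ac_subfield_poly[OF L _ assms(3)])
  have "\<delta> (poly (pCons a p) x) = \<delta> x * \<tau> (poly p x) + \<tau> x * (\<tau> (poly (pderiv p) x) * \<delta> x)"
    using a mem assms(3) pCons.IH[OF p] by (simp add: \<delta> ac_subfield_mult[OF L])
  also have "\<dots> = \<tau> (poly p x + x * poly (pderiv p) x) * \<delta> x"
    using mem mem' assms(3) by (simp add: \<tau> ac_subfield_mult[OF L] algebra_simps)
  finally show ?case by (simp add: pderiv_pCons)
qed

text \<open>The twist by an embedding \<open>\<tau>\<close> allows two uses: with
  \<open>\<tau>\<close> the identity the kernel is the field of constants, and with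
  \<open>\<delta>\<close> the difference of D \<tau> and \<tau> D it is the set on which
  \<open>\<tau>\<close> respects D. For \<open>m\<close> of least degree over the kernel with root
  \<open>x\<close>, applying \<open>\<delta>\<close> to the equation leaves the image of
  \<open>pderiv m\<close> at \<open>x\<close> times \<open>\<delta> x\<close>; the first factor is
  nonzero by minimality, in characteristic zero.\<close>

lemma ac_subfield_kernel: "ac_subfield {x \<in> L. \<delta> x = 0}"
proof -
  have one: "1 \<in> L" by (rule ac_subfield_1[OF L])
  have "\<delta> 1 = \<delta> 1 + \<delta> 1"
    using \<delta>(2)[OF one one] by (simp only: mult_1_left mult_1_right \<tau>(1))
  then have d1: "\<delta> 1 = 0" by (simp only: add_cancel_right_right)
  have zero: "0 \<in> L" by (rule ac_subfield_0[OF L])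
  have "\<delta> 0 = \<delta> 0 + \<delta> 0" using \<delta>(1)[OF zero zero] by (simp only: add_0_left)
  then have d0: "\<delta> 0 = 0" by (simp only: add_cancel_right_right)
  have diff: "\<delta> (a - b) = 0" if ab: "a \<in> L" "b \<in> L" "\<delta> a = 0" "\<delta> b = 0" for a b
  proof -
    have "\<delta> (a - b) + \<delta> b = \<delta> a"
      using \<delta>(1)[OF ac_subfield_diff[OF L ab(1,2)] ab(2)] by (simp only: diff_add_cancel)
    then show ?thesis using ab by (simp only: add_0_right)
  qed
  have mult: "\<delta> (a * b) = 0" if ab: "a \<in> L" "b \<in> L" "\<delta> a = 0" "\<delta> b = 0" for a b
    using \<delta>(2)[OF ab(1,2)] by (simp only: ab mult_zero_left mult_zero_right add_0_left)
  show ?thesis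
    unfolding ac_subfield_def
  proof (intro conjI ballI allI impI)
    show "1 \<in> {x \<in> L. \<delta> x = 0}" by (rule CollectI, rule conjI, rule one, rule d1)
  next
    fix a b assume "a \<in> {x \<in> L. \<delta> x = 0}" "b \<in> {x \<in> L. \<delta> x = 0}"
    then have ab: "a \<in> L" "b \<in> L" "\<delta> a = 0" "\<delta> b = 0" by simp_all
    show "a - b \<in> {x \<in> L. \<delta> x = 0}"
      by (rule CollectI, rule conjI, rule ac_subfield_diff[OF L ab(1,2)], rule diff[OF ab])
    show "a * b \<in> {x \<in> L. \<delta> x = 0}"
      by (rule CollectI, rule conjI, rule ac_subfield_mult[OF L ab(1,2)], rule mult[OF ab])
  next
  fix p x assume p: "(\<forall>i. coeff p i \<in> {x \<in> L. \<delta> x = 0}) \<and> p \<noteq> 0 \<and> poly p x = 0"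
  let ?P = "\<lambda>p. (\<forall>i. coeff p i \<in> {x \<in> L. \<delta> x = 0}) \<and> p \<noteq> 0 \<and> poly p x = 0"
  obtain m where m: "?P m" and least: "\<forall>q. ?P q \<longrightarrow> degree m \<le> degree q"
    using ex_has_least_nat[of ?P p degree, OF p] by (elim exE) (rule that, erule conjunct1, erule conjunct2)
  have coeffs: "coeff m i \<in> L" "\<delta> (coeff m i) = 0" for i using m by auto
  have x: "x \<in> L" using ac_subfield_root[OF L coeffs(1)] m by blast
  have pos: "degree m > 0"
    using m by (intro root_imp_degree_pos[of m x]) simp_all
  have dnat: "of_nat n \<in> L \<and> \<delta> (of_nat n) = 0" for n
    by (induction n) (auto simp: zero d0 one d1 \<delta> ac_subfield_add[OF L])
  have "poly (pderiv m) x \<noteq> 0"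
  proof
    assume "poly (pderiv m) x = 0"
    moreover have "pderiv m \<noteq> 0" using pos by (simp add: pderiv_eq_0_iff)
    moreover have "coeff (pderiv m) i \<in> {x \<in> L. \<delta> x = 0}" for i
      using dnat[of "Suc i"] coeffs
      by (simp add: coeff_pderiv \<delta> ac_subfield_mult[OF L] del: of_nat_Suc)
    ultimately have "degree m \<le> degree (pderiv m)"
      using least[THEN spec, of "pderiv m"] by simp
    then show False using pos by (simp add: degree_pderiv)
  qed
  moreover have "coeff (pderiv m) i \<in> L" for i
    using dnat[of "Suc i"] coeffs by (simp add: coeff_pderiv ac_subfield_mult[OF L] del: of_nat_Suc)
  then have "poly (pderiv m) x \<in> L" by (rule ac_subfield_poly[OF L _ x])
  \<comment> \<open>\<open>\<tau>\<close> keeps this value nonzero because it is multiplicative on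
    \<open>L\<close>, which contains the inverse.\<close>
  ultimately have "\<tau> (poly (pderiv m) x * inverse (poly (pderiv m) x))
      = \<tau> (poly (pderiv m) x) * \<tau> (inverse (poly (pderiv m) x))"
    by (intro \<tau> ac_subfield_inverse[OF L])
  then have "\<tau> (poly (pderiv m) x) \<noteq> 0" using \<open>poly (pderiv m) x \<noteq> 0\<close> \<tau>(1) by auto
  moreover have "\<tau> (poly (pderiv m) x) * \<delta> x = 0"
    using twisted_derivation_poly[OF coeffs x] m d0 by simp
  ultimately show "x \<in> {x \<in> L. \<delta> x = 0}" using x by simp
  qed
qed

end

lemma ac_subfield_UNIV: "ac_subfield UNIV"
  by (simp add: ac_subfield_def)

context
  fixes D :: "'a::field_char_0 \<Rightarrow> 'a"
  assumes D: "derivation D"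
begin

lemma derivation_add: "D (x + y) = D x + D y"
  and derivation_mult: "D (x * y) = D x * y + x * D y"
  using D by (simp_all add: derivation_def)

lemma ac_subfield_constants: "ac_subfield {x. D x = 0}"
  using ac_subfield_kernel[OF ac_subfield_UNIV, of "\<lambda>x. x" D] by (simp add: derivation_add derivation_mult)

lemma derivation_0: "D 0 = 0" and derivation_1: "D 1 = 0"
  using ac_subfield_0[OF ac_subfield_constants] ac_subfield_1[OF ac_subfield_constants] by auto

lemma derivation_uminus: "D (- x) = - D x"
  using derivation_add[of x "- x"] derivation_0 by (simp add: add_eq_0_iff)

lemma derivation_diff: "D (x - y) = D x - D y"
  using derivation_add[of x "- y"] derivation_uminus by simp

lemma derivation_acl: "(\<And>x. x \<in> V \<Longrightarrow> D x = 0) \<Longrightarrow> x \<in> acl V \<Longrightarrow> D x = 0"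
  using acl_least[OF ac_subfield_constants] by blast

text \<open>Differentiating the equation of an algebraic element solves for its derivative as a
  quotient. Minimality is taken among polynomials whose coefficients lie in the closure together
  with their derivatives, so \<open>pderiv m\<close> has to be placed in that same class before it
  can contradict minimality.\<close>

lemma derivation_acl_closed:
  assumes "\<And>x. x \<in> V \<Longrightarrow> D x \<in> acl V" "x \<in> acl V"
  shows "D x \<in> acl V"
proof -
  let ?S = "acl V"
  note S = ac_subfield_acl[of V]
  have "ac_subfield {x \<in> ?S. D x \<in> ?S}"
    unfolding ac_subfield_def
  proof (intro conjI ballI allI impI)
    show "1 \<in> {x \<in> ?S. D x \<in> ?S}" by (simp add: derivation_1 ac_subfield_0[OF S] ac_subfield_1[OF S])
  next
    fix a b assume "a \<in> {x \<in> ?S. D x \<in> ?S}" "b \<in> {x \<in> ?S. D x \<in> ?S}"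
    then show "a - b \<in> {x \<in> ?S. D x \<in> ?S}" "a * b \<in> {x \<in> ?S. D x \<in> ?S}"
      by (simp_all add: derivation_diff derivation_mult ac_subfield_diff[OF S]
          ac_subfield_mult[OF S] ac_subfield_add[OF S])
  next
    fix p x assume p: "(\<forall>i. coeff p i \<in> {x \<in> ?S. D x \<in> ?S}) \<and> p \<noteq> 0 \<and> poly p x = 0"
    let ?P = "\<lambda>p. (\<forall>i. coeff p i \<in> {x \<in> ?S. D x \<in> ?S}) \<and> p \<noteq> 0 \<and> poly p x = 0"
    obtain m where m: "?P m" and least: "\<forall>q. ?P q \<longrightarrow> degree m \<le> degree q"
      using ex_has_least_nat[of ?P p degree, OF p] by (elim exE) (rule that, erule conjunct1, erule conjunct2)
    have coeffs: "coeff m i \<in> ?S" "D (coeff m i) \<in> ?S" for i using m by auto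
    have x: "x \<in> ?S" using ac_subfield_root[OF S coeffs(1)] m by blast
    have pos: "degree m > 0"
      using m by (intro root_imp_degree_pos[of m x]) simp_all
    have dnat: "of_nat n \<in> ?S" "D (of_nat n) = 0" for n
    proof -
      show "of_nat n \<in> ?S"
        by (induction n) (auto simp: ac_subfield_0[OF S] ac_subfield_1[OF S] ac_subfield_add[OF S])
      show "D (of_nat n) = 0" by (induction n) (auto simp: derivation_0 derivation_1 derivation_add)
    qed
    have pd: "coeff (pderiv m) i \<in> ?S" for i
      using dnat[of "Suc i"] coeffs by (simp add: coeff_pderiv ac_subfield_mult[OF S] del: of_nat_Suc)
    have "poly (pderiv m) x \<noteq> 0"
    proof
      assume "poly (pderiv m) x = 0"
      moreover have "pderiv m \<noteq> 0" using pos by (simp add: pderiv_eq_0_iff)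
      moreover have "coeff (pderiv m) i \<in> {x \<in> ?S. D x \<in> ?S}" for i
        using dnat[of "Suc i"] coeffs pd[of i]
        by (simp add: coeff_pderiv derivation_mult ac_subfield_mult[OF S] del: of_nat_Suc)
      ultimately have "degree m \<le> degree (pderiv m)"
        using least[THEN spec, of "pderiv m"] by simp
      then show False using pos by (simp add: degree_pderiv)
    qed
    moreover have "D (poly q x) = poly (map_poly D q) x + poly (pderiv q) x * D x" for q
      by (induction q) (simp_all add: derivation_0 map_poly_pCons derivation_add derivation_mult
          pderiv_pCons algebra_simps)
    then have "poly (map_poly D m) x + poly (pderiv m) x * D x = 0"
      using m derivation_0 by metis
    ultimately have "D x = - poly (map_poly D m) x * inverse (poly (pderiv m) x)"
      by (simp add: field_simps eq_neg_iff_add_eq_0)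
    moreover have "poly (map_poly D m) x \<in> ?S"
      using coeffs by (intro ac_subfield_poly[OF S _ x]) (simp add: coeff_map_poly derivation_0)
    ultimately have "D x \<in> ?S"
      using ac_subfield_poly[OF S pd x]
      by (simp add: ac_subfield_mult[OF S] ac_subfield_uminus[OF S] ac_subfield_inverse[OF S])
    then show "x \<in> {x \<in> ?S. D x \<in> ?S}" using x by simp
  qed
  moreover have "V \<subseteq> {x \<in> ?S. D x \<in> ?S}" using assms(1) acl_superset[of V] by blast
  ultimately show ?thesis using acl_least assms(2) by blast
qed

end

text \<open>The graphs are those with identity in the first component. At a transcendental element
  the derivative is free and 0 is chosen; at an algebraic element it is forced. Either way a maximal
  graph can be enlarged, so it is total.\<close>

lemma derivation_extend:
  fixes g0 :: "('a::field_char_0 \<times> 'a dual) set"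
  assumes g0: "part_hom g0" "\<And>a b. (a, b) \<in> g0 \<Longrightarrow> re b = a"
  obtains D where "derivation D" "\<And>a b. (a, b) \<in> g0 \<Longrightarrow> D a = eps b"
proof -
  let ?Q = "\<lambda>g :: ('a \<times> 'a dual) set. \<forall>a b. (a, b) \<in> g \<longrightarrow> re b = a"
  have Q0: "?Q g0" using g0 by blast
  have chain: "?Q (\<Union>C)" if "subset.chain {g. part_hom g \<and> ?Q g} C" for C
    using that unfolding subset.chain_def by fast
  have frac: "?Q (fractions g)" if g: "part_hom g" "?Q g" for g
  proof (intro allI impI)
    fix u v assume "(u, v) \<in> fractions g"
    then obtain a b c d e where *: "(a, b) \<in> g" "(c, d) \<in> g" "c \<noteq> 0" "d * e = 1" "u = a / c" "v = b * e"
      unfolding fractions_def by blast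
    have re: "re b = a" "re d = c" using g(2) * by blast+
    have "re d * re e = 1" using *(4) by (metis re_dual(2,6))
    then have "re e = 1 / c" using re *(3) by (simp add: field_simps)
    then show "re v = u" using re * by simp
  qed
  obtain g where g: "g0 \<subseteq> g" "part_hom g" "?Q g" and inv: "\<And>x. x \<in> Domain g \<Longrightarrow> inverse x \<in> Domain g"
    and max: "\<And>x y. part_hom (adjoin g x y) \<Longrightarrow> ?Q (adjoin g x y) \<Longrightarrow> (x, y) \<in> g"
    by (rule maximal_part_hom[where Q = ?Q, OF g0(1) Q0 chain frac]) (assumption+, rule that)
  have re_poly: "map_poly re q = p" if "lifts g p q" for p q
    using that g(3) by (simp add: lifts_def poly_eq_iff coeff_map_poly)
  have adj: "?Q (adjoin g x (Dual x b))" for x b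
    using re_poly by (auto simp: adjoin_def poly_dual)
  have unit: "poly q (Dual x b) dvd 1" if "lifts g p q" "poly p x \<noteq> 0" for p q x b
    using that re_poly[OF that(1)] by (intro dual_unit) (simp add: poly_dual)
  have "x \<in> Domain g" for x
  proof (cases "\<exists>p q. lifts g p q \<and> p \<noteq> 0 \<and> poly p x = 0")
    case False
    have "part_hom (adjoin g x (Dual x 0))"
    proof (rule part_hom_adjoin[OF g(2)])
      fix p q assume "lifts g p q" "poly p x = 0"
      then show "poly q (Dual x 0) = 0" using False lifts_zeroD[OF g(2)] by fastforce
    qed (rule unit)
    then show ?thesis using max adj by blast
  next
    case True
    then obtain p p' where p: "lifts g p p'" "p \<noteq> 0" "poly p x = 0" by blast
    obtain m m' where m: "lifts g m m'" "coeff m (degree m) = 1" "poly m x = 0" "degree m > 0"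
      and least: "\<And>q q'. lifts g q q' \<Longrightarrow> q \<noteq> 0 \<Longrightarrow> poly q x = 0 \<Longrightarrow> degree m \<le> degree q"
      and dvd: "\<And>q q'. lifts g q q' \<Longrightarrow> poly q x = 0 \<Longrightarrow> \<exists>r r'. lifts g r r' \<and> q = m * r \<and> q' = m' * r'"
      using part_hom_minpoly[OF g(2) inv p] by blast
    have nz: "poly (pderiv m) x \<noteq> 0"
    proof
      assume "poly (pderiv m) x = 0"
      moreover have "pderiv m \<noteq> 0" using m(4) by (simp add: pderiv_eq_0_iff)
      moreover have "coeff (pderiv m) i \<in> Domain g" for i
      proof -
        have "\<exists>b. (of_nat n * a, b) \<in> g" if "(a, b) \<in> g" for n a b
        proof (induction n)
          case (Suc n)
          then obtain c where "(of_nat n * a, c) \<in> g" by blast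
          from part_hom_add[OF g(2) this that] show ?case by (auto simp: algebra_simps)
        qed (use part_hom_zero[OF g(2)] in auto)
        then show ?thesis using m(1) unfolding lifts_def coeff_pderiv by blast
      qed
      then obtain q where "lifts g (pderiv m) q" using lifts_exists[OF g(2)] by blast
      ultimately have "degree m \<le> degree (pderiv m)" using least by blast
      then show False using m(4) by (simp add: degree_pderiv)
    qed
    \<comment> \<open>The unique value for which the second component of \<open>m'\<close> at
      \<open>Dual x b\<close> vanishes, read off from \<open>poly_dual\<close>.\<close>
    define b where "b = - poly (map_poly eps m') x / poly (pderiv m) x"
    have root: "poly m' (Dual x b) = 0"
      using nz m(3) re_poly[OF m(1)] by (simp add: poly_dual b_def zero_dual_def)
    have "part_hom (adjoin g x (Dual x b))"
    proof (rule part_hom_adjoin[OF g(2)])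
      fix p q assume "lifts g p q" "poly p x = 0"
      then obtain r' where "q = m' * r'" using dvd by blast
      then show "poly q (Dual x b) = 0" using root by simp
    qed (rule unit)
    then show ?thesis using max adj by blast
  qed
  then have "\<forall>x. \<exists>y. (x, y) \<in> g" by blast
  then obtain h where h: "\<And>x. (x, h x) \<in> g" by metis
  have re_h: "re (h x) = x" for x using h g(3) by blast
  have "h (x + y) = h x + h y" "h (x * y) = h x * h y" for x y
    using part_hom_fun[OF g(2) h] part_hom_add[OF g(2) h h] part_hom_mult[OF g(2) h h] by blast+
  then have "derivation (\<lambda>x. eps (h x))"
    by (simp add: derivation_def re_h)
  moreover have "eps (h a) = eps b" if "(a, b) \<in> g0" for a b
    using part_hom_fun[OF g(2) h] that g(1) by (metis subsetD)
  ultimately show thesis using that by blast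
qed

definition subring_set :: "'a::field set \<Rightarrow> bool" where
  "subring_set R \<longleftrightarrow> 1 \<in> R \<and> (\<forall>a\<in>R. \<forall>b\<in>R. a - b \<in> R \<and> a * b \<in> R)"

lemma ac_subfield_imp_subring: "ac_subfield S \<Longrightarrow> subring_set S"
  by (simp add: ac_subfield_def subring_set_def)

text \<open>On the polynomials in \<open>x\<close> over \<open>R\<close> this is formal
  differentiation by \<open>x\<close>, encoded as x going to x + \<epsilon>;
  \<open>derivation_extend\<close> carries it to the whole field.\<close>

lemma exists_derivation_transcendental:
  fixes R :: "'a::field_char_0 set"
  assumes R: "subring_set R"
    and tr: "\<And>p. (\<And>i. coeff p i \<in> R) \<Longrightarrow> poly p x = 0 \<Longrightarrow> p = 0"
  obtains D where "derivation D" "\<And>a. a \<in> R \<Longrightarrow> D a = 0" "D x = 1"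
proof -
  let ?g = "(\<lambda>a. (a, Dual a 0)) ` R"
  have g: "part_hom ?g"
  proof (rule part_homI)
    show "(1, 1) \<in> ?g" using R by (auto simp: subring_set_def one_dual_def)
  next
    fix a b c d assume "(a, b) \<in> ?g" "(c, d) \<in> ?g"
    then show "(a - c, b - d) \<in> ?g" "(a * c, b * d) \<in> ?g"
      using R by (auto simp: subring_set_def minus_dual_def times_dual_def)
  next
    fix b assume "(0, b) \<in> ?g"
    then show "b = 0" by (auto simp: zero_dual_def)
  next
    fix a b assume "(a, b) \<in> ?g" "a \<noteq> 0"
    then show "b dvd 1" by (intro dual_unit) auto
  qed
  have q: "p = map_poly re q \<and> map_poly eps q = 0 \<and> (\<forall>i. coeff p i \<in> R)" if "lifts ?g p q" for p q
    using that by (auto simp: lifts_def poly_eq_iff coeff_map_poly image_iff)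
  have "part_hom (adjoin ?g x (Dual x 1))"
  proof (rule part_hom_adjoin[OF g])
    fix p q assume *: "lifts ?g p q" "poly p x = 0"
    then have "p = 0" using q[OF *(1)] tr by blast
    then show "poly q (Dual x 1) = 0" using * lifts_zeroD[OF g] by fastforce
  next
    fix p q assume *: "lifts ?g p q" "poly p x \<noteq> 0"
    then show "poly q (Dual x 1) dvd 1" using q[OF *(1)] by (intro dual_unit) (simp add: poly_dual)
  qed
  moreover have "re b = a" if "(a, b) \<in> adjoin ?g x (Dual x 1)" for a b
    using that q by (auto simp: adjoin_def poly_dual)
  ultimately obtain D where D: "derivation D"
      "\<And>a b. (a, b) \<in> adjoin ?g x (Dual x 1) \<Longrightarrow> D a = eps b"
    using derivation_extend by blast
  show thesis
  proof (rule that[OF D(1)])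
    show "D a = 0" if "a \<in> R" for a
    proof -
      have "(a, Dual a 0) \<in> adjoin ?g x (Dual x 1)" using adjoin_superset[OF g] that by blast
      then show ?thesis using D(2) by fastforce
    qed
    show "D x = 1" using D(2)[OF adjoin_elem[OF g]] by simp
  qed
qed

text \<open>In characteristic zero a transcendental element is moved by a derivation, whereas the constants
  of a derivation are relatively algebraically closed.\<close>

lemma acl_algebraic:
  fixes R :: "'a::field_char_0 set"
  assumes "subring_set R" "x \<in> acl R"
  obtains p where "\<And>i. coeff p i \<in> R" "p \<noteq> 0" "poly p x = 0"
proof (rule ccontr)
  assume "\<not> thesis"
  then have "\<And>p. (\<And>i. coeff p i \<in> R) \<Longrightarrow> poly p x = 0 \<Longrightarrow> p = 0" using that by blast
  then obtain D where D: "derivation D" "\<And>a. a \<in> R \<Longrightarrow> D a = 0" "D x = 1"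
    using exists_derivation_transcendental[OF assms(1)] by metis
  then have "D x = 0" using derivation_acl[OF D(1)] assms(2) by blast
  then show False using D(3) by simp
qed

lemma exists_derivation_not_acl:
  fixes V :: "'a::field_char_0 set"
  assumes "x \<notin> acl V"
  obtains D where "derivation D" "\<And>a. a \<in> acl V \<Longrightarrow> D a = 0" "D x = 1"
proof (rule exists_derivation_transcendental)
  show "subring_set (acl V)" by (rule ac_subfield_imp_subring[OF ac_subfield_acl])
  show "p = 0" if "\<And>i. coeff p i \<in> acl V" "poly p x = 0" for p
    using ac_subfield_root[OF ac_subfield_acl that(1) _ that(2)] assms by blast
qed (rule that)

text \<open>Linear algebra with derivations in place of manipulating polynomials. If
  \<open>D\<close> kills \<open>x\<close> and \<open>V\<close> with \<open>D y = 1\<close>, and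
  \<open>E\<close> kills \<open>V\<close> with \<open>E x = 1\<close>, then \<open>E\<close> minus
  \<open>E y\<close> times \<open>D\<close> kills \<open>V\<close> and \<open>y\<close> but sends
  \<open>x\<close> to 1, so \<open>x\<close> cannot be algebraic over them.\<close>

lemma acl_exchange:
  fixes V :: "'a::field_char_0 set"
  assumes "x \<in> acl (insert y V)" "x \<notin> acl V"
  shows "y \<in> acl (insert x V)"
proof (rule ccontr)
  assume "y \<notin> acl (insert x V)"
  then obtain D where D: "derivation D" "\<And>a. a \<in> acl (insert x V) \<Longrightarrow> D a = 0" "D y = 1"
    using exists_derivation_not_acl by blast
  obtain E where E: "derivation E" "\<And>a. a \<in> acl V \<Longrightarrow> E a = 0" "E x = 1"
    using exists_derivation_not_acl[OF assms(2)] by blast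
  define F where "F = (\<lambda>a. E a - E y * D a)"
  have F: "derivation F"
    using D(1) E(1) by (simp add: derivation_def F_def algebra_simps)
  have "F a = 0" if a: "a \<in> insert y V" for a
  proof (cases "a = y")
    case False
    then have "a \<in> acl V" "a \<in> acl (insert x V)" using a by (auto intro: acl_superset[THEN subsetD])
    then show ?thesis using D(2) E(2) by (simp add: F_def)
  qed (simp add: F_def D(3))
  then have "F x = 0" using derivation_acl[OF F] assms(1) by blast
  moreover have "D x = 0" using D(2) acl_superset by blast
  ultimately show False using E(3) by (simp add: F_def)
qed

text \<open>Into an algebraically closed target every algebraic element can be adjoined, so a
  maximal extension has a relatively algebraically closed domain. This is the source of conjugates
  of the given function.\<close>

lemma part_hom_extend_algebraic:
  fixes g0 :: "('a::field \<times> 'b::alg_closed_field) set"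
  assumes g0: "part_hom g0"
  obtains g where "g0 \<subseteq> g" "part_hom g" "ac_subfield (Domain g)"
proof -
  obtain g where g: "g0 \<subseteq> g" "part_hom g" "True" and inv: "\<And>x. x \<in> Domain g \<Longrightarrow> inverse x \<in> Domain g"
    and max: "\<And>x y. part_hom (adjoin g x y) \<Longrightarrow> True \<Longrightarrow> (x, y) \<in> g"
    by (rule maximal_part_hom[where Q = "\<lambda>_. True", OF g0]) (assumption | rule TrueI | rule that)+
  have "ac_subfield (Domain g)"
    unfolding ac_subfield_def
  proof (intro conjI ballI allI impI)
    show "1 \<in> Domain g" using part_hom_one[OF g(2)] by blast
  next
    fix a b assume "a \<in> Domain g" "b \<in> Domain g"
    then show "a - b \<in> Domain g" "a * b \<in> Domain g"
      using part_hom_diff[OF g(2)] part_hom_mult[OF g(2)] by blast+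
  next
    fix p x assume p: "(\<forall>i. coeff p i \<in> Domain g) \<and> p \<noteq> 0 \<and> poly p x = 0"
    obtain p' where "lifts g p p'" using lifts_exists[OF g(2)] p by blast
    then obtain y where "part_hom (adjoin g x y)"
      using part_hom_adjoin_algebraic[OF g(2) inv] p by blast
    then show "x \<in> Domain g" using max by blast
  qed
  then show thesis using that g by blast
qed

text \<open>The values of \<open>b\<close> serve as a reservoir of transcendental elements.\<close>

lemma exists_embedding:
  fixes b :: "'a::field_char_0 \<Rightarrow> 'b::{alg_closed_field,field_char_0}"
  assumes indep: "\<And>x V. x \<notin> V \<Longrightarrow> b x \<notin> acl (b ` V)"
  obtains \<sigma> :: "'a \<Rightarrow> 'b" where "\<sigma> 1 = 1" "\<And>x y. \<sigma> (x + y) = \<sigma> x + \<sigma> y"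
    "\<And>x y. \<sigma> (x * y) = \<sigma> x * \<sigma> y" "range \<sigma> \<subseteq> acl (range b)"
proof -
  \<comment> \<open>Both fields have characteristic zero, so the integers give a well-defined
    start.\<close>
  let ?g0 = "range (\<lambda>n. (of_int n :: 'a, of_int n :: 'b))"
  have g0: "part_hom ?g0"
  proof (rule part_homI)
    show "(1, 1) \<in> ?g0" by (rule range_eqI[of _ _ 1]) simp
  next
    fix a b c d assume "(a, b) \<in> ?g0" "(c, d) \<in> ?g0"
    then obtain m n where "a = of_int m" "b = of_int m" "c = of_int n" "d = of_int n" by blast
    then show "(a - c, b - d) \<in> ?g0" "(a * c, b * d) \<in> ?g0"
      by (auto intro: range_eqI[of _ _ "m - n"] range_eqI[of _ _ "m * n"])
  next
    fix b assume "(0, b) \<in> ?g0"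
    then show "b = 0" by auto
  next
    fix a b assume "(a, b) \<in> ?g0" "a \<noteq> 0"
    then show "b dvd 1" by (auto simp: dvd_field_iff)
  qed
  \<comment> \<open>Every value is algebraic over the reservoir elements attached to the current
    domain. Hence \<open>b x\<close> is transcendental over the range as long as \<open>x\<close> is
    outside the domain.\<close>
  let ?Q = "\<lambda>g :: ('a \<times> 'b) set. \<forall>x y. (x, y) \<in> g \<longrightarrow> y \<in> acl (b ` Domain g)"
  have Q0: "?Q ?g0"
  proof (intro allI impI)
    fix x y assume "(x, y) \<in> ?g0"
    then obtain n where "y = of_int n" by blast
    note S = ac_subfield_acl[of "b ` Domain ?g0"]
    have "of_nat n \<in> acl (b ` Domain ?g0)" for n
      by (induction n) (auto simp: ac_subfield_0[OF S] ac_subfield_1[OF S] ac_subfield_add[OF S])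
    then have "of_int n \<in> acl (b ` Domain ?g0)"
      by (cases n rule: int_cases2) (auto simp: ac_subfield_uminus[OF S])
    then show "y \<in> acl (b ` Domain ?g0)" using \<open>y = of_int n\<close> by simp
  qed
  have Qmono: "y \<in> acl (b ` Domain h)" if "?Q g" "(x, y) \<in> g" "Domain g \<subseteq> Domain h" for g h x y
    using that acl_mono[OF image_mono[OF that(3)], of b] by blast
  have chain: "?Q (\<Union>C)" if "subset.chain {g. part_hom g \<and> ?Q g} C" for C
  proof (intro allI impI)
    fix x y assume "(x, y) \<in> \<Union>C"
    then obtain g where g: "g \<in> C" "(x, y) \<in> g" by blast
    have "?Q g" using that g unfolding subset.chain_def by blast
    then show "y \<in> acl (b ` Domain (\<Union>C))" using g by (intro Qmono[of g x]) blast+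
  qed
  have frac: "?Q (fractions g)" if g: "part_hom g" "?Q g" for g
  proof (intro allI impI)
    fix u v assume "(u, v) \<in> fractions g"
    then obtain a1 b1 c d e where *: "(a1, b1) \<in> g" "(c, d) \<in> g" "d * e = 1" "v = b1 * e"
      unfolding fractions_def by blast
    have "e = inverse d" using *(3) by (metis inverse_unique)
    moreover have "b1 \<in> acl (b ` Domain (fractions g))" "d \<in> acl (b ` Domain (fractions g))"
      using * fractions_superset[OF g(1)] by (auto intro!: Qmono[OF g(2)])
    ultimately show "v \<in> acl (b ` Domain (fractions g))"
      unfolding *(4) by (auto intro: ac_subfield_mult[OF ac_subfield_acl] ac_subfield_inverse[OF ac_subfield_acl])
  qed
  obtain g where g: "?g0 \<subseteq> g" "part_hom g" "?Q g" and inv: "\<And>x. x \<in> Domain g \<Longrightarrow> inverse x \<in> Domain g"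
    and max: "\<And>x y. part_hom (adjoin g x y) \<Longrightarrow> ?Q (adjoin g x y) \<Longrightarrow> (x, y) \<in> g"
    by (rule maximal_part_hom[where Q = ?Q, OF g0 Q0 chain frac]) (assumption+, rule that)
  have Q_adjoin: "?Q (adjoin g x y)" if y: "y \<in> acl (b ` Domain (adjoin g x y))" for x y
  proof (intro allI impI)
    fix u v assume "(u, v) \<in> adjoin g x y"
    then obtain p q where pq: "lifts g p q" "v = poly q y" unfolding adjoin_def by blast
    have "coeff q i \<in> acl (b ` Domain (adjoin g x y))" for i
      using pq(1) adjoin_superset[OF g(2), of x y] unfolding lifts_def
      by (intro Qmono[OF g(3), of "coeff p i"]) blast+
    then show "v \<in> acl (b ` Domain (adjoin g x y))"
      unfolding pq(2) by (rule ac_subfield_poly[OF ac_subfield_acl _ y])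
  qed
  have total: "x \<in> Domain g" for x
  proof (cases "\<exists>p q. lifts g p q \<and> p \<noteq> 0 \<and> poly p x = 0")
    case True
    then obtain p p' where p: "lifts g p p'" "p \<noteq> 0" "poly p x = 0" by blast
    obtain y q q' where y: "part_hom (adjoin g x y)" "lifts g q q'" "q' \<noteq> 0" "poly q' y = 0"
      using part_hom_adjoin_algebraic[OF g(2) inv p] by blast
    have "coeff q' i \<in> acl (b ` Domain (adjoin g x y))" for i
      using y(2) adjoin_superset[OF g(2), of x y] unfolding lifts_def
      by (intro Qmono[OF g(3), of "coeff q i"]) blast+
    then have "y \<in> acl (b ` Domain (adjoin g x y))"
      by (rule ac_subfield_root[OF ac_subfield_acl _ y(3,4)])
    then show ?thesis using max[OF y(1)] Q_adjoin by blast
  next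
    case False
    show ?thesis
    proof (rule ccontr)
      assume x: "x \<notin> Domain g"
      then have tr: "b x \<notin> acl (b ` Domain g)" by (rule indep)
      have "part_hom (adjoin g x (b x))"
      proof (rule part_hom_adjoin_transcendental[OF g(2)])
        show "p = 0" if "lifts g p q" "poly p x = 0" for p q using False that by blast
      next
        fix p q assume pq: "lifts g p q" "p \<noteq> 0"
        have q: "coeff q i \<in> acl (b ` Domain g)" for i
          using pq(1) g(3) unfolding lifts_def by blast
        have "q \<noteq> 0"
        proof
          assume "q = 0"
          then have "(coeff p i, 0) \<in> g" for i using pq(1) unfolding lifts_def by (metis coeff_0)
          then have "coeff p i = 0" for i using part_hom_unit[OF g(2), of "coeff p i" 0] by auto
          then show False using pq(2) by (simp add: poly_eq_iff)
        qed
        then have "poly q (b x) \<noteq> 0" using ac_subfield_root[OF ac_subfield_acl q] tr by blast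
        then show "poly q (b x) dvd 1" by (simp add: dvd_field_iff)
      qed
      moreover have "x \<in> Domain (adjoin g x (b x))" using adjoin_elem[OF g(2)] by blast
      then have "b x \<in> acl (b ` Domain (adjoin g x (b x)))"
        by (rule acl_superset[THEN subsetD, OF imageI])
      ultimately have "(x, b x) \<in> g" by (intro max Q_adjoin)
      then show False using x by blast
    qed
  qed
  then have "\<forall>x. \<exists>y. (x, y) \<in> g" by blast
  then obtain h where h: "\<And>x. (x, h x) \<in> g" by metis
  show thesis
  proof (rule that[of h])
    show "h 1 = 1" "h (x + y) = h x + h y" "h (x * y) = h x * h y" for x y
      using part_hom_fun[OF g(2) h] part_hom_one[OF g(2)] part_hom_add[OF g(2) h h] part_hom_mult[OF g(2) h h]
      by blast+
    have "h x \<in> acl (b ` Domain g)" for x using h g(3) by blast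
    then show "range h \<subseteq> acl (range b)" using acl_mono[of "b ` Domain g" "range b"] by blast
  qed
qed

subsection \<open>Transcendence bases\<close>

definition alg_indep :: "'a::field set \<Rightarrow> bool" where
  "alg_indep A \<longleftrightarrow> (\<forall>a\<in>A. a \<notin> acl (A - {a}))"

text \<open>Zorn's lemma: unions of chains stay independent by finite character, and exchange shows
  that a maximal independent set generates.\<close>

lemma exists_transcendence_basis:
  obtains A :: "'a::field_char_0 set" where "alg_indep A" "acl A = UNIV"
proof -
  have "\<exists>M\<in>{A :: 'a set. alg_indep A}. \<forall>N\<in>{A. alg_indep A}. M \<subseteq> N \<longrightarrow> N = M"
  proof (rule subset_Zorn_nonempty)
    show "{A :: 'a set. alg_indep A} \<noteq> {}" by (auto simp: alg_indep_def)
  next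
    fix C :: "'a set set" assume C: "C \<noteq> {}" "subset.chain {A. alg_indep A} C"
    have "alg_indep (\<Union>C)"
      unfolding alg_indep_def
    proof (intro ballI notI)
      fix a assume a: "a \<in> \<Union>C" "a \<in> acl (\<Union>C - {a})"
      then obtain F where F: "finite F" "F \<subseteq> \<Union>C - {a}" "a \<in> acl F" using acl_finite by blast
      have "finite (insert a F)" "insert a F \<subseteq> \<Union>C" using F a by auto
      then obtain B where B: "B \<in> C" "insert a F \<subseteq> B"
        using finite_subset_Union_chain C by metis
      then have "F \<subseteq> B - {a}" using F(2) by blast
      then have "a \<in> acl (B - {a})" using F(3) acl_mono by blast
      moreover have "alg_indep B" using B(1) C(2) unfolding subset.chain_def by blast
      ultimately show False using B(2) unfolding alg_indep_def by blast
    qed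
    then show "\<Union>C \<in> {A. alg_indep A}" by simp
  qed
  then obtain A :: "'a set" where A: "alg_indep A" and max: "\<And>B. alg_indep B \<Longrightarrow> A \<subseteq> B \<Longrightarrow> B = A"
    by auto
  have "x \<in> acl A" for x
  proof (rule ccontr)
    assume x: "x \<notin> acl A"
    then have xA: "x \<notin> A" using acl_superset by blast
    have "alg_indep (insert x A)"
      unfolding alg_indep_def
    proof (intro ballI notI)
      fix a assume a: "a \<in> insert x A" "a \<in> acl (insert x A - {a})"
      show False
      proof (cases "a = x")
        case True
        then show False using a(2) x xA by simp
      next
        case False
        then have aA: "a \<in> A" and eq: "insert x A - {a} = insert x (A - {a})" using a(1) by auto
        have "a \<notin> acl (A - {a})" using A aA unfolding alg_indep_def by blast
        then have "x \<in> acl (insert a (A - {a}))" using acl_exchange a(2) eq by metis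
        then show False using x aA by (simp add: insert_absorb)
      qed
    qed
    then have "insert x A = A" using max by blast
    then show False using xA by blast
  qed
  then show thesis using that A by blast
qed

section \<open>Cardinalities of closures, transcendence bases and Laurent series\<close>

context
  includes cardinal_syntax
begin

lemma card_of_lists_ordLeq: "infinite C \<Longrightarrow> |A| \<le>o |C| \<Longrightarrow> |lists A| \<le>o |C|"
  using card_of_lists_mono[of A C] card_of_lists_infinite[of C] ordLeq_ordIso_trans by blast

lemma countable_ordLeq:
  assumes "infinite C" "countable (UNIV :: 'a set)"
  shows "|UNIV :: 'a set| \<le>o |C|"
proof -
  have "|UNIV :: 'a set| \<le>o |UNIV :: nat set|"
    using assms(2) card_of_ordLeq[of "UNIV :: 'a set" "UNIV :: nat set"] unfolding countable_def by blast
  then show ?thesis using assms(1) infinite_iff_card_of_nat ordLeq_transitive by blast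
qed

text \<open>\<open>ev\<close> reads a list of integer multiples of words over \<open>A\<close> as a
  sum, so its values form a subring containing \<open>A\<close>. An element of the closure is then
  coded by the coefficient list of a polynomial over that subring and a position in an enumeration
  of the roots.\<close>

lemma card_of_acl:
  fixes A :: "'a::field_char_0 set"
  assumes A: "infinite A"
  shows "|acl A| \<le>o |A|"
proof -
  let ?W = "lists ((UNIV :: int set) \<times> lists A)"
  define ev :: "(int \<times> 'a list) list \<Rightarrow> 'a" where
    "ev w = (\<Sum>(k, as)\<leftarrow>w. of_int k * prod_list as)" for w
  define R where "R = ev ` ?W"
  have W: "|?W| \<le>o |A|"
    using A by (intro card_of_lists_ordLeq card_of_Times_ordLeq_infinite countable_ordLeq) auto
  have ev_append: "ev (v @ w) = ev v + ev w" for v w by (simp add: ev_def)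
  have neg: "ev (map (\<lambda>(k, as). (- k, as)) w) = - ev w" for w
    by (induction w) (auto simp: ev_def)
  have scale: "ev (map (\<lambda>(l, bs). (k * l, as @ bs)) w) = of_int k * prod_list as * ev w" for k as w
    by (induction w) (auto simp: ev_def algebra_simps)
  have R: "subring_set R"
    unfolding subring_set_def
  proof (intro conjI ballI)
    show "1 \<in> R" unfolding R_def by (rule image_eqI[of _ _ "[(1, [])]"]) (auto simp: ev_def)
  next
    fix a b assume "a \<in> R" "b \<in> R"
    then obtain v w where vw: "v \<in> ?W" "w \<in> ?W" "a = ev v" "b = ev w" unfolding R_def by blast
    have "v @ map (\<lambda>(k, as). (- k, as)) w \<in> ?W" using vw(1,2) by (auto simp: lists_eq_set)
    then show "a - b \<in> R" unfolding R_def using vw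
      by (intro image_eqI[of _ _ "v @ map (\<lambda>(k, as). (- k, as)) w"]) (auto simp: ev_append neg)
    have "\<exists>u\<in>?W. ev u = ev v * ev w" using vw(1)
    proof (induction v rule: lists.induct)
      case Nil
      show ?case by (rule bexI[of _ "[]"]) (auto simp: ev_def)
    next
      case (Cons ka v)
      note IH = Cons.IH
      obtain k as where ka: "ka = (k, as)" by fastforce
      obtain u where u: "u \<in> ?W" "ev u = ev v * ev w" using IH by blast
      let ?u = "map (\<lambda>(l, bs). (k * l, as @ bs)) w @ u"
      have "set as \<subseteq> A" using Cons.hyps ka by (auto simp: lists_eq_set)
      moreover have "set bs \<subseteq> A" if "(l, bs) \<in> set w" for l bs
        using that vw(2) by (auto simp: lists_eq_set)
      ultimately have "?u \<in> ?W" using u(1) by (fastforce simp: lists_eq_set)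
      moreover have "ev ?u = ev (ka # v) * ev w"
        unfolding ev_append scale u(2) ka by (simp add: ev_def algebra_simps)
      ultimately show ?case by blast
    qed
    then show "a * b \<in> R" unfolding R_def vw by (metis image_eqI)
  qed
  have "|R| \<le>o |A|" unfolding R_def using card_of_image W ordLeq_transitive by blast
  then have L: "|lists R \<times> (UNIV :: nat set)| \<le>o |A|"
    using A by (intro card_of_Times_ordLeq_infinite card_of_lists_ordLeq countable_ordLeq) auto
  have "A \<subseteq> R"
  proof
    fix a assume "a \<in> A"
    then show "a \<in> R" unfolding R_def by (intro image_eqI[of _ _ "[(1, [a])]"]) (auto simp: ev_def)
  qed
  then have "acl A \<subseteq> acl R" by (rule acl_mono)
  moreover have "acl R \<subseteq> (\<lambda>(as, n). from_nat_into {x. poly (Poly as) x = 0} n) ` (lists R \<times> UNIV)"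
  proof
    fix x assume "x \<in> acl R"
    then obtain p where p: "\<And>i. coeff p i \<in> R" "p \<noteq> 0" "poly p x = 0"
      using acl_algebraic[OF R] by blast
    have "coeffs p \<in> lists R" using p(1) by (auto simp: coeffs_def lists_eq_set)
    moreover have "countable {x. poly p x = 0}" using poly_roots_finite[OF p(2)] by (rule countable_finite)
    then obtain n where "from_nat_into {x. poly p x = 0} n = x"
      using p(3) from_nat_into_surj[of _ x] by blast
    ultimately show "x \<in> (\<lambda>(as, n). from_nat_into {x. poly (Poly as) x = 0} n) ` (lists R \<times> UNIV)"
      by (intro image_eqI[of _ _ "(coeffs p, n)"]) auto
  qed
  ultimately have "|acl A| \<le>o |lists R \<times> (UNIV :: nat set)|"
    by (intro surj_imp_ordLeq[OF subset_trans])
  then show ?thesis using L by (rule ordLeq_transitive)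
qed

text \<open>A finite basis would make the field countable. The natural numbers are thrown in there
  because \<open>card_of_acl\<close> speaks of infinite sets.\<close>

lemma card_of_transcendence_basis:
  fixes A :: "'a::field_char_0 set"
  assumes "uncountable (UNIV :: 'a set)" "acl A = UNIV"
  shows "infinite A \<and> |UNIV :: 'a set| \<le>o |A|"
proof -
  have "infinite A"
  proof
    assume fin: "finite A"
    let ?B = "A \<union> range (of_nat :: nat \<Rightarrow> 'a)"
    have "infinite ?B" using range_inj_infinite[OF inj_of_nat] by (metis finite_Un)
    then have "|acl ?B| \<le>o |?B|" by (rule card_of_acl)
    moreover have "acl ?B = UNIV" using acl_mono[of A ?B] assms(2) by blast
    ultimately have "|UNIV :: 'a set| \<le>o |?B|" by simp
    then have "(UNIV :: 'a set) \<lesssim> ?B" unfolding lepoll_def by (rule card_of_ordLeq[THEN iffD2])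
    moreover have "countable ?B" using fin by (simp add: countable_finite)
    ultimately show False using assms(1) countable_lepoll by blast
  qed
  then show ?thesis using card_of_acl[of A] assms(2) by simp
qed

text \<open>With complex numbers coded by sets of naturals, a Laurent series becomes the set of
  pairs of an index and an element of the code of that coefficient.\<close>

lemma card_of_fls: "|UNIV :: complex fls set| \<le>o |UNIV :: complex set|"
proof -
  have inf: "infinite (UNIV :: complex set)" "infinite (UNIV :: real set)"
    using infinite_UNIV_char_0 by blast+
  have rn: "|UNIV :: nat set set| =o |UNIV :: real set|"
    using nat_sets_eqpoll_reals eqpoll_iff_card_of_ordIso by blast
  have "|UNIV :: complex set| \<le>o |(UNIV :: real set) \<times> (UNIV :: real set)|"
  proof (rule surj_imp_ordLeq, rule subsetI)
    show "z \<in> (\<lambda>(a, b). Complex a b) ` (UNIV \<times> UNIV)" for z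
      by (rule image_eqI[of _ _ "(Re z, Im z)"]) auto
  qed
  also have "|(UNIV :: real set) \<times> (UNIV :: real set)| \<le>o |UNIV :: real set|"
    using inf by (intro card_of_Times_ordLeq_infinite) auto
  also have "|UNIV :: real set| =o |UNIV :: nat set set|" using rn by (rule ordIso_symmetric)
  finally obtain u :: "complex \<Rightarrow> nat set" where u: "inj u"
    unfolding card_of_ordLeq[symmetric] by auto
  define w :: "complex fls \<Rightarrow> nat set" where "w f = to_nat ` {(k :: int, n). n \<in> u (fls_nth f k)}" for f
  have "inj w"
  proof (rule injI)
    fix f g assume "w f = w g"
    then have "{(k :: int, n). n \<in> u (fls_nth f k)} = {(k, n). n \<in> u (fls_nth g k)}"
      unfolding w_def by (simp add: inj_image_eq_iff)
    then have "u (fls_nth f k) = u (fls_nth g k)" for k by (simp add: set_eq_iff)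
    then have "fls_nth f k = fls_nth g k" for k using u by (simp add: inj_eq)
    then show "f = g" by (intro fls_eqI)
  qed
  then have "|UNIV :: complex fls set| \<le>o |UNIV :: nat set set|"
    unfolding card_of_ordLeq[symmetric] by auto
  also have "|UNIV :: nat set set| =o |UNIV :: real set|" by (rule rn)
  also have "|UNIV :: real set| \<le>o |UNIV :: complex set|"
    unfolding card_of_ordLeq[symmetric] using inj_of_real by auto
  finally show ?thesis .
qed

text \<open>A request for one generic solution: the terms of the polynomial, further elements over
  which the solution must be generic, and the order of the polynomial.\<close>

type_synonym task = "(nat multiset \<times> complex) list \<times> complex list \<times> nat"

text \<open>One basis element per Laurent series, for the embedding, and one infinite sequence per
  task, for its solution. There are at most continuum many such indices, which is the size of a
  transcendence basis.\<close>

lemma exists_reservoir: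
  obtains A and j :: "complex fls + task \<times> nat \<Rightarrow> complex"
  where "alg_indep A" "acl A = UNIV" "inj j" "range j \<subseteq> A"
proof -
  obtain A :: "complex set" where A: "alg_indep A" "acl A = UNIV" by (rule exists_transcendence_basis)
  have le: "infinite A" "|UNIV :: complex set| \<le>o |A|"
    using card_of_transcendence_basis[OF uncountable_UNIV_complex A(2)] by auto
  have ms: "|UNIV :: nat multiset set| \<le>o |UNIV :: nat list set|"
    by (rule surj_imp_ordLeq[of _ mset]) (metis ex_mset surjI subset_UNIV surj_def)
  have ms: "|UNIV :: nat multiset set| \<le>o |A|"
    using ordLeq_transitive[OF ms countable_ordLeq[OF le(1)]] by simp
  have "|lists ((UNIV :: nat multiset set) \<times> (UNIV :: complex set))| \<le>o |A|"
    by (intro card_of_lists_ordLeq card_of_Times_ordLeq_infinite le ms)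
  moreover have "|lists (UNIV :: complex set) \<times> (UNIV :: nat set)| \<le>o |A|"
    by (intro card_of_Times_ordLeq_infinite card_of_lists_ordLeq countable_ordLeq le) simp
  ultimately have "|lists ((UNIV :: nat multiset set) \<times> (UNIV :: complex set)) \<times>
      (lists (UNIV :: complex set) \<times> (UNIV :: nat set))| \<le>o |A|"
    by (rule card_of_Times_ordLeq_infinite[OF le(1)])
  then have "|(UNIV :: task set)| \<le>o |A|" by simp
  then have "|(UNIV :: task set) \<times> (UNIV :: nat set)| \<le>o |A|"
    by (rule card_of_Times_ordLeq_infinite[OF le(1) _ countable_ordLeq[OF le(1)]]) simp
  then have "|(UNIV :: complex fls set) <+> (UNIV :: (task \<times> nat) set)| \<le>o |A|"
    by (intro card_of_Plus_ordLeq_infinite le(1) ordLeq_transitive[OF card_of_fls le(2)]) simp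
  then have "|UNIV :: (complex fls + task \<times> nat) set| \<le>o |A|" by simp
  then obtain j :: "complex fls + task \<times> nat \<Rightarrow> complex" where "inj j" "range j \<subseteq> A"
    unfolding card_of_ordLeq[symmetric] by auto
  then show thesis using that A by blast
qed

end

subsection \<open>Evaluating polynomials in several variables\<close>

definition mp_eval :: "('i multiset \<Rightarrow> 'a) \<Rightarrow> ('i \<Rightarrow> 'a) \<Rightarrow> 'a::comm_ring_1" where
  "mp_eval p x = (\<Sum>m | p m \<noteq> 0. p m * (\<Prod>i\<in>set_mset m. x i ^ count m i))"

text \<open>The coefficient of the \<open>d\<close>-th power of variable \<open>n\<close>, as a
  polynomial in the other variables; hence the value 0 at monomials that contain
  \<open>n\<close>.\<close>

definition coeff_wrt :: "('i multiset \<Rightarrow> 'a) \<Rightarrow> 'i \<Rightarrow> nat \<Rightarrow> 'i multiset \<Rightarrow> 'a::comm_ring_1" where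
  "coeff_wrt p n d = (\<lambda>m. if n \<in># m then 0 else p (m + replicate_mset d n))"

lemma mp_eval_cong:
  "(\<And>m i. p m \<noteq> 0 \<Longrightarrow> i \<in># m \<Longrightarrow> x i = y i) \<Longrightarrow> mp_eval p x = mp_eval p y"
  unfolding mp_eval_def by (intro sum.cong refl arg_cong2[where f = "(*)"] prod.cong) auto

lemma mp_eval_superset:
  "finite S \<Longrightarrow> {m. p m \<noteq> 0} \<subseteq> S \<Longrightarrow>
    mp_eval p x = (\<Sum>m\<in>S. p m * (\<Prod>i\<in>set_mset m. x i ^ count m i))"
  unfolding mp_eval_def by (intro sum.mono_neutral_left) auto

lemma mp_eval_ac_subfield:
  "ac_subfield S \<Longrightarrow> (\<And>m. p m \<in> S) \<Longrightarrow> (\<And>m i. p m \<noteq> 0 \<Longrightarrow> i \<in># m \<Longrightarrow> x i \<in> S) \<Longrightarrow> mp_eval p x \<in> S"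
  unfolding mp_eval_def
  by (intro ac_subfield_sum ac_subfield_mult ac_subfield_prod ac_subfield_power) auto

lemma finite_coeff_wrt:
  assumes "finite {m. p m \<noteq> 0}"
  shows "finite {m. coeff_wrt p n d m \<noteq> 0}"
proof -
  have "{m. coeff_wrt p n d m \<noteq> 0} \<subseteq> (\<lambda>m. m - replicate_mset d n) ` {m. p m \<noteq> 0}"
    by (auto simp: coeff_wrt_def split: if_splits intro!: image_eqI[of _ _ "_ + replicate_mset d n"])
  then show ?thesis using assms finite_surj by blast
qed

lemma coeff_wrt_self:
  "coeff_wrt p n (count m n) (filter_mset (\<lambda>i. i \<noteq> n) m) = p m"
proof -
  have "filter_mset (\<lambda>i. i \<noteq> n) m + replicate_mset (count m n) n = m"
    by (metis add.commute filter_eq_replicate_mset multiset_partition)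
  then show ?thesis by (simp add: coeff_wrt_def)
qed

lemma mp_eval_univariate:
  fixes p :: "'i multiset \<Rightarrow> 'a::comm_ring_1"
  assumes fin: "finite {m. p m \<noteq> 0}"
  obtains q where "\<And>d. coeff q d = mp_eval (coeff_wrt p n d) x" "\<And>c. poly q c = mp_eval p (x(n := c))"
proof -
  let ?S = "{m. p m \<noteq> 0}"
  define N where "N = Max (insert 0 ((\<lambda>m. count m n) ` ?S))"
  have N: "count m n \<le> N" if "p m \<noteq> 0" for m
    unfolding N_def using fin that by (intro Max_ge) auto
  have zero: "coeff_wrt p n d = (\<lambda>_. 0)" if "d > N" for d
  proof
    fix m
    show "coeff_wrt p n d m = 0"
      using N[of "m + replicate_mset d n"] that by (auto simp: coeff_wrt_def)
  qed
  define q where "q = (\<Sum>d\<le>N. monom (mp_eval (coeff_wrt p n d) x) d)"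
  have q: "coeff q d = mp_eval (coeff_wrt p n d) x" for d
    using zero[of d] by (auto simp: q_def coeff_sum mp_eval_def)
  let ?t = "\<lambda>c m. p m * (\<Prod>i\<in>set_mset m. (x(n := c)) i ^ count m i)"
  have part: "mp_eval (coeff_wrt p n d) x * c ^ d = (\<Sum>m\<in>{m \<in> ?S. count m n = d}. ?t c m)" for d c
  proof -
    let ?r = "replicate_mset d n"
    have "mp_eval (coeff_wrt p n d) x * c ^ d =
        (\<Sum>m | coeff_wrt p n d m \<noteq> 0. coeff_wrt p n d m * (\<Prod>i\<in>set_mset m. x i ^ count m i) * c ^ d)"
      by (simp add: mp_eval_def sum_distrib_right)
    also have "\<dots> = (\<Sum>m\<in>{m \<in> ?S. count m n = d}. ?t c m)"
    proof (rule sum.reindex_bij_witness[of _ "\<lambda>m. m - ?r" "\<lambda>m. m + ?r"])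
      fix m assume m: "m \<in> {m. coeff_wrt p n d m \<noteq> 0}"
      then have n: "n \<notin># m" and pm: "p (m + ?r) \<noteq> 0" by (auto simp: coeff_wrt_def split: if_splits)
      then show "m + ?r - ?r = m" "m + ?r \<in> {m \<in> ?S. count m n = d}"
        by (auto simp: not_in_iff)
      have "(\<Prod>i\<in>set_mset (m + ?r). (x(n := c)) i ^ count (m + ?r) i)
          = (\<Prod>i\<in>insert n (set_mset m). (x(n := c)) i ^ count (m + ?r) i)"
        by (intro prod.mono_neutral_left) (auto simp: not_in_iff split: if_splits)
      also have "\<dots> = c ^ d * (\<Prod>i\<in>set_mset m. (x(n := c)) i ^ count (m + ?r) i)"
        using n by (subst prod.insert) (auto simp: not_in_iff)
      also have "(\<Prod>i\<in>set_mset m. (x(n := c)) i ^ count (m + ?r) i) = (\<Prod>i\<in>set_mset m. x i ^ count m i)"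
        using n by (intro prod.cong) auto
      finally show "?t c (m + ?r) = coeff_wrt p n d m * (\<Prod>i\<in>set_mset m. x i ^ count m i) * c ^ d"
        using n by (simp add: coeff_wrt_def mult_ac)
    next
      fix m assume m: "m \<in> {m \<in> ?S. count m n = d}"
      then show 1: "m - ?r + ?r = m"
        by (intro subset_mset.diff_add) (simp add: count_le_replicate_mset_subset_eq[symmetric])
      then show "m - ?r \<in> {m. coeff_wrt p n d m \<noteq> 0}"
        using m by (auto simp: coeff_wrt_def not_in_iff[symmetric] in_diff_count)
    qed
    finally show ?thesis .
  qed
  have "poly q c = mp_eval p (x(n := c))" for c
  proof -
    have "poly q c = (\<Sum>d\<le>N. mp_eval (coeff_wrt p n d) x * c ^ d)"
      by (simp add: q_def poly_sum poly_monom)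
    also have "\<dots> = (\<Sum>d\<in>{..N}. \<Sum>m\<in>{m \<in> ?S. count m n = d}. ?t c m)"
      by (simp only: part)
    also have "\<dots> = sum (?t c) ?S"
      using fin N by (intro sum.group) auto
    finally show ?thesis by (simp add: mp_eval_def)
  qed
  with q show thesis using that by blast
qed

text \<open>Peel off the last variable: by induction some coefficient with respect to it is nonzero
  at \<open>e\<close>, and the last value is transcendental over a field that contains all these
  coefficients.\<close>

lemma mp_eval_generic_nonzero:
  fixes q :: "nat multiset \<Rightarrow> 'a::field_char_0"
  assumes "finite {m. q m \<noteq> 0}" "q m \<noteq> 0" "\<And>m. q m \<in> acl V" "\<And>m. q m \<noteq> 0 \<Longrightarrow> set_mset m \<subseteq> {..<n}"
    and "\<And>i. i < n \<Longrightarrow> e i \<notin> acl (V \<union> e ` {..<i})"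
  shows "mp_eval q e \<noteq> 0"
  using assms
proof (induction n arbitrary: q m)
  case 0
  then have "{m. q m \<noteq> 0} = {{#}}" by force
  then show ?case using 0 by (auto simp: mp_eval_def)
next
  case (Suc n)
  let ?W = "acl (V \<union> e ` {..<n})"
  obtain r where r: "\<And>d. coeff r d = mp_eval (coeff_wrt q n d) e" "\<And>c. poly r c = mp_eval q (e(n := c))"
    using mp_eval_univariate[OF Suc.prems(1)] by blast
  have vars: "set_mset m' \<subseteq> {..<n}" if "coeff_wrt q n d m' \<noteq> 0" for d m'
    using that Suc.prems(4)[of "m' + replicate_mset d n"] by (force simp: coeff_wrt_def less_Suc_eq split: if_splits)
  have mem: "coeff_wrt q n d m' \<in> acl V" for d m'
    using Suc.prems(3) ac_subfield_0[OF ac_subfield_acl[of V]] by (simp add: coeff_wrt_def)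
  have "coeff r (count m n) \<noteq> 0"
    unfolding r(1)
  proof (rule Suc.IH)
    show "coeff_wrt q n (count m n) (filter_mset (\<lambda>i. i \<noteq> n) m) \<noteq> 0"
      using Suc.prems(2) by (simp add: coeff_wrt_self)
  qed (use Suc.prems finite_coeff_wrt mem vars in auto)
  then have "r \<noteq> 0" by auto
  moreover have "coeff r d \<in> ?W" for d
    unfolding r(1)
  proof (rule mp_eval_ac_subfield[OF ac_subfield_acl])
    show "coeff_wrt q n d m' \<in> ?W" for m' using mem acl_mono[of V "V \<union> e ` {..<n}"] by blast
  next
    fix m' i assume "coeff_wrt q n d m' \<noteq> 0" "i \<in># m'"
    then have "i < n" using vars by blast
    then show "e i \<in> ?W" using acl_superset[of "V \<union> e ` {..<n}"] by blast
  qed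
  ultimately have "poly r (e n) \<noteq> 0"
    using ac_subfield_root[OF ac_subfield_acl, of r _ "e n"] Suc.prems(5)[of n] by blast
  then show ?case using r(2)[of "e n"] by simp
qed

subsection \<open>Derivations with prescribed values on a transcendence basis\<close>

lemma alg_indepD: "alg_indep A \<Longrightarrow> a \<in> A \<Longrightarrow> V \<subseteq> A - {a} \<Longrightarrow> a \<notin> acl V"
  unfolding alg_indep_def using acl_mono by blast

text \<open>\<open>E a\<close> is the partial derivative by the basis element \<open>a\<close>, and
  \<open>D\<close> corrects \<open>D0\<close> by the sum of (\<open>d a - D0 a\<close>) times
  \<open>E a\<close> over \<open>B\<close>. At each \<open>x\<close> only finitely many summands
  survive, because \<open>x\<close> is algebraic over finitely many basis elements and
  \<open>E a\<close> kills it for every other \<open>a\<close>.\<close>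

lemma derivation_prescribed:
  fixes A :: "'a::field_char_0 set"
  assumes A: "alg_indep A" "acl A = UNIV" and D0: "derivation D0" and B: "B \<subseteq> A"
  obtains D where "derivation D" "\<And>a. a \<in> acl (A - B) \<Longrightarrow> D a = D0 a" "\<And>a. a \<in> B \<Longrightarrow> D a = d a"
proof -
  have "\<forall>a. \<exists>D. a \<in> A \<longrightarrow> derivation D \<and> (\<forall>x\<in>acl (A - {a}). D x = 0) \<and> D a = 1"
  proof
    fix a
    show "\<exists>D. a \<in> A \<longrightarrow> derivation D \<and> (\<forall>x\<in>acl (A - {a}). D x = 0) \<and> D a = 1"
    proof (cases "a \<in> A")
      case True
      then have "a \<notin> acl (A - {a})" using A(1) by (intro alg_indepD) auto
      then obtain D where "derivation D" "\<And>x. x \<in> acl (A - {a}) \<Longrightarrow> D x = 0" "D a = 1"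
        using exists_derivation_not_acl by blast
      then show ?thesis by blast
    qed simp
  qed
  then obtain E where E: "\<And>a. a \<in> A \<Longrightarrow> derivation (E a) \<and> (\<forall>x\<in>acl (A - {a}). E a x = 0) \<and> E a a = 1"
    by metis
  have E0: "E a x = 0" if "a \<in> A" "x \<in> acl V" "V \<subseteq> A - {a}" for a x V
    using E[OF that(1)] that(2) acl_mono[OF that(3)] by blast
  define T where "T x = {a \<in> B. E a x \<noteq> 0}" for x
  have fin: "finite (T x)" for x
  proof -
    have "x \<in> acl A" using A(2) by simp
    then obtain F where F: "finite F" "F \<subseteq> A" "x \<in> acl F" by (rule acl_finite)
    have "a \<in> F" if "a \<in> T x" for a
    proof (rule ccontr)
      assume "a \<notin> F"
      then have "F \<subseteq> A - {a}" using F(2) by blast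
      moreover have "a \<in> A" using that B by (auto simp: T_def)
      ultimately show False using E0[of a x F] F(3) that by (auto simp: T_def)
    qed
    then show ?thesis using F(1) by (meson finite_subset subsetI)
  qed
  define v where "v a = d a - D0 a" for a
  define D where "D x = D0 x + (\<Sum>a\<in>T x. v a * E a x)" for x
  have D: "D x = D0 x + (\<Sum>a\<in>S. v a * E a x)" if "finite S" "T x \<subseteq> S" "S \<subseteq> B" for x S
    unfolding D_def using that by (intro arg_cong2[where f = "(+)"] refl sum.mono_neutral_left) (auto simp: T_def)
  have "derivation D"
    unfolding derivation_def
  proof (intro conjI allI)
    fix x y
    let ?S = "T x \<union> T y \<union> T (x + y) \<union> T (x * y)"
    have S: "finite ?S" "?S \<subseteq> B" using fin by (auto simp: T_def)
    have eq: "D z = D0 z + (\<Sum>a\<in>?S. v a * E a z)" if "z \<in> {x, y, x + y, x * y}" for z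
      using that by (intro D S) auto
    have E': "E a (x + y) = E a x + E a y" "E a (x * y) = E a x * y + x * E a y" if "a \<in> ?S" for a
      using E[of a] that S(2) B derivation_add[of "E a"] derivation_mult[of "E a"] by blast+
    have "(\<Sum>a\<in>?S. v a * E a (x + y)) = (\<Sum>a\<in>?S. v a * E a x) + (\<Sum>a\<in>?S. v a * E a y)"
      unfolding sum.distrib[symmetric] using E' by (intro sum.cong refl) (simp add: algebra_simps)
    then show "D (x + y) = D x + D y" by (simp add: eq derivation_add[OF D0])
    have "(\<Sum>a\<in>?S. v a * E a (x * y)) = (\<Sum>a\<in>?S. v a * E a x) * y + x * (\<Sum>a\<in>?S. v a * E a y)"
      unfolding sum_distrib_left sum_distrib_right sum.distrib[symmetric]
      using E' by (intro sum.cong refl) (simp add: algebra_simps)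
    then show "D (x * y) = D x * y + x * D y"
      by (simp add: eq derivation_mult[OF D0] algebra_simps)
  qed
  moreover have "D a = D0 a" if "a \<in> acl (A - B)" for a
  proof -
    have "T a = {}" using E0[OF _ that] B by (auto simp: T_def)
    then show ?thesis by (simp add: D_def)
  qed
  moreover have "D a = d a" if "a \<in> B" for a
  proof -
    have aA: "a \<in> A" using that B by blast
    have "T a \<subseteq> {a}"
    proof
      fix c assume c: "c \<in> T a"
      show "c \<in> {a}"
      proof (rule ccontr)
        assume "c \<notin> {a}"
        then have "{a} \<subseteq> A - {c}" using aA by blast
        moreover have "a \<in> acl {a}" using acl_superset by blast
        ultimately have "E c a = 0" using E0[of c a "{a}"] c B by (auto simp: T_def)
        then show False using c by (simp add: T_def)
      qed
    qed
    then have "D a = D0 a + (\<Sum>c\<in>{a}. v c * E c a)" using that by (intro D) auto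
    then show ?thesis using E[OF aA] by (simp add: v_def)
  qed
  ultimately show thesis using that by blast
qed

subsection \<open>A differential field with generic solutions\<close>

text \<open>Every differential polynomial \<open>p\<close> gets its own unused stretch \<open>e\<^sub>0, e\<^sub>1, \<dots>\<close> of a transcendence
  basis.  As a derivation may take arbitrary values on a transcendence basis, one can choose it so that
  \<open>e\<^sub>0\<close> becomes a solution of \<open>p\<close> with \<open>e\<^sub>i\<close> as its \<open>i\<close>-th derivative below the order of \<open>p\<close>.\<close>

definition generic_solutions :: "(complex \<Rightarrow> complex) \<Rightarrow> complex set \<Rightarrow> bool" where
  "generic_solutions D K \<longleftrightarrow>
     (\<forall>p n F. finite {m. p m \<noteq> 0} \<and> (\<exists>m. p m \<noteq> 0 \<and> n \<in># m) \<and>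
        (\<forall>m. p m \<noteq> 0 \<longrightarrow> set_mset m \<subseteq> {..n}) \<and> finite F \<longrightarrow>
        (\<exists>a. mp_eval p (\<lambda>i. (D ^^ i) a) = 0 \<and>
           (\<forall>i<n. (D ^^ i) a \<notin> acl (K \<union> range p \<union> F \<union> (\<lambda>j. (D ^^ j) a) ` {..<i}))))"

theorem exists_generic_differential_field:
  obtains D :: "complex \<Rightarrow> complex" and \<sigma> :: "complex fls \<Rightarrow> complex"
  where "derivation D" "\<sigma> 1 = 1" "\<And>x y. \<sigma> (x + y) = \<sigma> x + \<sigma> y" "\<And>x y. \<sigma> (x * y) = \<sigma> x * \<sigma> y"
    "\<And>x. D (\<sigma> x) = \<sigma> (fls_deriv x)" "generic_solutions D (range \<sigma>)"
proof -
  obtain A and j :: "complex fls + task \<times> nat \<Rightarrow> complex"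
    where A: "alg_indep A" "acl A = UNIV" and j: "inj j" "range j \<subseteq> A"
    by (rule exists_reservoir)
  define b where "b = j \<circ> Inl"
  have b_indep: "b x \<notin> acl (b ` V)" if "x \<notin> V" for x V
  proof (rule alg_indepD[OF A(1)])
    show "b x \<in> A" using j(2) by (auto simp: b_def)
    show "b ` V \<subseteq> A - {b x}" using j that by (auto simp: b_def inj_eq)
  qed
  obtain \<sigma> :: "complex fls \<Rightarrow> complex" where \<sigma>: "\<sigma> 1 = 1" "\<And>x y. \<sigma> (x + y) = \<sigma> x + \<sigma> y"
    "\<And>x y. \<sigma> (x * y) = \<sigma> x * \<sigma> y" "range \<sigma> \<subseteq> acl (range b)"
    using exists_embedding[of b] b_indep by blast
  have \<sigma>0: "\<sigma> 0 = 0" using \<sigma>(2)[of 0 0] by simp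
  have \<sigma>m: "\<sigma> (x - y) = \<sigma> x - \<sigma> y" for x y
    using \<sigma>(2)[of "x - y" y] by simp
  have \<sigma>nz: "x = 0" if "\<sigma> x = 0" for x
  proof (rule ccontr)
    assume "x \<noteq> 0"
    then have "\<sigma> x * \<sigma> (inverse x) = 1" using \<sigma>(1) \<sigma>(3)[of x "inverse x"] by simp
    then show False using that by simp
  qed
  \<comment> \<open>Differentiation of Laurent series transported along \<open>\<sigma>\<close>. It
    extends to some \<open>D0\<close> on all complex numbers, which is later corrected at the
    reserved basis elements.\<close>
  let ?g = "range (\<lambda>x. (\<sigma> x, Dual (\<sigma> x) (\<sigma> (fls_deriv x))))"
  have "part_hom ?g"
  proof (rule part_homI)
    show "(1, 1) \<in> ?g" by (rule range_eqI[of _ _ 1]) (simp add: \<sigma> \<sigma>0 one_dual_def)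
  next
    fix a b c d assume "(a, b) \<in> ?g" "(c, d) \<in> ?g"
    then obtain x y where xy: "a = \<sigma> x" "b = Dual (\<sigma> x) (\<sigma> (fls_deriv x))"
      "c = \<sigma> y" "d = Dual (\<sigma> y) (\<sigma> (fls_deriv y))" by blast
    show "(a - c, b - d) \<in> ?g"
      unfolding xy by (rule range_eqI[of _ _ "x - y"]) (simp add: \<sigma>m minus_dual_def)
    show "(a * c, b * d) \<in> ?g"
      unfolding xy by (rule range_eqI[of _ _ "x * y"]) (simp add: \<sigma> times_dual_def)
  next
    fix b assume "(0, b) \<in> ?g"
    then obtain x where "\<sigma> x = 0" "b = Dual (\<sigma> x) (\<sigma> (fls_deriv x))" by auto
    then show "b = 0" using \<sigma>nz[of x] \<sigma>0 by (simp add: zero_dual_def)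
  next
    fix a b assume "(a, b) \<in> ?g" "a \<noteq> 0"
    then show "b dvd 1" by (intro dual_unit) auto
  qed
  then obtain D0 where D0: "derivation D0" "\<And>x b. (x, b) \<in> ?g \<Longrightarrow> D0 x = eps b"
    by (rule derivation_extend) auto
  have D0\<sigma>: "D0 (\<sigma> x) = \<sigma> (fls_deriv x)" for x
    using D0(2)[OF rangeI, of x] by simp

  define poly_of :: "task \<Rightarrow> nat multiset \<Rightarrow> complex" where
    "poly_of t m = (case map_of (fst t) m of None \<Rightarrow> 0 | Some c \<Rightarrow> c)" for t m
  define params :: "task \<Rightarrow> complex set" where "params t = snd ` set (fst t) \<union> set (fst (snd t))" for t
  \<comment> \<open>The parameters of a task are arbitrary complex numbers and may themselves depend
    on finitely many elements of its stretch; from \<open>N t\<close> on the stretch is free of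
    them.\<close>
  have "\<forall>t. \<exists>F N. finite F \<and> F \<subseteq> A \<and> params t \<subseteq> acl F \<and> (\<forall>k\<ge>N. j (Inr (t, k)) \<notin> F)"
  proof
    fix t
    have "\<exists>F. finite F \<and> F \<subseteq> A \<and> P \<subseteq> acl F" if "finite P" for P
      using that
    proof (induction P rule: finite_induct)
      case (insert x P)
      then obtain F where F: "finite F" "F \<subseteq> A" "P \<subseteq> acl F" by blast
      obtain G where G: "finite G" "G \<subseteq> A" "x \<in> acl G" using acl_finite[of x A] A(2) by auto
      show ?case
        using F G acl_mono[of F "F \<union> G"] acl_mono[of G "F \<union> G"] by (intro exI[of _ "F \<union> G"]) auto
    qed auto
    moreover have "finite (params t)" by (simp add: params_def)
    ultimately obtain F where F: "finite F" "F \<subseteq> A" "params t \<subseteq> acl F" by blast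
    have "finite ((\<lambda>k. j (Inr (t, k))) -` F)"
      using F(1) j(1) by (intro finite_vimageI injI) (auto dest: injD)
    then obtain N where "\<forall>k\<in>(\<lambda>k. j (Inr (t, k))) -` F. k < N" using finite_nat_set_iff_bounded by blast
    then have "\<forall>k\<ge>N. j (Inr (t, k)) \<notin> F" by (meson leD vimageI2)
    with F show "\<exists>F N. finite F \<and> F \<subseteq> A \<and> params t \<subseteq> acl F \<and> (\<forall>k\<ge>N. j (Inr (t, k)) \<notin> F)"
      by blast
  qed
  then obtain supp N where supp: "\<And>t. supp t \<subseteq> A" "\<And>t. params t \<subseteq> acl (supp t)"
      "\<And>t k. k \<ge> N t \<Longrightarrow> j (Inr (t, k)) \<notin> supp t" by metis
  define e where "e t i = j (Inr (t, N t + i))" for t i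
  \<comment> \<open>The derivative whose index is the order is not free: it must be a root of the
    polynomial in its top variable, at the generic values of the lower ones. For tasks coming from
    an actual polynomial of that order a root exists, as \<open>root\<close> confirms below.\<close>
  define c where "c t = (SOME y. mp_eval (poly_of t) ((e t)(snd (snd t) := y)) = 0)" for t
  \<comment> \<open>The element with index k = \<open>N t\<close> + i is \<open>e t i\<close>. For
    positive order n the test singles out i = n - 1, whose derivative is to be the root
    \<open>c t\<close>; the other elements are sent to their successors.\<close>
  define d where "d a = (case the_inv j a of Inl _ \<Rightarrow> 0
      | Inr (t, k) \<Rightarrow> if Suc k = N t + snd (snd t) then c t else j (Inr (t, Suc k)))" for a
  let ?B = "range (j \<circ> Inr)"
  have B: "?B \<subseteq> A" using j(2) by auto
  have bB: "range b \<subseteq> A - ?B" using j by (auto simp: b_def inj_eq)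
  obtain D where D: "derivation D" "\<And>a. a \<in> acl (A - ?B) \<Longrightarrow> D a = D0 a" "\<And>a. a \<in> ?B \<Longrightarrow> D a = d a"
    using derivation_prescribed[OF A D0(1) B] by metis
  have D\<sigma>: "D (\<sigma> x) = \<sigma> (fls_deriv x)" for x
  proof -
    have "\<sigma> x \<in> acl (A - ?B)" using \<sigma>(4) acl_mono[OF bB] by blast
    then show ?thesis using D(2) D0\<sigma> by simp
  qed
  have De: "D (e t i) = (if Suc i = snd (snd t) then c t else e t (Suc i))" for t i
  proof -
    have "D (e t i) = d (j (Inr (t, N t + i)))" unfolding e_def by (rule D(3)) auto
    then show ?thesis by (simp add: d_def the_inv_f_f[OF j(1)] e_def)
  qed
  have "generic_solutions D (range \<sigma>)"
    unfolding generic_solutions_def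
  proof (intro allI impI; elim conjE exE)
    fix p :: "nat multiset \<Rightarrow> complex" and n and F :: "complex set" and m0
    assume fin: "finite {m. p m \<noteq> 0}" and m0: "p m0 \<noteq> 0" "n \<in># m0"
      and vars: "\<forall>m. p m \<noteq> 0 \<longrightarrow> set_mset m \<subseteq> {..n}" and "finite F"
    obtain ms where ms: "set ms = {m. p m \<noteq> 0}" using finite_list[OF fin] by blast
    obtain xs where xs: "set xs = F" using finite_list[OF \<open>finite F\<close>] by blast
    define t :: task where "t = (map (\<lambda>m. (m, p m)) ms, xs, n)"
    have pt: "poly_of t = p"
      using ms by (auto simp: poly_of_def t_def map_of_map_restrict restrict_map_def fun_eq_iff)
    have nt: "snd (snd t) = n" by (simp add: t_def)
    have "range p \<union> F \<subseteq> insert 0 (params t)" using ms xs by (auto simp: params_def t_def image_iff)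
    also have "insert 0 (params t) \<subseteq> acl (supp t)"
      using ac_subfield_0[OF ac_subfield_acl] supp(2) by (rule insert_subsetI)
    finally have pF: "range p \<union> F \<subseteq> acl (supp t)" .
    define V where "V = range \<sigma> \<union> range p \<union> F"
    have eA: "e t i \<in> A" "e t i \<notin> range b" "e t i \<notin> supp t" for i
      using j supp(3)[of t] by (auto simp: e_def b_def inj_eq)
    have gen: "e t i \<notin> acl (V \<union> e t ` {..<i})" for i
    proof
      assume a: "e t i \<in> acl (V \<union> e t ` {..<i})"
      have "inj (e t)" using j(1) by (intro injI) (simp add: e_def inj_eq)
      then have "e t ` {..<i} \<subseteq> A - {e t i}" using eA(1) by (auto simp: inj_eq)
      moreover have "range b \<subseteq> A - {e t i}" using bB eA(2)[of i] by blast
      moreover have "supp t \<subseteq> A - {e t i}" using supp(1)[of t] eA(3)[of i] by blast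
      ultimately have sub: "range b \<union> supp t \<union> e t ` {..<i} \<subseteq> A - {e t i}" by simp
      \<comment> \<open>The elements of \<open>V\<close> need not be basis elements, but they are
        algebraic over \<open>?W\<close>, a set of basis elements omitting
        \<open>e t i\<close>.\<close>
      let ?W = "range b \<union> supp t \<union> e t ` {..<i}"
      have "range \<sigma> \<subseteq> acl ?W" using \<sigma>(4) by (rule subset_trans) (intro acl_mono, simp add: Un_assoc)
      moreover have "range p \<union> F \<subseteq> acl ?W" using pF by (rule subset_trans) (intro acl_mono, auto)
      moreover have "e t ` {..<i} \<subseteq> acl ?W" by (rule subset_trans[OF _ acl_superset]) simp
      ultimately have "V \<union> e t ` {..<i} \<subseteq> acl ?W" unfolding V_def by simp
      then have "e t i \<in> acl ?W" using a by (rule subsetD[OF acl_subsetI])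
      then show False using alg_indepD[OF A(1) eA(1) sub] by contradiction
    qed
    obtain q where q: "\<And>d. coeff q d = mp_eval (coeff_wrt p n d) (e t)"
        "\<And>y. poly q y = mp_eval p ((e t)(n := y))"
      using mp_eval_univariate[OF fin] by blast
    \<comment> \<open>\<open>m0\<close> contains the variable \<open>n\<close>, so this makes
      \<open>q\<close> nonconstant and the complex numbers supply a root.\<close>
    have "coeff q (count m0 n) \<noteq> 0"
      unfolding q(1)
    proof (rule mp_eval_generic_nonzero)
      show "finite {m. coeff_wrt p n (count m0 n) m \<noteq> 0}" by (rule finite_coeff_wrt[OF fin])
      show "coeff_wrt p n (count m0 n) (filter_mset (\<lambda>i. i \<noteq> n) m0) \<noteq> 0"
        using m0 by (simp add: coeff_wrt_self)
      have "0 \<in> acl V" by (rule ac_subfield_0[OF ac_subfield_acl])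
      then show "coeff_wrt p n (count m0 n) m \<in> acl V" for m
        using acl_superset[of V] by (auto simp: coeff_wrt_def V_def)
      show "set_mset m \<subseteq> {..<n}" if "coeff_wrt p n (count m0 n) m \<noteq> 0" for m
      proof
        fix i assume "i \<in># m"
        then have "i \<le> n" "i \<noteq> n"
          using that vars[rule_format, of "m + replicate_mset (count m0 n) n"]
          by (auto simp: coeff_wrt_def split: if_splits)
        then show "i \<in> {..<n}" by simp
      qed
    qed (rule gen)
    then have "degree q > 0" using m0(2) le_degree[of q "count m0 n"] by (metis count_greater_zero_iff less_le_trans)
    then obtain y where "poly q y = 0" using alg_closed_imp_poly_has_root by blast
    then have "\<exists>y. mp_eval (poly_of t) ((e t)(snd (snd t) := y)) = 0" using q(2) pt nt by auto
    then have root: "mp_eval p ((e t)(n := c t)) = 0"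
      unfolding c_def pt nt by (rule someI_ex)
    \<comment> \<open>In order 0 no derivative is free, and the solution is the root itself.\<close>
    define a where "a = (if n = 0 then c t else e t 0)"
    have Di: "(D ^^ i) a = e t i" if "i < n" for i
      using that by (induction i) (auto simp: a_def De nt)
    have Dn: "(D ^^ n) a = c t"
    proof (cases n)
      case (Suc k)
      then show ?thesis using Di[of k] De[of t k] nt by simp
    qed (simp add: a_def)
    have "mp_eval p (\<lambda>i. (D ^^ i) a) = mp_eval p ((e t)(n := c t))"
    proof (rule mp_eval_cong)
      fix m i assume "p m \<noteq> 0" "i \<in># m"
      then have "i \<le> n" using vars by blast
      then show "(D ^^ i) a = ((e t)(n := c t)) i" using Di Dn by (cases "i = n") auto
    qed
    moreover have "(D ^^ i) a \<notin> acl (V \<union> (\<lambda>j. (D ^^ j) a) ` {..<i})" if "i < n" for i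
    proof -
      have "(\<lambda>j. (D ^^ j) a) ` {..<i} = e t ` {..<i}" using Di that by (intro image_cong) auto
      then show ?thesis using gen[of i] Di[OF that] by simp
    qed
    ultimately show "\<exists>a. mp_eval p (\<lambda>i. (D ^^ i) a) = 0 \<and>
        (\<forall>i<n. (D ^^ i) a \<notin> acl (range \<sigma> \<union> range p \<union> F \<union> (\<lambda>j. (D ^^ j) a) ` {..<i}))"
      using root unfolding V_def by (intro exI[of _ a]) simp
  qed
  then show thesis using that[OF D(1) \<sigma>(1-3) D\<sigma>] by blast
qed

subsection \<open>Splitting the solution set\<close>

lemma part_hom_prod:
  assumes g: "part_hom g" and "finite I" and "\<And>i. i \<in> I \<Longrightarrow> (a i, b i) \<in> g"
  shows "(prod a I, prod b I) \<in> g"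
  using assms(2,3)
  by (induction I rule: finite_induct) (auto intro: part_hom_one[OF g] part_hom_mult[OF g])

lemma part_hom_power: "part_hom g \<Longrightarrow> (a, b) \<in> g \<Longrightarrow> (a ^ n, b ^ n) \<in> g"
  by (induction n) (auto intro: part_hom_one part_hom_mult)

lemma acl_ac_subfield: "ac_subfield S \<Longrightarrow> acl S = S"
  using acl_least[of S S] acl_superset[of S] by blast

definition bi_eval :: "nat \<Rightarrow> (nat \<Rightarrow> complex poly) \<Rightarrow> complex \<Rightarrow> complex \<Rightarrow> complex" where
  "bi_eval N r x y = (\<Sum>j\<le>N. poly (r j) x * y ^ j)"

text \<open>The set T of the overview. The condition on \<open>r N\<close> keeps the relation
  nontrivial in its second argument, so that for \<open>r\<close> over k each member is algebraic
  over k and its \<open>x\<close>.\<close>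

definition ode_image :: "(complex \<Rightarrow> complex) \<Rightarrow> complex poly \<Rightarrow> nat \<Rightarrow> (nat \<Rightarrow> complex poly) \<Rightarrow> complex set" where
  "ode_image D p N r = {a. \<exists>x. D x = poly p x \<and> bi_eval N r x a = 0 \<and> poly (r N) x \<noteq> 0}"

lemma bi_eval_algebraic:
  assumes k: "ac_subfield k" and r: "\<And>i j. coeff (r j) i \<in> k"
    and "bi_eval N r x y = 0" "poly (r N) x \<noteq> 0"
  shows "y \<in> acl (insert x k)"
proof -
  define q where "q = (\<Sum>j\<le>N. monom (poly (r j) x) j)"
  have q: "coeff q j = (if j \<le> N then poly (r j) x else 0)" for j
    by (simp add: q_def coeff_sum)
  have mem: "k \<subseteq> acl (insert x k)" "x \<in> acl (insert x k)"
    using acl_superset[of "insert x k"] by blast+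
  have "coeff q j \<in> acl (insert x k)" for j
    unfolding q using mem r
    by (auto intro!: ac_subfield_poly[OF ac_subfield_acl] ac_subfield_0[OF ac_subfield_acl])
  moreover have "coeff q N \<noteq> 0" using assms(4) by (simp add: q)
  then have "q \<noteq> 0" by (metis coeff_0)
  moreover have "poly q y = 0"
    using assms(3) by (simp add: q_def poly_sum poly_monom bi_eval_def)
  ultimately show ?thesis by (rule ac_subfield_root[OF ac_subfield_acl])
qed

text \<open>\<open>acl_algebraic\<close> is applied to the ring of polynomial values at
  \<open>\<gamma>\<close> instead of the field, so no denominators occur and each coefficient lifts
  to a polynomial over \<open>k\<close>.\<close>

lemma acl_insert_relation:
  fixes k :: "complex set"
  assumes k: "ac_subfield k" and "\<phi> \<in> acl (insert \<gamma> k)"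
  obtains N r where "\<And>i j. coeff (r j) i \<in> k" "bi_eval N r \<gamma> \<phi> = 0" "poly (r N) \<gamma> \<noteq> 0"
proof -
  let ?R = "{poly r \<gamma> | r. \<forall>i. coeff r i \<in> k}"
  have sub: "subring_set ?R"
    unfolding subring_set_def
  proof (intro conjI ballI)
    have "\<forall>i. coeff [:1:] i \<in> k"
      by (simp add: coeff_pCons ac_subfield_1[OF k] ac_subfield_0[OF k] split: nat.split)
    then show "1 \<in> ?R" by (intro CollectI exI[of _ "[:1:]"]) simp
  next
    fix a b assume "a \<in> ?R" "b \<in> ?R"
    then obtain r s where rs: "a = poly r \<gamma>" "b = poly s \<gamma>" "\<forall>i. coeff r i \<in> k" "\<forall>i. coeff s i \<in> k"
      by blast
    have "\<forall>i. coeff (r - s) i \<in> k" "\<forall>i. coeff (r * s) i \<in> k"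
      using rs by (simp_all add: ac_subfield_diff[OF k] coeff_mult ac_subfield_sum[OF k] ac_subfield_mult[OF k])
    then show "a - b \<in> ?R" "a * b \<in> ?R"
      unfolding rs(1,2) poly_diff[symmetric] poly_mult[symmetric] by blast+
  qed
  have "insert \<gamma> k \<subseteq> ?R"
  proof
    fix x assume x: "x \<in> insert \<gamma> k"
    have "\<forall>i. coeff (if x = \<gamma> then [:0, 1:] else [:x:]) i \<in> k"
      using x by (cases "x = \<gamma>")
        (simp_all add: coeff_pCons ac_subfield_1[OF k] ac_subfield_0[OF k] split: nat.split)
    then show "x \<in> ?R" by (intro CollectI exI[of _ "if x = \<gamma> then [:0, 1:] else [:x:]"]) simp
  qed
  then have "\<phi> \<in> acl ?R" using assms(2) acl_mono by blast
  then obtain q where q: "\<And>i. coeff q i \<in> ?R" "q \<noteq> 0" "poly q \<phi> = 0"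
    by (rule acl_algebraic[OF sub]) blast
  have "\<forall>j. \<exists>r. coeff q j = poly r \<gamma> \<and> (\<forall>i. coeff r i \<in> k)" using q(1) by blast
  then obtain r where r: "\<And>j. coeff q j = poly (r j) \<gamma>" "\<And>i j. coeff (r j) i \<in> k" by metis
  show thesis
  proof (rule that[OF r(2)])
    show "bi_eval (degree q) r \<gamma> \<phi> = 0"
      using q(3) by (simp add: bi_eval_def r(1)[symmetric] poly_altdef[of q])
    show "poly (r (degree q)) \<gamma> \<noteq> 0" using q(2) by (simp add: r(1)[symmetric])
  qed
qed

text \<open>The equation x' = p(x) as a differential polynomial of order one, the form to which
  \<open>generic_solutions\<close> applies.\<close>

lemma ode_polynomial:
  fixes p :: "complex poly"
  obtains q :: "nat multiset \<Rightarrow> complex" where "finite {m. q m \<noteq> 0}" "q {#1#} = 1"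
    "\<And>m. q m \<noteq> 0 \<Longrightarrow> set_mset m \<subseteq> {..1}" "\<And>x. mp_eval q x = x 1 - poly p (x 0)"
proof -
  let ?S = "insert {#1#} ((\<lambda>i. replicate_mset i 0) ` {..degree p})"
  define q :: "nat multiset \<Rightarrow> complex" where
    "q m = (if m = {#1#} then 1 else if m = replicate_mset (size m) 0 then - coeff p (size m) else 0)" for m
  have sup: "{m. q m \<noteq> 0} \<subseteq> ?S"
    by (auto simp: q_def intro: le_degree split: if_splits)
  have new: "{#1#} \<noteq> replicate_mset i (0::nat)" for i
    by (cases i) (auto simp: add_mset_eq_single)
  have qr: "q (replicate_mset i 0) = - coeff p i" for i
    using new[of i] by (auto simp: q_def)
  have inj: "inj_on (\<lambda>i. replicate_mset i (0::nat)) {..degree p}"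
    by (intro inj_onI) (metis size_replicate_mset)
  have "mp_eval q x = x 1 - poly p (x 0)" for x
  proof -
    let ?t = "\<lambda>m. q m * (\<Prod>i\<in>set_mset m. x i ^ count m i)"
    have "mp_eval q x = sum ?t ?S" by (rule mp_eval_superset[OF _ sup]) simp
    also have "\<dots> = ?t {#1#} + sum ?t ((\<lambda>i. replicate_mset i 0) ` {..degree p})"
      using new by (subst sum.insert) auto
    also have "sum ?t ((\<lambda>i. replicate_mset i 0) ` {..degree p})
        = (\<Sum>i\<le>degree p. - (coeff p i * x 0 ^ i))"
    proof (subst sum.reindex[OF inj], rule sum.cong[OF refl])
      show "(?t \<circ> (\<lambda>i. replicate_mset i 0)) i = - (coeff p i * x 0 ^ i)" for i
        by (cases "i = 0") (auto simp: qr qr[of 0, simplified])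
    qed
    moreover have "q {#1#} = 1" by (simp add: q_def)
    ultimately show ?thesis by (simp add: poly_altdef sum_negf)
  qed
  moreover have "set_mset m \<subseteq> {..1}" if "q m \<noteq> 0" for m
    using that sup by (auto split: if_splits)
  moreover have "finite {m. q m \<noteq> 0}" by (rule finite_subset[OF sup]) simp
  ultimately show thesis using that[of q] by (simp add: q_def)
qed

text \<open>The algebraic core, with \<open>\<phi>\<close> for the given function and
  \<open>\<gamma>\<close> for the next chain element. The dichotomy is assumed for all
  \<open>N\<close> and \<open>r\<close> because the relation between \<open>\<gamma>\<close> and
  \<open>\<phi>\<close> is found only in the proof.\<close>

theorem no_minimal_dichotomy:
  fixes K k :: "complex set" and P :: "nat multiset \<Rightarrow> complex"
  assumes D: "derivation D" and gen: "generic_solutions D K"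
    and k: "ac_subfield k" "k \<subseteq> acl K" "\<And>x. x \<in> k \<Longrightarrow> D x \<in> k"
    and p: "\<And>i. coeff p i \<in> k" "D \<gamma> = poly p \<gamma>"
    and \<phi>: "\<phi> \<in> acl (insert \<gamma> k)" "\<phi> \<notin> k" "mp_eval P (\<lambda>i. (D ^^ i) \<phi>) = 0"
    and P: "finite {m. P m \<noteq> 0}" "\<And>m. P m \<in> k" "P m0 \<noteq> 0" "n \<in># m0"
      "\<And>m. P m \<noteq> 0 \<Longrightarrow> set_mset m \<subseteq> {..n}" "n \<ge> 2"
    and dichotomy: "\<And>N r. finite ({a. mp_eval P (\<lambda>i. (D ^^ i) a) = 0} \<inter> ode_image D p N r) \<or>
      finite ({a. mp_eval P (\<lambda>i. (D ^^ i) a) = 0} - ode_image D p N r)"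
  shows False
proof -
  let ?S = "{a. mp_eval P (\<lambda>i. (D ^^ i) a) = 0}"
  have acl_k: "acl k = k" by (rule acl_ac_subfield[OF k(1)])
  have k_le: "k \<subseteq> acl (K \<union> V)" for V using k(2) acl_mono[of K "K \<union> V"] by blast
  have insert_le: "acl (insert b k) \<subseteq> acl (K \<union> V)" if "b \<in> acl (K \<union> V)" for b V
    using that k_le by (intro acl_subsetI) blast
  have \<gamma>: "\<gamma> \<notin> k" using \<phi>(1,2) acl_k by (metis insert_absorb)
  obtain N r where r: "\<And>i j. coeff (r j) i \<in> k" and R: "bi_eval N r \<gamma> \<phi> = 0" "poly (r N) \<gamma> \<noteq> 0"
    by (rule acl_insert_relation[OF k(1) \<phi>(1)]) blast
  let ?T = "ode_image D p N r"
  \<comment> \<open>The equation puts D x back into the closure of \<open>k\<close> and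
    \<open>x\<close>, and derivatives of algebraic elements follow.\<close>
  have D_closed: "D y \<in> acl (insert x k)" if x: "D x = poly p x" and y: "y \<in> acl (insert x k)" for x y
  proof (rule derivation_acl_closed[OF D _ y])
    have mem: "k \<subseteq> acl (insert x k)" "x \<in> acl (insert x k)"
      using acl_superset[of "insert x k"] by blast+
    have "coeff p i \<in> acl (insert x k)" for i using mem(1) p(1) by blast
    then have "D x \<in> acl (insert x k)" unfolding x by (rule ac_subfield_poly[OF ac_subfield_acl _ mem(2)])
    moreover fix z assume "z \<in> insert x k"
    ultimately show "D z \<in> acl (insert x k)" using k(3) mem(1) by blast
  qed
  show False
  proof (cases "finite (?S - ?T)")
    case True
    obtain b where b: "mp_eval P (\<lambda>i. (D ^^ i) b) = 0"
      and ind: "\<And>i. i < n \<Longrightarrow> (D ^^ i) b \<notin> acl (K \<union> range P \<union> (?S - ?T) \<union> (\<lambda>j. (D ^^ j) b) ` {..<i})"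
    proof -
      \<comment> \<open>The finite set to avoid is \<open>?S - ?T\<close> itself, which forces
        \<open>b\<close> into \<open>?T\<close>.\<close>
      have "\<exists>b. mp_eval P (\<lambda>i. (D ^^ i) b) = 0 \<and>
          (\<forall>i<n. (D ^^ i) b \<notin> acl (K \<union> range P \<union> (?S - ?T) \<union> (\<lambda>j. (D ^^ j) b) ` {..<i}))"
        by (rule gen[unfolded generic_solutions_def, rule_format]) (use P True in auto)
      then show thesis using that by (elim exE conjE) blast
    qed
    have 0: "b \<notin> acl (K \<union> (range P \<union> (?S - ?T)))" using ind[of 0] P(6) by (simp add: Un_assoc)
    have 1: "D b \<notin> acl (K \<union> (range P \<union> (?S - ?T) \<union> {b}))"
      using ind[of 1] P(6) by (simp add: Un_assoc lessThan_Suc)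
    have "b \<notin> ?S - ?T" using 0 acl_superset[of "K \<union> (range P \<union> (?S - ?T))"] by blast
    then have "b \<in> ?T" using b by simp
    then obtain x where x: "D x = poly p x" "bi_eval N r x b = 0" "poly (r N) x \<noteq> 0"
      unfolding ode_image_def by blast
    have bx: "b \<in> acl (insert x k)" by (rule bi_eval_algebraic[OF k(1) r x(2,3)])
    have "b \<notin> acl k" using 0 k_le acl_k by blast
    \<comment> \<open>Thus \<open>b\<close> and \<open>x\<close> are interalgebraic over
      \<open>k\<close>, and D b is algebraic over \<open>k\<close> and \<open>b\<close>, against the
      independence granted by order at least two.\<close>
    then have "x \<in> acl (insert b k)" by (rule acl_exchange[OF bx])
    then have "acl (insert x k) \<subseteq> acl (insert b k)"
      using acl_superset[of "insert b k"] by (intro acl_subsetI) blast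
    moreover have "b \<in> acl (K \<union> (range P \<union> (?S - ?T) \<union> {b}))"
      using acl_superset[of "K \<union> (range P \<union> (?S - ?T) \<union> {b})"] by blast
    ultimately have "D b \<in> acl (K \<union> (range P \<union> (?S - ?T) \<union> {b}))"
      using D_closed[OF x(1) bx] insert_le by blast
    then show False using 1 by contradiction
  next
    case False
    then have F: "finite (?S \<inter> ?T)" using dichotomy by blast
    obtain q :: "nat multiset \<Rightarrow> complex" where q: "finite {m. q m \<noteq> 0}" "q {#1#} = 1"
        "\<And>m. q m \<noteq> 0 \<Longrightarrow> set_mset m \<subseteq> {..1}" "\<And>x. mp_eval q x = x 1 - poly p (x 0)"
      by (rule ode_polynomial[of p]) blast
    have qm: "\<exists>m. q m \<noteq> 0 \<and> 1 \<in># m" using q(2) by (intro exI[of _ "{#1#}"]) simp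
    obtain e where e: "mp_eval q (\<lambda>i. (D ^^ i) e) = 0"
      and ind: "\<And>i. i < 1 \<Longrightarrow> (D ^^ i) e \<notin> acl (K \<union> range q \<union> (?S \<inter> ?T) \<union> (\<lambda>j. (D ^^ j) e) ` {..<i})"
    proof -
      \<comment> \<open>Now the finite set to avoid is \<open>?S \<inter> ?T\<close>. A conjugate of
        \<open>\<phi>\<close> will land in it and make \<open>e\<close> algebraic over
        \<open>k\<close> and that set.\<close>
      have "\<exists>e. mp_eval q (\<lambda>i. (D ^^ i) e) = 0 \<and>
          (\<forall>i<1. (D ^^ i) e \<notin> acl (K \<union> range q \<union> (?S \<inter> ?T) \<union> (\<lambda>j. (D ^^ j) e) ` {..<i}))"
        by (rule gen[unfolded generic_solutions_def, rule_format]) (use q F qm in auto)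
      then show thesis using that by (elim exE conjE) blast
    qed
    have e_new: "e \<notin> acl (K \<union> (range q \<union> (?S \<inter> ?T)))" using ind[of 0] by (simp add: Un_assoc)
    have De: "D e = poly p e" using e by (simp add: q(4))
    have ek: "e \<notin> k" using e_new k_le by blast
    have Id: "part_hom (Id_on k)"
      by (rule part_homI) (auto simp: ac_subfield_1[OF k(1)] ac_subfield_diff[OF k(1)]
          ac_subfield_mult[OF k(1)] dvd_field_iff)
    have lifts_Id: "lifts (Id_on k) r s \<longleftrightarrow> r = s \<and> (\<forall>i. coeff r i \<in> k)" for r s
      by (auto simp: lifts_def poly_eq_iff Id_on_iff)
    \<comment> \<open>\<open>\<gamma>\<close> and \<open>e\<close> are both transcendental over
      \<open>k\<close>, so the identity of \<open>k\<close> extends by sending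
      \<open>\<gamma>\<close> to \<open>e\<close>, and then to all algebraic elements.\<close>
    have "part_hom (adjoin (Id_on k) \<gamma> e)"
    proof (rule part_hom_adjoin_transcendental[OF Id])
      fix r s assume "lifts (Id_on k) r s" "poly r \<gamma> = 0"
      then show "r = 0" using \<gamma> ac_subfield_root[OF k(1), of r \<gamma>] by (auto simp: lifts_Id)
    next
      fix r s assume "lifts (Id_on k) r s" "r \<noteq> 0"
      then have "poly s e \<noteq> 0" using ek ac_subfield_root[OF k(1), of r e] by (auto simp: lifts_Id)
      then show "poly s e dvd 1" by (simp add: dvd_field_iff)
    qed
    then obtain g where g: "adjoin (Id_on k) \<gamma> e \<subseteq> g" "part_hom g" "ac_subfield (Domain g)"
      by (rule part_hom_extend_algebraic)
    have g_k: "(x, x) \<in> g" if "x \<in> k" for x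
      using that adjoin_superset[OF Id, of \<gamma> e] g(1) by blast
    have g_\<gamma>: "(\<gamma>, e) \<in> g" using adjoin_elem[OF Id, of \<gamma> e] g(1) by blast
    have g_poly: "(poly s x, poly s y) \<in> g" if "\<And>i. coeff s i \<in> k" "(x, y) \<in> g" for s x y
      unfolding poly_altdef using that g_k
      by (intro part_hom_sum[OF g(2)] part_hom_mult[OF g(2)] part_hom_power[OF g(2)]) auto
    let ?L = "acl (insert \<gamma> k)"
    have L: "ac_subfield ?L" by (rule ac_subfield_acl)
    have "insert \<gamma> k \<subseteq> Domain g" using g_k g_\<gamma> by blast
    then have "?L \<subseteq> Domain g" by (rule acl_least[OF g(3)])
    then have "\<forall>x\<in>?L. \<exists>y. (x, y) \<in> g" by blast
    then obtain \<tau> where \<tau>: "\<And>x. x \<in> ?L \<Longrightarrow> (x, \<tau> x) \<in> g" by metis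
    have \<tau>_eq: "\<tau> x = y" if "x \<in> ?L" "(x, y) \<in> g" for x y
      using part_hom_fun[OF g(2)] \<tau>[OF that(1)] that(2) by blast
    have mem: "k \<subseteq> ?L" "\<gamma> \<in> ?L" using acl_superset[of "insert \<gamma> k"] by blast+
    have DL: "D x \<in> ?L" if "x \<in> ?L" for x by (rule D_closed[OF p(2) that])
    have \<tau>_hom: "\<tau> 1 = 1" "\<tau> (x + y) = \<tau> x + \<tau> y" "\<tau> (x * y) = \<tau> x * \<tau> y"
      if "x \<in> ?L" "y \<in> ?L" for x y
      using that by (auto intro!: \<tau>_eq part_hom_add[OF g(2)] part_hom_mult[OF g(2)] part_hom_one[OF g(2)] \<tau>
          ac_subfield_1[OF L] ac_subfield_add[OF L] ac_subfield_mult[OF L])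
    \<comment> \<open>The commutation defect is a derivation along \<open>\<tau>\<close>. It
      vanishes on \<open>k\<close>, which is fixed, and at \<open>\<gamma>\<close>, since
      \<open>\<gamma>\<close> and \<open>e\<close> satisfy the same first-order equation; by
      \<open>ac_subfield_kernel\<close> it vanishes on the closure, and \<open>\<tau>\<close>
      preserves differential equations over \<open>k\<close>.\<close>
    define \<delta> where "\<delta> x = D (\<tau> x) - \<tau> (D x)" for x
    have "ac_subfield {x \<in> ?L. \<delta> x = 0}"
    proof (rule ac_subfield_kernel[OF L])
      show "\<tau> 1 = 1" using \<tau>_hom(1) mem(2) by blast
      show "\<delta> (x + y) = \<delta> x + \<delta> y" "\<delta> (x * y) = \<delta> x * \<tau> y + \<tau> x * \<delta> y"
        if "x \<in> ?L" "y \<in> ?L" for x y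
        using that DL ac_subfield_mult[OF L]
        by (simp_all add: \<delta>_def \<tau>_hom derivation_add[OF D] derivation_mult[OF D] algebra_simps)
    qed (use \<tau>_hom in auto)
    moreover have "\<delta> x = 0" if "x \<in> insert \<gamma> k" for x
    proof (cases "x = \<gamma>")
      case True
      have "\<tau> \<gamma> = e" using \<tau>_eq mem(2) g_\<gamma> by blast
      moreover have "\<tau> (D \<gamma>) = poly p e"
        using DL[OF mem(2)] g_poly[OF p(1) g_\<gamma>] unfolding p(2) by (rule \<tau>_eq)
      ultimately show ?thesis using True De by (simp add: \<delta>_def)
    next
      case False
      then have "x \<in> k" using that by blast
      then have "\<tau> x = x" "\<tau> (D x) = D x" using mem(1) g_k k(3) by (auto intro!: \<tau>_eq)
      then show ?thesis by (simp add: \<delta>_def)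
    qed
    then have "insert \<gamma> k \<subseteq> {x \<in> ?L. \<delta> x = 0}" using mem by blast
    ultimately have "?L \<subseteq> {x \<in> ?L. \<delta> x = 0}" by (rule acl_least)
    then have comm: "D (\<tau> x) = \<tau> (D x)" if "x \<in> ?L" for x using that by (auto simp: \<delta>_def)
    have iter: "(D ^^ i) \<phi> \<in> ?L \<and> (D ^^ i) (\<tau> \<phi>) = \<tau> ((D ^^ i) \<phi>)" for i
      by (induction i) (auto simp: \<phi>(1) DL comm)
    let ?a = "\<tau> \<phi>"
    have ga: "(\<phi>, ?a) \<in> g" by (rule \<tau>[OF \<phi>(1)])
    have "(mp_eval P (\<lambda>i. (D ^^ i) \<phi>), mp_eval P (\<lambda>i. (D ^^ i) ?a)) \<in> g"
      unfolding mp_eval_def using P(1,2) iter \<tau> g_k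
      by (intro part_hom_sum[OF g(2)] part_hom_mult[OF g(2)] part_hom_prod[OF g(2)] part_hom_power[OF g(2)]) auto
    then have aS: "?a \<in> ?S" using \<phi>(3) part_hom_zeroD[OF g(2)] by simp
    have "(bi_eval N r \<gamma> \<phi>, bi_eval N r e ?a) \<in> g"
      unfolding bi_eval_def using r g_\<gamma> ga
      by (intro part_hom_sum[OF g(2)] part_hom_mult[OF g(2)] part_hom_power[OF g(2)] g_poly) auto
    then have Re: "bi_eval N r e ?a = 0" using R(1) part_hom_zeroD[OF g(2)] by simp
    have ce: "poly (r N) e \<noteq> 0"
      using part_hom_unit[OF g(2) g_poly[OF r g_\<gamma>] R(2)] by auto
    have "?a \<in> ?T" unfolding ode_image_def using De Re ce by blast
    then have "?a \<in> acl (K \<union> (range q \<union> (?S \<inter> ?T)))"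
      using aS acl_superset[of "K \<union> (range q \<union> (?S \<inter> ?T))"] by blast
    then have le: "acl (insert ?a k) \<subseteq> acl (K \<union> (range q \<union> (?S \<inter> ?T)))" by (rule insert_le)
    have "?a \<notin> k"
    proof
      assume "?a \<in> k"
      then have "(\<phi> - ?a, ?a - ?a) \<in> g" by (intro part_hom_diff[OF g(2)] ga g_k)
      then have "\<phi> - ?a = 0" using part_hom_unit[OF g(2), of "\<phi> - ?a" 0] by auto
      then show False using \<open>?a \<in> k\<close> \<phi>(2) by simp
    qed
    then have "?a \<notin> acl k" using acl_k by simp
    then have "e \<in> acl (insert ?a k)"
      by (rule acl_exchange[OF bi_eval_algebraic[OF k(1) r Re ce]])
    then show False using e_new le by blast
  qed
qed

subsection \<open>Polynomials over a ring given by its carrier\<close>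

lemma (in ring) indexed_pset_support:
  assumes "p \<in> indexed_pset I K" "K \<subseteq> carrier R"
  shows "finite {m. p m \<noteq> \<zero>} \<and> (\<forall>m. p m \<in> carrier R) \<and> (\<forall>m. p m \<noteq> \<zero> \<longrightarrow> set_mset m \<subseteq> I)"
  using assms(1)
proof (induction rule: indexed_pset.induct)
  case (indexed_const k)
  then show ?case using assms(2)
    by (auto simp: indexed_const_def intro: finite_subset[of _ "{{#}}"])
next
  case (indexed_padd p q)
  have "{m. indexed_padd p q m \<noteq> \<zero>} \<subseteq> {m. p m \<noteq> \<zero>} \<union> {m. q m \<noteq> \<zero>}"
    by (auto simp: indexed_padd_def)
  moreover from this have "set_mset m \<subseteq> I" if "indexed_padd p q m \<noteq> \<zero>" for m
    using that indexed_padd.IH by blast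
  ultimately show ?case using indexed_padd.IH by (auto simp: indexed_padd_def intro: finite_subset)
next
  case (indexed_pmult p i)
  have sub: "{m. indexed_pmult p i m \<noteq> \<zero>} \<subseteq> add_mset i ` {m. p m \<noteq> \<zero>}"
    by (auto simp: indexed_pmult_def split: if_splits intro!: image_eqI[of _ _ "_ - {#i#}"])
  then have "finite {m. indexed_pmult p i m \<noteq> \<zero>}"
    using indexed_pmult.IH finite_subset by blast
  moreover have "set_mset m \<subseteq> I" if "indexed_pmult p i m \<noteq> \<zero>" for m
    using that sub indexed_pmult by fastforce
  ultimately show ?case using indexed_pmult.IH by (auto simp: indexed_pmult_def)
qed

text \<open>Passes from carrier-based to type-class evaluation. It is used with
  \<open>\<iota>\<close> the singleton map, for the field of singletons, and with the identity, for
  \<open>complex_ring\<close>.\<close>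

lemma mpoly_eval_transfer:
  fixes \<iota> :: "'c::comm_ring_1 \<Rightarrow> 'a" and R (structure)
  assumes R: "cring R" and \<iota>: "\<And>x. \<iota> x \<in> carrier R" "\<iota> 0 = \<zero>" "\<iota> 1 = \<one>"
      "\<And>x y. \<iota> (x + y) = \<iota> x \<oplus> \<iota> y" "\<And>x y. \<iota> (x * y) = \<iota> x \<otimes> \<iota> y" "inj \<iota>"
    and fin: "finite {m. p m \<noteq> 0}"
  shows "mpoly_eval R (\<lambda>m. \<iota> (p m)) (\<lambda>i. \<iota> (x i)) = \<iota> (mp_eval p x)"
proof -
  interpret cring R by (rule R)
  have pow: "\<iota> a [^] (n :: nat) = \<iota> (a ^ n)" for a n
    by (induction n) (simp_all add: \<iota> m_comm)
  have prd: "finite I \<Longrightarrow> finprod R (\<lambda>i. \<iota> (f i)) I = \<iota> (prod f I)" for f :: "'d \<Rightarrow> 'c" and I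
    by (induction I rule: finite_induct) (auto simp: \<iota>(1,3) \<iota>(5)[symmetric])
  have sm: "finite I \<Longrightarrow> finsum R (\<lambda>i. \<iota> (f i)) I = \<iota> (sum f I)" for f :: "'d multiset \<Rightarrow> 'c" and I
    by (induction I rule: finite_induct) (auto simp: \<iota>(1,2) \<iota>(4)[symmetric])
  have nz: "\<iota> a \<noteq> \<zero> \<longleftrightarrow> a \<noteq> 0" for a using \<iota>(2,6) by (metis injD)
  show ?thesis
    unfolding mpoly_eval_def mp_eval_def nz pow
    by (simp add: prd \<iota>(5)[symmetric] sm[OF fin])
qed

text \<open>The default -1 cannot be the maximum when the order is a natural number, so the order is
  attained by a variable that occurs.\<close>

lemma diff_order_geD:
  assumes "ring R" "finite {m. p m \<noteq> \<zero>\<^bsub>R\<^esub>}" "diff_order R p = int n"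
  shows "\<exists>m. p m \<noteq> \<zero>\<^bsub>R\<^esub> \<and> n \<in># m" "p m \<noteq> \<zero>\<^bsub>R\<^esub> \<Longrightarrow> set_mset m \<subseteq> {..n}"
proof -
  let ?V = "{i. \<not> ring.index_free R p i}"
  have V: "?V = (\<Union>m\<in>{m. p m \<noteq> \<zero>\<^bsub>R\<^esub>}. set_mset m)"
    by (auto simp: ring.index_free_def[OF assms(1)])
  then have fin: "finite (insert (- 1) (int ` ?V))" using assms(2) by auto
  have "int n \<in> insert (- 1) (int ` ?V)"
    using Max_in[OF fin] assms(3) unfolding diff_order_def by auto
  then show "\<exists>m. p m \<noteq> \<zero>\<^bsub>R\<^esub> \<and> n \<in># m" using V by auto
  show "set_mset m \<subseteq> {..n}" if "p m \<noteq> \<zero>\<^bsub>R\<^esub>"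
  proof
    fix i assume "i \<in># m"
    then have "int i \<in> insert (- 1) (int ` ?V)" using V that by auto
    then have "int i \<le> int n" using Max_ge[OF fin] assms(3) unfolding diff_order_def by metis
    then show "i \<in> {..n}" by simp
  qed
qed

lemma diff_order_lessD:
  assumes "ring R" "finite {m. p m \<noteq> \<zero>\<^bsub>R\<^esub>}" "diff_order R p < int n" "p m \<noteq> \<zero>\<^bsub>R\<^esub>"
  shows "set_mset m \<subseteq> {..<n}"
proof
  fix i assume i: "i \<in># m"
  let ?V = "{i. \<not> ring.index_free R p i}"
  have V: "?V = (\<Union>m\<in>{m. p m \<noteq> \<zero>\<^bsub>R\<^esub>}. set_mset m)"
    by (auto simp: ring.index_free_def[OF assms(1)])
  then have "finite (insert (- 1) (int ` ?V))" using assms(2) by auto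
  moreover have "int i \<in> insert (- 1) (int ` ?V)" using V i assms(4) by auto
  ultimately have "int i \<le> diff_order R p" unfolding diff_order_def by (rule Max_ge)
  then show "i \<in> {..<n}" using assms(3) by simp
qed

lemma diff_order_ge_neg: "finite {i. \<not> ring.index_free R p i} \<Longrightarrow> diff_order R p \<ge> -1"
  unfolding diff_order_def by (intro Max_ge) auto

subsection \<open>A differentially closed field of singletons\<close>

text \<open>Singletons, because \<^const>\<open>strongly_minimal_ade\<close> asks for fields inside the type \<^typ>\<open>complex set\<close>.\<close>

definition model :: "(complex \<Rightarrow> complex) \<Rightarrow> complex set diff_ring" where
  "model D = \<lparr>carrier = range (\<lambda>z. {z}), monoid.mult = (\<lambda>A B. {the_elem A * the_elem B}),
     one = {1}, ring.zero = {0}, add = (\<lambda>A B. {the_elem A + the_elem B}), der = (\<lambda>A. {D (the_elem A)})\<rparr>"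

lemma model_simps [simp]:
  "carrier (model D) = range (\<lambda>z. {z})" "{x} \<otimes>\<^bsub>model D\<^esub> {y} = {x * y}" "\<one>\<^bsub>model D\<^esub> = {1}"
  "\<zero>\<^bsub>model D\<^esub> = {0}" "{x} \<oplus>\<^bsub>model D\<^esub> {y} = {x + y}" "der (model D) {x} = {D x}"
  by (simp_all add: model_def)

lemma field_model: "field (model D)"
proof -
  have "cring (model D)"
  proof (rule cringI)
    show "abelian_group (model D)"
      by (rule abelian_groupI) (auto simp: add_ac intro: exI[of _ "- _"] bexI[of _ "{- _}"])
    show "comm_monoid (model D)"
      by (rule comm_monoidI) (auto simp: mult_ac)
  qed (auto simp: algebra_simps)
  then show ?thesis
  proof (rule cring.cring_fieldI2)
    fix a assume "a \<in> carrier (model D)" "a \<noteq> \<zero>\<^bsub>model D\<^esub>"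
    then obtain x where "a = {x}" "x \<noteq> 0" by auto
    then show "\<exists>b\<in>carrier (model D). a \<otimes>\<^bsub>model D\<^esub> b = \<one>\<^bsub>model D\<^esub>"
      by (intro bexI[of _ "{inverse x}"]) auto
  qed auto
qed

lemma differential_field_model:
  assumes D: "derivation D"
  shows "differential_field (model D)"
proof -
  interpret field "model D" by (rule field_model)
  have pow: "[n] \<cdot>\<^bsub>model D\<^esub> {1} = {of_nat n}" for n
    by (induction n) (simp_all add: add.commute)
  show ?thesis
  proof (unfold_locales)
    show "n > 0 \<Longrightarrow> [n] \<cdot>\<^bsub>model D\<^esub> \<one>\<^bsub>model D\<^esub> \<noteq> \<zero>\<^bsub>model D\<^esub>" for n :: nat
      by (simp add: pow)
  qed (auto simp: derivation_add[OF D] derivation_mult[OF D])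
qed

lemma der_model_iterate: "(der (model D) ^^ i) {a} = {(D ^^ i) a}"
  by (induction i) auto

lemma diff_eval_model:
  assumes "finite {m. p m \<noteq> 0}"
  shows "diff_eval (model D) (\<lambda>m. {p m}) {a} = {mp_eval p (\<lambda>i. (D ^^ i) a)}"
  unfolding diff_eval_def der_model_iterate
  using domain.axioms(1)[OF field.axioms(1)[OF field_model]] assms by (intro mpoly_eval_transfer) (auto simp: inj_on_def)

lemma diff_polys_model:
  assumes "p \<in> diff_polys (model D)"
  obtains q where "p = (\<lambda>m. {q m})" "finite {m. q m \<noteq> 0}"
proof -
  interpret field "model D" by (rule field_model)
  have p: "finite {m. p m \<noteq> {0}}" "\<And>m. p m \<in> range (\<lambda>z. {z})"
    using indexed_pset_support[of p UNIV "carrier (model D)"] assms by (auto simp: diff_polys_def)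
  have "\<forall>m. \<exists>z. p m = {z}" using p(2) by blast
  then obtain q where "\<And>m. p m = {q m}" by metis
  then show thesis using p(1) that[of q] by auto
qed

text \<open>In Blum's axiom \<open>Q\<close> involves only derivatives below the order of
  \<open>P\<close>. A solution of \<open>P\<close> generic over the coefficients of \<open>Q\<close>
  has these derivatives algebraically independent, so \<open>Q\<close> does not vanish
  there.\<close>

lemma differentially_closed_model:
  assumes D: "derivation D" and gen: "generic_solutions D K"
  shows "differentially_closed (model D)"
  unfolding differentially_closed_def
proof (intro conjI ballI impI differential_field_model[OF D]; elim conjE)
  interpret field "model D" by (rule field_model)
  fix P Q assume PQ: "P \<in> diff_polys (model D)" "Q \<in> diff_polys (model D)"
    and ord: "diff_order (model D) Q < diff_order (model D) P" and nz: "Q \<noteq> (\<lambda>_. \<zero>\<^bsub>model D\<^esub>)"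
  obtain p where p: "P = (\<lambda>m. {p m})" "finite {m. p m \<noteq> 0}" by (rule diff_polys_model[OF PQ(1)])
  obtain q where q: "Q = (\<lambda>m. {q m})" "finite {m. q m \<noteq> 0}" by (rule diff_polys_model[OF PQ(2)])
  have "{i. \<not> index_free Q i} = (\<Union>m\<in>{m. q m \<noteq> 0}. set_mset m)"
    by (auto simp: index_free_def q)
  \<comment> \<open>Orders are at least -1, so one that exceeds the order of \<open>Q\<close> is a
    natural number.\<close>
  then have "diff_order (model D) Q \<ge> -1" using q(2) by (intro diff_order_ge_neg) simp
  then obtain n where n: "diff_order (model D) P = int n"
    using ord by (metis nonneg_int_cases zle_add1_eq_le add.commute add.right_inverse less_le_trans
        order.strict_trans1 int_one_le_iff_zero_less linorder_not_le zless_imp_add1_zle)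
  have pm: "{m. P m \<noteq> \<zero>\<^bsub>model D\<^esub>} = {m. p m \<noteq> 0}" and qm: "{m. Q m \<noteq> \<zero>\<^bsub>model D\<^esub>} = {m. q m \<noteq> 0}"
    by (auto simp: p q)
  have vp: "\<exists>m. p m \<noteq> 0 \<and> n \<in># m" "\<And>m. p m \<noteq> 0 \<Longrightarrow> set_mset m \<subseteq> {..n}"
    using diff_order_geD[OF ring_axioms, of P n] p n pm by auto
  have vq: "set_mset m \<subseteq> {..<n}" if "q m \<noteq> 0" for m
    using diff_order_lessD[OF ring_axioms, of Q n m] q n ord qm that by auto
  have fin: "finite (range q)"
    by (rule finite_subset[of _ "insert 0 (q ` {m. q m \<noteq> 0})"]) (use q(2) in auto)
  have "\<exists>a. mp_eval p (\<lambda>i. (D ^^ i) a) = 0 \<and>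
      (\<forall>i<n. (D ^^ i) a \<notin> acl (K \<union> range p \<union> range q \<union> (\<lambda>j. (D ^^ j) a) ` {..<i}))"
    by (rule gen[unfolded generic_solutions_def, rule_format]) (use p(2) vp fin in auto)
  then obtain a where a: "mp_eval p (\<lambda>i. (D ^^ i) a) = 0"
      "\<And>i. i < n \<Longrightarrow> (D ^^ i) a \<notin> acl (K \<union> range p \<union> range q \<union> (\<lambda>j. (D ^^ j) a) ` {..<i})" by blast
  obtain m where m: "q m \<noteq> 0" using nz by (auto simp: q fun_eq_iff)
  have "mp_eval q (\<lambda>i. (D ^^ i) a) \<noteq> 0"
  proof (rule mp_eval_generic_nonzero[OF q(2) m _ vq a(2)])
    show "q m \<in> acl (K \<union> range p \<union> range q)" for m
      using acl_superset[of "K \<union> range p \<union> range q"] by blast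
  qed
  then show "\<exists>a\<in>carrier (model D). diff_eval (model D) P a = \<zero>\<^bsub>model D\<^esub> \<and> diff_eval (model D) Q a \<noteq> \<zero>\<^bsub>model D\<^esub>"
    using a(1) by (intro bexI[of _ "{a}"]) (simp_all add: p q diff_eval_model)
qed

section \<open>A formula for the set T\<close>

primrec pow_term :: "complex set dterm \<Rightarrow> nat \<Rightarrow> complex set dterm" where
  "pow_term t 0 = DPar {1}"
| "pow_term t (Suc n) = DMult t (pow_term t n)"

text \<open>Recursion runs over the truncation degree; the full polynomial is the instance with
  \<open>degree p\<close>.\<close>

primrec poly_term :: "complex poly \<Rightarrow> complex set dterm \<Rightarrow> nat \<Rightarrow> complex set dterm" where
  "poly_term p t 0 = DPar {coeff p 0}"
| "poly_term p t (Suc n) = DAdd (poly_term p t n) (DMult (DPar {coeff p (Suc n)}) (pow_term t (Suc n)))"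

primrec bi_term :: "(nat \<Rightarrow> complex poly) \<Rightarrow> nat \<Rightarrow> complex set dterm" where
  "bi_term r 0 = poly_term (r 0) (DVar 0) (degree (r 0))"
| "bi_term r (Suc n) = DAdd (bi_term r n)
     (DMult (poly_term (r (Suc n)) (DVar 0) (degree (r (Suc n)))) (pow_term (DVar 1) (Suc n)))"

lemma pow_term_val: "dterm_val (model D) v t = {x} \<Longrightarrow> dterm_val (model D) v (pow_term t n) = {x ^ n}"
  by (induction n) simp_all

lemma poly_term_val:
  assumes "dterm_val (model D) v t = {x}"
  shows "dterm_val (model D) v (poly_term p t (degree p)) = {poly p x}"
proof -
  have "dterm_val (model D) v (poly_term p t n) = {\<Sum>i\<le>n. coeff p i * x ^ i}" for n
    by (induction n) (simp_all add: pow_term_val[OF assms] assms)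
  then show ?thesis by (simp add: poly_altdef)
qed

lemma bi_term_val:
  "v 0 = {x} \<Longrightarrow> v 1 = {y} \<Longrightarrow> dterm_val (model D) v (bi_term r n) = {bi_eval n r x y}"
proof (induction n)
  case (Suc n)
  then have "dterm_val (model D) v (DVar 0) = {x}" "dterm_val (model D) v (DVar 1) = {y}" by simp_all
  note * = poly_term_val[OF this(1)] pow_term_val[OF this(2), unfolded One_nat_def]
  show ?case using Suc by (simp add: * bi_eval_def del: pow_term.simps)
qed (simp add: poly_term_val bi_eval_def)

lemma term_params:
  "dt_params t \<subseteq> range (\<lambda>z. {z}) \<Longrightarrow> dt_params (pow_term t n) \<subseteq> range (\<lambda>z. {z})"
  "dt_params t \<subseteq> range (\<lambda>z. {z}) \<Longrightarrow> dt_params (poly_term p t n) \<subseteq> range (\<lambda>z. {z})"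
  "dt_params (bi_term r n) \<subseteq> range (\<lambda>z. {z})"
proof -
  show 1: "dt_params t \<subseteq> range (\<lambda>z. {z}) \<Longrightarrow> dt_params (pow_term t n) \<subseteq> range (\<lambda>z. {z})" for t n
    by (induction n) auto
  show 2: "dt_params t \<subseteq> range (\<lambda>z. {z}) \<Longrightarrow> dt_params (poly_term p t n) \<subseteq> range (\<lambda>z. {z})" for p t n
    using 1[of t] by (induction n) auto
  show "dt_params (bi_term r n) \<subseteq> range (\<lambda>z. {z})"
    using 1[of "DVar 1"] 2[of "DVar 0"] by (induction n) auto
qed

lemma definable_ode_image: "definable (model D) ((\<lambda>z. {z}) ` ode_image D p N r)"
proof -
  \<comment> \<open>\<open>def_set\<close> gives every variable the same value. The quantifier
    rebinds variable 0 to the witness, so variable 1, the second argument in \<open>bi_term\<close>,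
    still denotes the element being tested.\<close>
  define \<phi> where "\<phi> = DEx 0 (DAnd (DEq (DDer (DVar 0)) (poly_term p (DVar 0) (degree p)))
    (DAnd (DEq (bi_term r N) (DPar {0})) (DNot (DEq (poly_term (r N) (DVar 0) (degree (r N))) (DPar {0})))))"
  have "df_params \<phi> \<subseteq> carrier (model D)"
    using term_params by (auto simp: \<phi>_def)
  moreover have "dsat (model D) (\<lambda>_. {a}) \<phi> \<longleftrightarrow> a \<in> ode_image D p N r" for a
    by (auto simp: \<phi>_def ode_image_def poly_term_val bi_term_val)
  then have "(\<lambda>z. {z}) ` ode_image D p N r = def_set (model D) \<phi>"
    by (auto simp: def_set_def)
  ultimately show ?thesis unfolding definable_def by blast
qed

lemma elementary_extension_refl: "differential_field M \<Longrightarrow> elementary_extension M M id"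
  by (simp add: elementary_extension_def dformula.map_id)

section \<open>Rational functions and the use of strong minimality\<close>

lemma ring_ratfun_field: "ring ratfun_field"
proof -
  have "cring ratfun_field"
  proof (rule cringI)
    show "abelian_group ratfun_field"
      by (rule abelian_groupI) (auto simp: ratfun_field_def add_ac intro: exI[of _ "- _"])
    show "comm_monoid ratfun_field"
      by (rule comm_monoidI) (auto simp: ratfun_field_def mult_ac)
  qed (auto simp: ratfun_field_def algebra_simps)
  then show ?thesis by (rule cring.axioms)
qed

lemma diff_polys_ratfun_field:
  assumes "P \<in> diff_polys ratfun_field"
  shows "finite {m. P m \<noteq> 0}"
  using ring.indexed_pset_support[OF ring_ratfun_field, of P UNIV "carrier ratfun_field"] assms
  by (simp add: diff_polys_def ratfun_field_def)

text \<open>The identity is an elementary extension, so the solution set is minimal in the field of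
  singletons, where T is definable; injectivity of the singleton map brings the statement back to
  complex numbers.\<close>

lemma strongly_minimal_dichotomy:
  fixes u :: "complex poly fract \<Rightarrow> complex"
  assumes D: "derivation D" and gen: "generic_solutions D K"
    and u: "u 1 = 1" "\<And>x y. u (x + y) = u x + u y" "\<And>x y. u (x * y) = u x * u y"
      "\<And>x. D (u x) = u (ratfun_deriv x)"
    and P: "strongly_minimal_ade P"
  shows "finite ({a. mp_eval (u \<circ> P) (\<lambda>i. (D ^^ i) a) = 0} \<inter> ode_image D p N r) \<or>
    finite ({a. mp_eval (u \<circ> P) (\<lambda>i. (D ^^ i) a) = 0} - ode_image D p N r)"
proof -
  let ?M = "model D" and ?\<iota> = "\<lambda>z :: complex. {z}"
  let ?S = "{a. mp_eval (u \<circ> P) (\<lambda>i. (D ^^ i) a) = 0}"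
  have "diff_field_embedding ratfun_field ?M (\<lambda>x. {u x})"
    unfolding diff_field_embedding_def
    by (intro conjI ring_hom_memI ballI) (auto simp: ratfun_field_def u)
  then have sm: "strongly_minimal ?M (diff_solutions ?M ((\<lambda>x. {u x}) \<circ> P))"
    using P differentially_closed_model[OF D gen] unfolding strongly_minimal_ade_def by blast
  have "u 0 = 0" using u(2)[of 0 0] by simp
  then have "{m. (u \<circ> P) m \<noteq> 0} \<subseteq> {m. P m \<noteq> 0}" by auto
  then have fin: "finite {m. (u \<circ> P) m \<noteq> 0}"
    using diff_polys_ratfun_field P finite_subset unfolding strongly_minimal_ade_def by blast
  have "diff_solutions ?M ((\<lambda>x. {u x}) \<circ> P) = ?\<iota> ` ?S"
    using diff_eval_model[OF fin, of D] by (auto simp: diff_solutions_def comp_def)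
  then obtain \<phi> where \<phi>: "df_params \<phi> \<subseteq> carrier ?M" "?\<iota> ` ?S = def_set ?M \<phi>"
      "\<And>(N :: complex set diff_ring) j. elementary_extension ?M N j \<Longrightarrow> minimal_set N (def_set N (map_dformula j \<phi>))"
    using sm unfolding strongly_minimal_def by auto
  have "minimal_set ?M (?\<iota> ` ?S)"
    using \<phi>(3)[OF elementary_extension_refl[OF differential_field_model[OF D]]] \<phi>(2)
    by (simp add: dformula.map_id)
  then have "finite (?\<iota> ` ?S \<inter> ?\<iota> ` ode_image D p N r) \<or> finite (?\<iota> ` ?S - ?\<iota> ` ode_image D p N r)"
    using definable_ode_image unfolding minimal_set_def by blast
  moreover have inj: "inj ?\<iota>" by (simp add: inj_on_def)
  ultimately have "finite (?\<iota> ` (?S \<inter> ode_image D p N r)) \<or> finite (?\<iota> ` (?S - ode_image D p N r))"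
    by (simp add: image_Int image_set_diff)
  then show ?thesis using inj by (meson finite_imageD inj_on_subset subset_UNIV)
qed

subsection \<open>Germs of analytic functions\<close>

lemma analytic_on_poly: "poly a analytic_on S" for a :: "complex poly"
proof -
  have "poly a = (\<lambda>x. \<Sum>i\<le>degree a. coeff a i * x ^ i)" by (rule ext) (rule poly_altdef)
  moreover have "(\<lambda>x. \<Sum>i\<le>degree a. coeff a i * x ^ i) analytic_on S" by (intro analytic_intros)
  ultimately show ?thesis by simp
qed

lemma has_fps_expansion_deriv_shift:
  fixes h :: "complex \<Rightarrow> complex"
  assumes "(\<lambda>w. h (z + w)) has_fps_expansion F"
  shows "(\<lambda>w. deriv h (z + w)) has_fps_expansion fps_deriv F"
proof -
  have "deriv (\<lambda>w. h (z + w)) = (\<lambda>w. deriv h (z + w))"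
    by (rule ext) (simp add: deriv_shift_0' o_def add_ac)
  then show ?thesis using has_fps_expansion_deriv[OF assms] by simp
qed

lemma has_fps_expansion_iterated_deriv:
  fixes h :: "complex \<Rightarrow> complex"
  assumes "(\<lambda>w. h (z + w)) has_fps_expansion F"
  shows "(\<lambda>w. (deriv ^^ i) h (z + w)) has_fps_expansion (fps_deriv ^^ i) F"
  by (induction i) (auto intro: assms has_fps_expansion_deriv_shift)

lemma has_fps_expansion_unique_on_open:
  fixes h h' :: "complex \<Rightarrow> complex"
  assumes "(\<lambda>w. h (z + w)) has_fps_expansion F" "(\<lambda>w. h' (z + w)) has_fps_expansion G"
    and "open W" "z \<in> W" "\<And>y. y \<in> W \<Longrightarrow> h y = h' y"
  shows "F = G"
proof -
  have "eventually (\<lambda>w. z + w \<in> W) (nhds 0)"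
    using assms(3,4) by (intro eventually_nhds_in_open[of "(\<lambda>w. z + w) -` W", simplified]
        open_vimage continuous_intros) auto
  then have "eventually (\<lambda>w. h (z + w) = h' (z + w)) (nhds 0)"
    by (rule eventually_mono) (rule assms(5))
  then have "(\<lambda>w. h' (z + w)) has_fps_expansion F"
    using assms(1) has_fps_expansion_cong[of "\<lambda>w. h (z + w)" "\<lambda>w. h' (z + w)", OF _ refl] by simp
  then show ?thesis using assms(2) by (rule fps_expansion_unique_complex)
qed

text \<open>\<open>\<sigma>\<close> lives on Laurent series because these form a field; Taylor
  series enter through the inclusion.\<close>

definition germ :: "(complex fls \<Rightarrow> complex) \<Rightarrow> complex fps \<Rightarrow> complex" where
  "germ \<sigma> F = \<sigma> (fps_to_fls F)"

definition poly_germ :: "(complex fls \<Rightarrow> complex) \<Rightarrow> complex \<Rightarrow> complex poly \<Rightarrow> complex" where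
  "poly_germ \<sigma> z a = germ \<sigma> (fps_expansion (poly a) z)"

text \<open>The quotient is formed after applying \<open>\<sigma>\<close>, so it makes sense at a
  pole too and is a homomorphism on all rational functions. Away from poles
  \<open>ratfun_germ_expansion\<close> identifies it with the Taylor expansion.\<close>

definition ratfun_germ :: "(complex fls \<Rightarrow> complex) \<Rightarrow> complex \<Rightarrow> complex poly fract \<Rightarrow> complex" where
  "ratfun_germ \<sigma> z r = poly_germ \<sigma> z (fst (quot_of_fract r)) / poly_germ \<sigma> z (snd (quot_of_fract r))"

lemma poly_expansion: "(\<lambda>w. poly a (z + w)) has_fps_expansion fps_expansion (poly a) z"
  by (intro analytic_at_imp_has_fps_expansion analytic_on_poly)

lemma mpoly_eval_complex:
  fixes p :: "'i multiset \<Rightarrow> complex"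
  assumes "finite {m. p m \<noteq> 0}"
  shows "mpoly_eval complex_ring p x = mp_eval p x"
  by (rule mpoly_eval_transfer[where \<iota> = "\<lambda>x. x", OF cring_from_type_algebra _ _ _ _ _ _ assms])
    (simp_all add: ring_of_type_algebra_def)

lemma indexed_pset_complex:
  assumes "p \<in> ring.indexed_pset complex_ring I UNIV"
  shows "finite {m. p m \<noteq> 0}" "p m \<noteq> 0 \<Longrightarrow> set_mset m \<subseteq> I"
  using ring.indexed_pset_support[OF ring_from_type_algebra assms]
  by (auto simp: ring_of_type_algebra_def)

context
  fixes D :: "complex \<Rightarrow> complex" and \<sigma> :: "complex fls \<Rightarrow> complex" and z :: complex
  assumes D: "derivation D"
    and \<sigma>: "\<sigma> 1 = 1" "\<And>x y. \<sigma> (x + y) = \<sigma> x + \<sigma> y" "\<And>x y. \<sigma> (x * y) = \<sigma> x * \<sigma> y"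
      "\<And>x. D (\<sigma> x) = \<sigma> (fls_deriv x)"
begin

lemma germ_hom:
  "germ \<sigma> 0 = 0" "germ \<sigma> 1 = 1" "germ \<sigma> (F + G) = germ \<sigma> F + germ \<sigma> G"
  "germ \<sigma> (F * G) = germ \<sigma> F * germ \<sigma> G" "germ \<sigma> (F ^ n) = germ \<sigma> F ^ n" "germ \<sigma> F = 0 \<Longrightarrow> F = 0"
  "D (germ \<sigma> F) = germ \<sigma> (fps_deriv F)"
proof -
  have \<sigma>0: "\<sigma> 0 = 0" using \<sigma>(2)[of 0 0] by simp
  then show "germ \<sigma> 0 = 0" by (simp add: germ_def)
  show 1: "germ \<sigma> 1 = 1" by (simp add: germ_def \<sigma>)
  show "germ \<sigma> (F + G) = germ \<sigma> F + germ \<sigma> G" by (simp add: germ_def \<sigma>)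
  show 2: "germ \<sigma> (F * G) = germ \<sigma> F * germ \<sigma> G" for F G
    by (simp add: germ_def \<sigma> fls_times_fps_to_fls)
  show "germ \<sigma> (F ^ n) = germ \<sigma> F ^ n" by (induction n) (simp_all add: 1 2)
  show "F = 0" if "germ \<sigma> F = 0"
  proof (rule ccontr)
    assume "F \<noteq> 0"
    then have "fps_to_fls F * inverse (fps_to_fls F) = 1" by simp
    then have "germ \<sigma> F * \<sigma> (inverse (fps_to_fls F)) = 1" using \<sigma>(1,3) by (metis germ_def)
    then show False using that by simp
  qed
  show "D (germ \<sigma> F) = germ \<sigma> (fps_deriv F)" by (simp add: germ_def \<sigma> fls_deriv_fps_to_fls)
qed

lemma germ_sum: "germ \<sigma> (sum F I) = (\<Sum>i\<in>I. germ \<sigma> (F i))"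
  by (induction I rule: infinite_finite_induct) (simp_all add: germ_hom)

lemma germ_prod: "germ \<sigma> (prod F I) = (\<Prod>i\<in>I. germ \<sigma> (F i))"
  by (induction I rule: infinite_finite_induct) (simp_all add: germ_hom)

lemma iterate_germ: "(D ^^ i) (germ \<sigma> F) = germ \<sigma> ((fps_deriv ^^ i) F)"
  by (induction i) (simp_all add: germ_hom)

lemma poly_germ_eqI:
  "(\<lambda>w. poly a (z + w)) has_fps_expansion F \<Longrightarrow> poly_germ \<sigma> z a = germ \<sigma> F"
  unfolding poly_germ_def using fps_expansion_unique_complex[OF poly_expansion] by metis

lemma poly_germ_hom:
  "poly_germ \<sigma> z 0 = 0" "poly_germ \<sigma> z 1 = 1"
  "poly_germ \<sigma> z (a + b) = poly_germ \<sigma> z a + poly_germ \<sigma> z b"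
  "poly_germ \<sigma> z (a - b) = poly_germ \<sigma> z a - poly_germ \<sigma> z b"
  "poly_germ \<sigma> z (a * b) = poly_germ \<sigma> z a * poly_germ \<sigma> z b"
  "D (poly_germ \<sigma> z a) = poly_germ \<sigma> z (pderiv a)"
  "poly_germ \<sigma> z a = 0 \<Longrightarrow> a = 0"
proof -
  show "poly_germ \<sigma> z 0 = 0" "poly_germ \<sigma> z 1 = 1"
    using poly_germ_eqI[of 0 0] poly_germ_eqI[of 1 1] by (simp_all add: germ_hom)
  show add: "poly_germ \<sigma> z (a + b) = poly_germ \<sigma> z a + poly_germ \<sigma> z b" for a b
  proof -
    have "(\<lambda>w. poly (a + b) (z + w)) has_fps_expansion fps_expansion (poly a) z + fps_expansion (poly b) z"
      unfolding poly_add by (intro fps_expansion_intros poly_expansion)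
    from poly_germ_eqI[OF this] show ?thesis by (simp add: germ_hom poly_germ_def)
  qed
  show "poly_germ \<sigma> z (a - b) = poly_germ \<sigma> z a - poly_germ \<sigma> z b"
    using add[of "a - b" b] by simp
  show "poly_germ \<sigma> z (a * b) = poly_germ \<sigma> z a * poly_germ \<sigma> z b"
  proof -
    have "(\<lambda>w. poly (a * b) (z + w)) has_fps_expansion fps_expansion (poly a) z * fps_expansion (poly b) z"
      unfolding poly_mult by (intro fps_expansion_intros poly_expansion)
    from poly_germ_eqI[OF this] show ?thesis by (simp add: germ_hom poly_germ_def)
  qed
  show "D (poly_germ \<sigma> z a) = poly_germ \<sigma> z (pderiv a)"
  proof -
    have "deriv (poly a) = poly (pderiv a)" by (rule ext) (simp add: DERIV_imp_deriv)
    then have "(\<lambda>w. poly (pderiv a) (z + w)) has_fps_expansion fps_deriv (fps_expansion (poly a) z)"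
      using has_fps_expansion_deriv_shift[OF poly_expansion, of a z] by simp
    from poly_germ_eqI[OF this] show ?thesis by (simp add: germ_hom poly_germ_def)
  qed
  show "a = 0" if "poly_germ \<sigma> z a = 0"
  proof (rule ccontr)
    assume "a \<noteq> 0"
    have "fps_expansion (poly a) z = 0" using germ_hom(6) that unfolding poly_germ_def by blast
    then have ev: "(\<lambda>w. poly a (z + w)) has_fps_expansion 0" using poly_expansion[of a z] by simp
    have "poly a (z + w) = 0" for w
    proof (rule has_fps_expansion_0_analytic_continuation[OF ev, of UNIV])
      show "(\<lambda>w. poly a (z + w)) holomorphic_on UNIV"
        unfolding poly_altdef by (intro holomorphic_intros)
    qed (simp_all add: convex_connected)
    then have "poly a y = 0" for y by (metis add.commute diff_add_cancel)
    then show False using \<open>a \<noteq> 0\<close> poly_all_0_iff_0 by blast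
  qed
qed

text \<open>\<open>quot_of_fract\<close> picks one representation; cross multiplication compares it
  with any other, and injectivity of \<open>poly_germ\<close> keeps the denominators
  nonzero.\<close>

lemma ratfun_germ_Fract:
  assumes "b \<noteq> 0"
  shows "ratfun_germ \<sigma> z (Fraction_Field.Fract a b) = poly_germ \<sigma> z a / poly_germ \<sigma> z b"
proof -
  let ?r = "Fraction_Field.Fract a b"
  let ?n = "fst (quot_of_fract ?r)" and ?d = "snd (quot_of_fract ?r)"
  have d: "?d \<noteq> 0" by simp
  have "Fraction_Field.Fract ?n ?d = ?r" by (metis Fract_quot_of_fract)
  then have "?n * b = a * ?d" by (simp only: eq_fract(1)[OF d assms])
  then have "poly_germ \<sigma> z ?n * poly_germ \<sigma> z b = poly_germ \<sigma> z a * poly_germ \<sigma> z ?d"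
    by (metis poly_germ_hom(5))
  moreover have "poly_germ \<sigma> z ?d \<noteq> 0" "poly_germ \<sigma> z b \<noteq> 0" using poly_germ_hom(7) d assms by blast+
  ultimately show ?thesis by (simp add: ratfun_germ_def field_simps)
qed

lemma ratfun_germ_hom:
  "ratfun_germ \<sigma> z 1 = 1" "ratfun_germ \<sigma> z (r + s) = ratfun_germ \<sigma> z r + ratfun_germ \<sigma> z s"
  "ratfun_germ \<sigma> z (r * s) = ratfun_germ \<sigma> z r * ratfun_germ \<sigma> z s"
  "D (ratfun_germ \<sigma> z r) = ratfun_germ \<sigma> z (ratfun_deriv r)"
proof -
  let ?e = "poly_germ \<sigma> z"
  show "ratfun_germ \<sigma> z 1 = 1" by (simp add: ratfun_germ_def poly_germ_hom)
  obtain a b where r: "r = Fraction_Field.Fract a b" "b \<noteq> 0" by (cases r) auto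
  obtain c d where s: "s = Fraction_Field.Fract c d" "d \<noteq> 0" by (cases s) auto
  have nz: "?e b \<noteq> 0" "?e d \<noteq> 0" using poly_germ_hom(7) r s by blast+
  show "ratfun_germ \<sigma> z (r + s) = ratfun_germ \<sigma> z r + ratfun_germ \<sigma> z s"
    "ratfun_germ \<sigma> z (r * s) = ratfun_germ \<sigma> z r * ratfun_germ \<sigma> z s"
  proof -
    have bd: "b * d \<noteq> 0" using r s by simp
    have "r + s = Fraction_Field.Fract (a * d + c * b) (b * d)" unfolding r(1) s(1) by (rule add_fract[OF r(2) s(2)])
    then have "ratfun_germ \<sigma> z (r + s) = (?e a * ?e d + ?e c * ?e b) / (?e b * ?e d)"
      by (simp only: ratfun_germ_Fract[OF bd] poly_germ_hom)
    also have "\<dots> = ?e a / ?e b + ?e c / ?e d" using nz by (simp add: add_frac_eq)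
    also have "\<dots> = ratfun_germ \<sigma> z r + ratfun_germ \<sigma> z s"
      unfolding r(1) s(1) ratfun_germ_Fract[OF r(2)] ratfun_germ_Fract[OF s(2)] ..
    finally show "ratfun_germ \<sigma> z (r + s) = ratfun_germ \<sigma> z r + ratfun_germ \<sigma> z s" .
    have "r * s = Fraction_Field.Fract (a * c) (b * d)" unfolding r(1) s(1) by (rule mult_fract)
    then have "ratfun_germ \<sigma> z (r * s) = (?e a * ?e c) / (?e b * ?e d)"
      by (simp only: ratfun_germ_Fract[OF bd] poly_germ_hom)
    also have "\<dots> = ratfun_germ \<sigma> z r * ratfun_germ \<sigma> z s"
      unfolding r(1) s(1) ratfun_germ_Fract[OF r(2)] ratfun_germ_Fract[OF s(2)] by simp
    finally show "ratfun_germ \<sigma> z (r * s) = ratfun_germ \<sigma> z r * ratfun_germ \<sigma> z s" .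
  qed
  obtain p q where pq: "quot_of_fract r = (p, q)" by fastforce
  have q: "q \<noteq> 0" using snd_quot_of_fract_nonzero[of r] pq by simp
  then have eq: "?e q \<noteq> 0" using poly_germ_hom(7) by blast
  \<comment> \<open>Differentiating this product yields the quotient rule.\<close>
  have "ratfun_germ \<sigma> z r * ?e q = ?e p" using eq by (simp add: ratfun_germ_def pq)
  then have "D (ratfun_germ \<sigma> z r) * ?e q + ratfun_germ \<sigma> z r * D (?e q) = D (?e p)"
    using derivation_mult[OF D] by metis
  then have "D (ratfun_germ \<sigma> z r) * ?e q + (?e p / ?e q) * ?e (pderiv q) = ?e (pderiv p)"
    unfolding poly_germ_hom(6) by (simp add: ratfun_germ_def pq)
  moreover have "x = (p' * c - a * q') / (c * c)"
    if "x * c + (a / c) * q' = p'" "c \<noteq> 0" for x a c p' q' :: complex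
  proof -
    have "a / c * q' * c = a * q'" using that(2) by simp
    then have "p' * c - a * q' = x * (c * c)" unfolding that(1)[symmetric] by (simp add: distrib_right mult.assoc)
    then show ?thesis using that(2) by simp
  qed
  ultimately have "D (ratfun_germ \<sigma> z r) = (?e (pderiv p) * ?e q - ?e p * ?e (pderiv q)) / (?e q * ?e q)"
    using eq by blast
  then show "D (ratfun_germ \<sigma> z r) = ratfun_germ \<sigma> z (ratfun_deriv r)"
    using q by (simp add: ratfun_deriv_def pq ratfun_germ_Fract poly_germ_hom(4,5))
qed

text \<open>Near a point that is not a pole the expansion of the function times that of its
  denominator is that of its numerator.\<close>

lemma ratfun_germ_expansion:
  assumes "\<not> ratfun_pole r z"
  obtains F where "(\<lambda>w. ratfun_eval r (z + w)) has_fps_expansion F" "ratfun_germ \<sigma> z r = germ \<sigma> F"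
proof -
  let ?n = "fst (quot_of_fract r)" and ?d = "snd (quot_of_fract r)"
  have d: "poly ?d z \<noteq> 0" using assms by (simp add: ratfun_pole_def)
  have "ratfun_eval r analytic_on {z}"
    unfolding ratfun_eval_def using d by (intro analytic_intros analytic_on_poly) auto
  then obtain F where F: "(\<lambda>w. ratfun_eval r (z + w)) has_fps_expansion F"
    using analytic_at_imp_has_fps_expansion by blast
  let ?W = "{y. poly ?d y \<noteq> 0}"
  have "open ?W" by (intro open_Collect_neq continuous_intros)
  have "(\<lambda>w. ratfun_eval r (z + w) * poly ?d (z + w)) has_fps_expansion F * fps_expansion (poly ?d) z"
    by (intro fps_expansion_intros F poly_expansion)
  then have "fps_expansion (poly ?n) z = F * fps_expansion (poly ?d) z"
    by (rule has_fps_expansion_unique_on_open[OF poly_expansion, where W = ?W])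
      (use d \<open>open ?W\<close> in \<open>auto simp: ratfun_eval_def\<close>)
  then have "poly_germ \<sigma> z ?n = germ \<sigma> F * poly_germ \<sigma> z ?d" by (simp add: poly_germ_def germ_hom)
  moreover have "poly_germ \<sigma> z ?d \<noteq> 0" using poly_germ_hom(7)[of ?d] by auto
  ultimately have "ratfun_germ \<sigma> z r = germ \<sigma> F" by (simp add: ratfun_germ_def)
  with F show thesis using that by blast
qed

text \<open>One passage from functions to elements of the differential field. The coefficients
  \<open>c m\<close> are functions so that the same statement covers the chain equations, the
  polynomial expression for f and the differential equation with rational coefficients.\<close>

lemma germ_polynomial_relation:
  assumes "open W" "z \<in> W"
    and "(\<lambda>w. h (z + w)) has_fps_expansion H"
    and "\<And>m. m \<in> S \<Longrightarrow> (\<lambda>w. c m (z + w)) has_fps_expansion C m"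
    and "\<And>m i. m \<in> S \<Longrightarrow> i \<in># m \<Longrightarrow> (\<lambda>w. x i (z + w)) has_fps_expansion Y i"
    and "\<And>y. y \<in> W \<Longrightarrow> h y = (\<Sum>m\<in>S. c m y * (\<Prod>i\<in>set_mset m. x i y ^ count m i))"
  shows "germ \<sigma> H = (\<Sum>m\<in>S. germ \<sigma> (C m) * (\<Prod>i\<in>set_mset m. germ \<sigma> (Y i) ^ count m i))"
proof -
  have "(\<lambda>w. \<Sum>m\<in>S. c m (z + w) * (\<Prod>i\<in>set_mset m. x i (z + w) ^ count m i)) has_fps_expansion
      (\<Sum>m\<in>S. C m * (\<Prod>i\<in>set_mset m. Y i ^ count m i))"
    by (intro has_fps_expansion_sum has_fps_expansion_mult has_fps_expansion_prod
        has_fps_expansion_power assms(4,5))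
  then have "H = (\<Sum>m\<in>S. C m * (\<Prod>i\<in>set_mset m. Y i ^ count m i))"
    by (rule has_fps_expansion_unique_on_open[OF assms(3) _ assms(1,2) assms(6)])
  then show ?thesis by (simp add: germ_sum germ_prod germ_hom)
qed

text \<open>An algebraic equation for the germ says that a polynomial expression in \<open>f\<close>
  has zero Taylor series at \<open>z\<close>; connectedness of \<open>U\<close> spreads its
  vanishing to all of \<open>U\<close>. The coefficients are polynomials, so the equation holds at
  every point without excluding poles.\<close>

lemma acl_imp_algebraic_on:
  assumes U: "open U" "connected U" "z \<in> U" and f: "f analytic_on U"
    and "germ \<sigma> (fps_expansion f z) \<in> acl (range (poly_germ \<sigma> z))"
  shows "algebraic_on U f"
proof -
  let ?e = "poly_germ \<sigma> z" and ?\<phi> = "germ \<sigma> (fps_expansion f z)"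
  have "subring_set (range ?e)"
    unfolding subring_set_def
  proof (intro conjI ballI)
    show "1 \<in> range ?e" using poly_germ_hom(2) by (metis rangeI)
    fix x y assume "x \<in> range ?e" "y \<in> range ?e"
    then obtain a b where "x = ?e a" "y = ?e b" by blast
    then show "x - y \<in> range ?e" "x * y \<in> range ?e"
      using poly_germ_hom(4,5)[of a b] by (metis rangeI)+
  qed
  then obtain Q where Q: "\<And>i. coeff Q i \<in> range ?e" "Q \<noteq> 0" "poly Q ?\<phi> = 0"
    using acl_algebraic assms(5) by blast
  have "\<forall>i. \<exists>a. coeff Q i = ?e a" using Q(1) by blast
  then obtain a where a: "\<And>i. coeff Q i = ?e (a i)" by metis
  let ?N = "degree Q"
  define H where "H y = (\<Sum>n\<le>?N. poly (a n) y * f y ^ n)" for y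
  have fz: "(\<lambda>w. f (z + w)) has_fps_expansion fps_expansion f z"
    using f U(3) analytic_on_subset by (intro analytic_at_imp_has_fps_expansion) blast
  have "(\<lambda>w. H (z + w)) has_fps_expansion (\<Sum>n\<le>?N. fps_expansion (poly (a n)) z * fps_expansion f z ^ n)"
    unfolding H_def by (intro fps_expansion_intros poly_expansion fz)
  moreover have "germ \<sigma> (\<Sum>n\<le>?N. fps_expansion (poly (a n)) z * fps_expansion f z ^ n) = poly Q ?\<phi>"
    by (simp add: germ_sum germ_hom poly_altdef[of Q] a poly_germ_def)
  then have "(\<Sum>n\<le>?N. fps_expansion (poly (a n)) z * fps_expansion f z ^ n) = 0"
    using Q(3) germ_hom(6) by metis
  ultimately have H0: "(\<lambda>w. H (z + w)) has_fps_expansion 0" by simp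
  have "H holomorphic_on U"
    unfolding H_def using analytic_imp_holomorphic[OF f] analytic_imp_holomorphic[OF analytic_on_poly]
    by (intro holomorphic_intros) auto
  then have hol: "(\<lambda>w. H (z + w)) holomorphic_on (\<lambda>x. x - z) ` U"
    by (intro holomorphic_on_compose_gen[of "\<lambda>w. z + w" _ H U, unfolded o_def] holomorphic_intros) auto
  have H: "H y = 0" if "y \<in> U" for y
  proof -
    have "H (z + (y - z)) = 0"
      by (rule has_fps_expansion_0_analytic_continuation[OF H0 hol])
        (use U that in \<open>auto intro!: open_translation_subtract connected_continuous_image continuous_intros\<close>)
    then show ?thesis by simp
  qed
  define R :: "complex poly fract poly" where "R = (\<Sum>n\<le>?N. monom (to_fract (a n)) n)"
  have R: "coeff R n = (if n \<le> ?N then to_fract (a n) else 0)" for n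
    by (simp add: R_def coeff_sum)
  have "coeff R ?N \<noteq> 0"
  proof
    assume "coeff R ?N = 0"
    then have "coeff Q ?N = 0" unfolding a by (simp add: R poly_germ_hom)
    then show False using Q(2) by simp
  qed
  then have "R \<noteq> 0" by (metis coeff_0)
  moreover have "poly (map_poly (\<lambda>r. ratfun_eval r y) R) (f y) = 0" if "y \<in> U" for y
  proof -
    have e0: "ratfun_eval 0 y = 0" by (simp add: ratfun_eval_def)
    have cf: "coeff (map_poly (\<lambda>r. ratfun_eval r y) R) n = (if n \<le> ?N then poly (a n) y else 0)" for n
      by (simp add: coeff_map_poly e0 R) (simp add: ratfun_eval_def)
    have "degree (map_poly (\<lambda>r. ratfun_eval r y) R) \<le> ?N" by (rule degree_le) (simp add: cf)
    then have "poly (map_poly (\<lambda>r. ratfun_eval r y) R) (f y)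
        = (\<Sum>n\<le>?N. coeff (map_poly (\<lambda>r. ratfun_eval r y) R) n * f y ^ n)"
      unfolding poly_altdef by (intro sum.mono_neutral_left) (auto simp: coeff_eq_0)
    also have "\<dots> = (\<Sum>n\<le>?N. poly (a n) y * f y ^ n)" by (simp add: cf)
    finally have "poly (map_poly (\<lambda>r. ratfun_eval r y) R) (f y) = (\<Sum>n\<le>?N. poly (a n) y * f y ^ n)" .
    then show ?thesis using H[OF that] by (simp add: H_def)
  qed
  ultimately show ?thesis unfolding algebraic_on_def by blast
qed

end

subsection \<open>Solutions of strongly minimal equations are not Pfaffian\<close>

lemma poly_germ_mem:
  assumes D: "derivation D" and \<sigma>: "\<sigma> 1 = 1" "\<And>x y. \<sigma> (x + y) = \<sigma> x + \<sigma> y" "\<And>x y. \<sigma> (x * y) = \<sigma> x * \<sigma> y"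
      "\<And>x. D (\<sigma> x) = \<sigma> (fls_deriv x)"
    and S: "ac_subfield S" "\<And>c. poly_germ \<sigma> z [:c:] \<in> S" "poly_germ \<sigma> z [:0, 1:] \<in> S"
  shows "poly_germ \<sigma> z a \<in> S"
proof (induction a)
  case 0
  then show ?case using S(2)[of 0] by simp
next
  case (pCons c a)
  have "pCons c a = [:c:] + [:0, 1:] * a" by simp
  then have "poly_germ \<sigma> z (pCons c a) = poly_germ \<sigma> z [:c:] + poly_germ \<sigma> z [:0, 1:] * poly_germ \<sigma> z a"
    by (simp only: poly_germ_hom[OF D \<sigma>])
  then show ?case using pCons S by (simp add: ac_subfield_add ac_subfield_mult)
qed

theorem theorem3p2:
  fixes U :: "complex set" and f :: "complex \<Rightarrow> complex"
    and P :: "nat multiset \<Rightarrow> complex poly fract"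
  assumes "open U" and "connected U" and "U \<noteq> {}"
    and "f analytic_on U"
    and "\<not> algebraic_on U f"
    and "strongly_minimal_ade P"
    and "diff_order ratfun_field P \<ge> 2"
    and "satisfies_ade U f P"
  shows "\<not> pfaffian_on U f"
proof
  assume "pfaffian_on U f"
  then obtain l g q where chain: "pfaffian_chain U l g"
    and q: "q \<in> ring.indexed_pset complex_ring {1..l} UNIV"
    and f_eq: "\<And>z. z \<in> U \<Longrightarrow> f z = mpoly_eval complex_ring q (\<lambda>j. g j z)"
    unfolding pfaffian_on_def by blast
  obtain p where g: "\<And>i. i \<in> {1..l} \<Longrightarrow> g i analytic_on U"
    and p: "\<And>i. i \<in> {1..l} \<Longrightarrow> p i \<in> ring.indexed_pset complex_ring {0..i} UNIV"
    and g_deriv: "\<And>i z. i \<in> {1..l} \<Longrightarrow> z \<in> U \<Longrightarrow>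
        deriv (g i) z = mpoly_eval complex_ring (p i) (\<lambda>j. if j = 0 then z else g j z)"
    using chain unfolding pfaffian_chain_def by blast

  have finP: "finite {m. P m \<noteq> 0}"
    using assms(6) diff_polys_ratfun_field unfolding strongly_minimal_ade_def by blast
  \<comment> \<open>A zero coefficient has a constant denominator, so poles come from the finitely
    many nonzero coefficients alone.\<close>
  have "{z. \<exists>m. ratfun_pole (P m) z} \<subseteq> (\<Union>m\<in>{m. P m \<noteq> 0}. {z. poly (snd (quot_of_fract (P m))) z = 0})"
  proof
    fix z assume "z \<in> {z. \<exists>m. ratfun_pole (P m) z}"
    then obtain m where m: "ratfun_pole (P m) z" by blast
    then have "P m \<noteq> 0" by (auto simp: ratfun_pole_def)
    then show "z \<in> (\<Union>m\<in>{m. P m \<noteq> 0}. {z. poly (snd (quot_of_fract (P m))) z = 0})"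
      using m by (auto simp: ratfun_pole_def)
  qed
  then have poles: "finite {z. \<exists>m. ratfun_pole (P m) z}"
    by (rule finite_subset) (use finP in \<open>auto intro: poly_roots_finite\<close>)
  let ?W = "U - {z. \<exists>m. ratfun_pole (P m) z}"
  have W: "open ?W" using assms(1) poles by (intro open_Diff finite_imp_closed)
  have "infinite U" using assms(1,3) finite_imp_not_open by blast
  then have "?W \<noteq> {}" using poles by (metis Diff_eq_empty_iff finite_subset)
  then obtain z where z: "z \<in> ?W" by blast
  then have zU: "z \<in> U" by blast
  have expand: "(\<lambda>w. h (z + w)) has_fps_expansion fps_expansion h z" if "h analytic_on U" for h
    using analytic_on_subset[OF that] zU by (intro analytic_at_imp_has_fps_expansion) blast

  obtain D :: "complex \<Rightarrow> complex" and \<sigma> :: "complex fls \<Rightarrow> complex"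
    where D: "derivation D" and \<sigma>: "\<sigma> 1 = 1" "\<And>x y. \<sigma> (x + y) = \<sigma> x + \<sigma> y" "\<And>x y. \<sigma> (x * y) = \<sigma> x * \<sigma> y"
      "\<And>x. D (\<sigma> x) = \<sigma> (fls_deriv x)" and gen: "generic_solutions D (range \<sigma>)"
    by (rule exists_generic_differential_field) blast
  note germ_hom = germ_hom[OF D \<sigma>] and poly_germ_hom = poly_germ_hom[OF D \<sigma>]
    and ratfun_germ_hom = ratfun_germ_hom[OF D \<sigma>]
  let ?e = "poly_germ \<sigma> z" and ?u = "ratfun_germ \<sigma> z"
  let ?\<phi> = "germ \<sigma> (fps_expansion f z)"
  define \<gamma> where "\<gamma> j = germ \<sigma> (fps_expansion (g j) z)" for j
  \<comment> \<open>Constants and the coordinate function generate all polynomials, so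
    \<open>k 0\<close> is the closure of the rational functions.\<close>
  define k where "k i = acl (range (\<lambda>c. ?e [:c:]) \<union> {?e [:0, 1:]} \<union> \<gamma> ` {1..i})" for i
  have k: "ac_subfield (k i)" for i unfolding k_def by (rule ac_subfield_acl)
  have gens: "range (\<lambda>c. ?e [:c:]) \<union> {?e [:0, 1:]} \<union> \<gamma> ` {1..i} \<subseteq> k i" for i
    unfolding k_def by (rule acl_superset)
  have e_mem: "?e a \<in> k i" for a i
  proof (rule poly_germ_mem[OF D \<sigma> k])
    show "?e [:c:] \<in> k i" for c using gens[of i] by blast
    show "?e [:0, 1:] \<in> k i" using gens[of i] by blast
  qed
  have u_mem: "?u r \<in> k i" for r i
    unfolding ratfun_germ_def divide_inverse
    by (intro ac_subfield_mult ac_subfield_inverse k e_mem)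

  have const_germ: "germ \<sigma> (fps_const c) = ?e [:c:]" for c
    by (rule poly_germ_eqI[OF D \<sigma>, symmetric]) simp
  have X_germ: "germ \<sigma> (fps_expansion (\<lambda>y. y) z) = ?e [:0, 1:]"
  proof (rule poly_germ_eqI[OF D \<sigma>, symmetric])
    show "(\<lambda>w. poly [:0, 1:] (z + w)) has_fps_expansion fps_expansion (\<lambda>y. y) z"
      using expand[of "\<lambda>y. y"] by (simp add: analytic_intros)
  qed
  let ?y = "\<lambda>j. if j = 0 then ?e [:0, 1:] else \<gamma> j"
  have D_\<gamma>: "D (\<gamma> i) = mp_eval (\<lambda>m. ?e [:p i m:]) ?y" if i: "i \<in> {1..l}" for i
  proof -
    have fin: "finite {m. p i m \<noteq> 0}" using indexed_pset_complex[OF p[OF i]] by blast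
    have "germ \<sigma> (fps_deriv (fps_expansion (g i) z)) = (\<Sum>m\<in>{m. p i m \<noteq> 0}. germ \<sigma> (fps_const (p i m)) *
        (\<Prod>j\<in>set_mset m. germ \<sigma> (if j = 0 then fps_expansion (\<lambda>y. y) z else fps_expansion (g j) z) ^ count m j))"
    proof (rule germ_polynomial_relation[where h = "deriv (g i)" and c = "\<lambda>m _. p i m"
          and x = "\<lambda>j y. if j = 0 then y else g j y" and W = U and z = z and D = D
          and C = "\<lambda>m. fps_const (p i m)" and S = "{m. p i m \<noteq> 0}"
          and Y = "\<lambda>j. if j = 0 then fps_expansion (\<lambda>y. y) z else fps_expansion (g j) z", OF D \<sigma> assms(1) zU])
      show "(\<lambda>w. deriv (g i) (z + w)) has_fps_expansion fps_deriv (fps_expansion (g i) z)"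
        by (rule has_fps_expansion_deriv_shift[OF expand[OF g[OF i]]])
      show "(\<lambda>w. p i m) has_fps_expansion fps_const (p i m)" for m by simp
      fix m j assume "m \<in> {m. p i m \<noteq> 0}" "j \<in># m"
      then have "set_mset m \<subseteq> {0..i}" "j \<in># m" using indexed_pset_complex(2)[OF p[OF i]] by simp_all
      then have "j \<le> i" by auto
      then have "j = 0 \<or> g j analytic_on U" using g[of j] i by (cases "j = 0") auto
      then show "(\<lambda>w. if j = 0 then z + w else g j (z + w)) has_fps_expansion
          (if j = 0 then fps_expansion (\<lambda>y. y) z else fps_expansion (g j) z)"
        using expand[of "\<lambda>y. y"] expand[of "g j"] by (auto simp: analytic_intros)
    next
      fix y assume "y \<in> U"
      then show "deriv (g i) y = (\<Sum>m\<in>{m. p i m \<noteq> 0}. p i m *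
          (\<Prod>j\<in>set_mset m. (if j = 0 then y else g j y) ^ count m j))"
        using g_deriv[OF i] fin by (simp add: mpoly_eval_complex mp_eval_def)
    qed
    also have "\<dots> = (\<Sum>m\<in>{m. p i m \<noteq> 0}. ?e [:p i m:] * (\<Prod>j\<in>set_mset m. ?y j ^ count m j))"
      by (intro sum.cong refl arg_cong2[where f = "(*)"] prod.cong) (auto simp: const_germ X_germ \<gamma>_def)
    also have "\<dots> = mp_eval (\<lambda>m. ?e [:p i m:]) ?y"
      using poly_germ_hom(1) by (intro mp_eval_superset[OF fin, symmetric]) auto
    finally show ?thesis by (simp add: \<gamma>_def germ_hom)
  qed
  have y_mem: "?y j \<in> k i" if "j \<le> i" for i j
    using gens[of i] that by auto
  have p_support: "finite {m. ?e [:p i m:] \<noteq> 0}" "?e [:p i m:] \<noteq> 0 \<Longrightarrow> set_mset m \<subseteq> {0..i}"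
    if i: "i \<in> {1..l}" for i m
  proof -
    have sub: "p i m \<noteq> 0" if "?e [:p i m:] \<noteq> 0" for m using that poly_germ_hom(1) by auto
    then show "finite {m. ?e [:p i m:] \<noteq> 0}"
      using indexed_pset_complex(1)[OF p[OF i]] by (rule_tac finite_subset) auto
    show "set_mset m \<subseteq> {0..i}" if "?e [:p i m:] \<noteq> 0"
      using indexed_pset_complex(2)[OF p[OF i] sub[OF that]] .
  qed
  \<comment> \<open>Triangularity of the chain: the derivative of a generator of level j involves
    only generators up to j.\<close>
  have D_closed: "D x \<in> k i" if "i \<le> l" "x \<in> k i" for i x
    unfolding k_def
  proof (rule derivation_acl_closed[OF D])
    show "x \<in> acl (range (\<lambda>c. ?e [:c:]) \<union> {?e [:0, 1:]} \<union> \<gamma> ` {1..i})"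
      using that(2) unfolding k_def .
    fix y assume "y \<in> range (\<lambda>c. ?e [:c:]) \<union> {?e [:0, 1:]} \<union> \<gamma> ` {1..i}"
    then consider a where "y = ?e a" | j where "1 \<le> j" "j \<le> i" "y = \<gamma> j" by auto
    then have "D y \<in> k i"
    proof cases
      case 1
      then show ?thesis using e_mem by (simp add: poly_germ_hom(6))
    next
      case 2
      then have j: "j \<in> {1..l}" using that(1) by simp
      have "mp_eval (\<lambda>m. ?e [:p j m:]) ?y \<in> k i"
      proof (rule mp_eval_ac_subfield[OF k e_mem])
        fix m h assume "?e [:p j m:] \<noteq> 0" "h \<in># m"
        then have "h \<le> i" using p_support(2)[OF j] 2(2) by fastforce
        then show "?y h \<in> k i" by (rule y_mem)
      qed
      then show ?thesis using D_\<gamma>[OF j] 2(3) by simp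
    qed
    then show "D y \<in> acl (range (\<lambda>c. ?e [:c:]) \<union> {?e [:0, 1:]} \<union> \<gamma> ` {1..i})" unfolding k_def .
  qed

  have "?\<phi> \<notin> k 0"
  proof
    assume "?\<phi> \<in> k 0"
    moreover have "k 0 \<subseteq> acl (range ?e)" unfolding k_def by (intro acl_mono) auto
    ultimately have "algebraic_on U f"
      using acl_imp_algebraic_on[OF D \<sigma> assms(1,2) zU assms(4)] by blast
    then show False using assms(5) by contradiction
  qed
  moreover have "?\<phi> \<in> k l"
  proof -
    have fin: "finite {m. q m \<noteq> 0}" using indexed_pset_complex[OF q] by blast
    have "?\<phi> = (\<Sum>m\<in>{m. q m \<noteq> 0}. germ \<sigma> (fps_const (q m)) *
        (\<Prod>j\<in>set_mset m. germ \<sigma> (fps_expansion (g j) z) ^ count m j))"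
    proof (rule germ_polynomial_relation[where h = f and c = "\<lambda>m _. q m" and x = g and W = U and z = z and D = D
          and C = "\<lambda>m. fps_const (q m)" and S = "{m. q m \<noteq> 0}" and Y = "\<lambda>j. fps_expansion (g j) z",
          OF D \<sigma> assms(1) zU expand[OF assms(4)]])
      show "(\<lambda>w. q m) has_fps_expansion fps_const (q m)" for m by simp
      fix m j assume "m \<in> {m. q m \<noteq> 0}" "j \<in># m"
      then have "j \<in> {1..l}" using indexed_pset_complex(2)[OF q] by blast
      then show "(\<lambda>w. g j (z + w)) has_fps_expansion fps_expansion (g j) z" using g expand by blast
    qed (use f_eq fin in \<open>simp add: mpoly_eval_complex mp_eval_def\<close>)
    also have "\<dots> \<in> k l"
    proof (intro ac_subfield_sum ac_subfield_mult ac_subfield_prod ac_subfield_power k)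
      show "germ \<sigma> (fps_const (q m)) \<in> k l" for m unfolding const_germ by (rule e_mem)
      fix m j assume "m \<in> {m. q m \<noteq> 0}" "j \<in># m"
      then have "j \<in> {1..l}" using indexed_pset_complex(2)[OF q] by blast
      then show "germ \<sigma> (fps_expansion (g j) z) \<in> k l" using gens[of l] by (auto simp: \<gamma>_def)
    qed
    finally show ?thesis .
  qed
  ultimately obtain i where i: "i < l" "?\<phi> \<notin> k i" "?\<phi> \<in> k (Suc i)"
    using ex_least_nat_less[of "\<lambda>i. ?\<phi> \<in> k i" l] by blast

  \<comment> \<open>\<open>?u\<close> is injective, so \<open>?u \<circ> P\<close> has the same
    monomials as \<open>P\<close>, hence the same order.\<close>
  have uP: "?u (P m) = 0 \<longleftrightarrow> P m = 0" for m
  proof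
    assume "?u (P m) = 0"
    show "P m = 0"
    proof (rule ccontr)
      assume "P m \<noteq> 0"
      then have "?u (P m) * ?u (inverse (P m)) = 1" using ratfun_germ_hom(1,3) by (metis right_inverse)
      then show False using \<open>?u (P m) = 0\<close> by simp
    qed
  qed (simp add: ratfun_germ_def poly_germ_hom)
  obtain n where n: "diff_order ratfun_field P = int n" "n \<ge> 2"
    using assms(7) by (metis nonneg_int_cases nat_int of_nat_numeral of_nat_le_iff order_trans zero_le_numeral)
  have zero: "\<zero>\<^bsub>ratfun_field\<^esub> = 0" by (simp add: ratfun_field_def)
  obtain m0 where m0: "P m0 \<noteq> 0" "n \<in># m0"
    using diff_order_geD(1)[OF ring_ratfun_field _ n(1)] finP by (auto simp: zero)
  have Pvars: "set_mset m \<subseteq> {..n}" if "P m \<noteq> 0" for m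
    using diff_order_geD(2)[OF ring_ratfun_field _ n(1), of m] finP that by (auto simp: zero)

  have P0: "mp_eval (?u \<circ> P) (\<lambda>i. (D ^^ i) ?\<phi>) = 0"
  proof -
    \<comment> \<open>Since \<open>z\<close> avoids all poles, every coefficient of the equation has
      a Taylor expansion there.\<close>
    have "\<forall>m. \<exists>F. (\<lambda>w. ratfun_eval (P m) (z + w)) has_fps_expansion F \<and> ?u (P m) = germ \<sigma> F"
      using ratfun_germ_expansion[OF D \<sigma>, of _ z] z by blast
    then obtain C where C: "\<And>m. (\<lambda>w. ratfun_eval (P m) (z + w)) has_fps_expansion C m"
        "\<And>m. ?u (P m) = germ \<sigma> (C m)" by metis
    have "germ \<sigma> 0 = (\<Sum>m\<in>{m. P m \<noteq> 0}. germ \<sigma> (C m) *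
        (\<Prod>i\<in>set_mset m. germ \<sigma> ((fps_deriv ^^ i) (fps_expansion f z)) ^ count m i))"
    proof (rule germ_polynomial_relation[where h = "\<lambda>_. 0" and c = "\<lambda>m. ratfun_eval (P m)"
          and x = "\<lambda>i. (deriv ^^ i) f" and W = "?W" and z = z and D = D and C = C
          and S = "{m. P m \<noteq> 0}" and Y = "\<lambda>i. (fps_deriv ^^ i) (fps_expansion f z)", OF D \<sigma> W z])
      show "(\<lambda>w. 0) has_fps_expansion 0" for w :: complex by simp
      show "(\<lambda>w. ratfun_eval (P m) (z + w)) has_fps_expansion C m" for m by (rule C(1))
      show "(\<lambda>w. (deriv ^^ i) f (z + w)) has_fps_expansion (fps_deriv ^^ i) (fps_expansion f z)" for i
        by (rule has_fps_expansion_iterated_deriv[OF expand[OF assms(4)]])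
      fix y assume y: "y \<in> ?W"
      have sub: "{m. ratfun_eval (P m) y \<noteq> 0} \<subseteq> {m. P m \<noteq> 0}" by (auto simp: ratfun_eval_def)
      then have "finite {m. ratfun_eval (P m) y \<noteq> 0}" using finP finite_subset by blast
      then have "mp_eval (\<lambda>m. ratfun_eval (P m) y) (\<lambda>i. (deriv ^^ i) f y) = 0"
        using assms(8) y unfolding satisfies_ade_def by (auto simp: mpoly_eval_complex)
      then show "0 = (\<Sum>m\<in>{m. P m \<noteq> 0}. ratfun_eval (P m) y * (\<Prod>i\<in>set_mset m. (deriv ^^ i) f y ^ count m i))"
        using mp_eval_superset[OF finP sub] by simp
    qed
    also have "\<dots> = mp_eval (?u \<circ> P) (\<lambda>i. (D ^^ i) ?\<phi>)"
      by (simp add: mp_eval_def uP C(2)[symmetric] iterate_germ[OF D \<sigma>])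
    finally show ?thesis by (simp add: germ_hom)
  qed

  have Si: "Suc i \<in> {1..l}" using i(1) by simp
  \<comment> \<open>The chain polynomial of the next level as a univariate polynomial in its own
    function; the coordinate and the earlier functions are absorbed into coefficients from
    \<open>k i\<close>.\<close>
  obtain r where r: "\<And>d. coeff r d = mp_eval (coeff_wrt (\<lambda>m. ?e [:p (Suc i) m:]) (Suc i) d) ?y"
      "\<And>c. poly r c = mp_eval (\<lambda>m. ?e [:p (Suc i) m:]) (?y(Suc i := c))"
    by (rule mp_eval_univariate[OF p_support(1)[OF Si], of "Suc i" ?y]) (rule that)
  show False
  proof (rule no_minimal_dichotomy[OF D gen k, of i r "\<gamma> (Suc i)" ?\<phi> "?u \<circ> P" m0 n])
    show "k i \<subseteq> acl (range \<sigma>)"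
      unfolding k_def by (intro acl_mono) (auto simp: poly_germ_def germ_def \<gamma>_def)
    show "D x \<in> k i" if "x \<in> k i" for x using D_closed i(1) that by simp
    show "coeff r d \<in> k i" for d
      unfolding r(1)
    proof (rule mp_eval_ac_subfield[OF k])
      show "coeff_wrt (\<lambda>m. ?e [:p (Suc i) m:]) (Suc i) d m \<in> k i" for m
        using e_mem ac_subfield_0[OF k] by (simp add: coeff_wrt_def)
      fix m j assume m: "coeff_wrt (\<lambda>m. ?e [:p (Suc i) m:]) (Suc i) d m \<noteq> 0" "j \<in># m"
      then have "Suc i \<notin># m" "?e [:p (Suc i) (m + replicate_mset d (Suc i)):] \<noteq> 0"
        by (auto simp: coeff_wrt_def split: if_splits)
      moreover have "set_mset (m + replicate_mset d (Suc i)) \<subseteq> {0..Suc i}"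
        using p_support(2)[OF Si] calculation(2) by blast
      ultimately have "j \<le> i" using m(2) by (metis atLeastAtMost_iff le_SucE subsetD union_iff)
      then show "?y j \<in> k i" by (rule y_mem)
    qed
    show "D (\<gamma> (Suc i)) = poly r (\<gamma> (Suc i))"
      unfolding D_\<gamma>[OF Si] r(2) by (intro mp_eval_cong) simp
    have "range (\<lambda>c. ?e [:c:]) \<union> {?e [:0, 1:]} \<union> \<gamma> ` {1..Suc i} \<subseteq> insert (\<gamma> (Suc i)) (k i)"
      using gens[of i] by (auto simp: atLeastAtMostSuc_conv)
    then show "?\<phi> \<in> acl (insert (\<gamma> (Suc i)) (k i))" using i(3) acl_mono unfolding k_def[of "Suc i"] by blast
    show "?\<phi> \<notin> k i" by (rule i(2))
    show "mp_eval (?u \<circ> P) (\<lambda>i. (D ^^ i) ?\<phi>) = 0" by (rule P0)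
    show "finite {m. (?u \<circ> P) m \<noteq> 0}" using finP by (simp add: uP)
    show "(?u \<circ> P) m \<in> k i" for m using u_mem by simp
    show "(?u \<circ> P) m0 \<noteq> 0" using m0 by (simp add: uP)
    show "set_mset m \<subseteq> {..n}" if "(?u \<circ> P) m \<noteq> 0" for m using Pvars that by (simp add: uP)
    show "finite ({a. mp_eval (?u \<circ> P) (\<lambda>i. (D ^^ i) a) = 0} \<inter> ode_image D r N s) \<or>
        finite ({a. mp_eval (?u \<circ> P) (\<lambda>i. (D ^^ i) a) = 0} - ode_image D r N s)" for N s
      by (rule strongly_minimal_dichotomy[OF D gen ratfun_germ_hom assms(6)])
  qed (use m0 n in auto)
qed

end
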